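(* Let $G=(V,E)$ be a planar graph with maximum degree $\Delta(G)\geq 28$ that has no isolated edge. Then $\chi'_{\Sigma}(G)\leq \Delta(G)+1$; that is, there exists a proper edge colouring $c:E\to\{1,2,\ldots,\Delta(G)+1\}$ such that $\sum_{e\ni u}c(e)\neq\sum_{e\ni v}c(e)$ for every edge $uv\in E$.
   Context: An isolated edge of a graph is a connected component consisting of a single edge. A proper edge $k$-colouring of $G$ is a map $c:E\to\{1,\ldots,k\}$ assigning distinct colours to any two edges sharing an endpoint. Such a colouring is neighbour sum distinguishing if for every edge $uv$ the sums of colours of edges incident with $u$ and with $v$ differ. The neighbour sum distinguishing index $\chi'_{\Sigma}(G)$ of a graph $G$ without isolated edges is the least $k$ for which a neighbour sum distinguishing proper edge $k$-colouring of $G$ exists. *)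

theory Defs
  imports "HOL-Analysis.Analysis"
begin

definition simple_graph :: "'a set \<Rightarrow> 'a set set \<Rightarrow> bool" where
  "simple_graph V E \<longleftrightarrow> finite V \<and> (\<forall>e\<in>E. e \<subseteq> V \<and> card e = 2)"

definition incident_edges :: "'a set set \<Rightarrow> 'a \<Rightarrow> 'a set set" where
  "incident_edges E v = {e \<in> E. v \<in> e}"

definition graph_degree :: "'a set set \<Rightarrow> 'a \<Rightarrow> nat" where
  "graph_degree E v = card (incident_edges E v)"

text \<open>On a finite nonempty vertex set this is the maximum; the supremum of the
  empty set of naturals is 0, so the empty graph has maximum degree 0.\<close>

definition max_degree :: "'a set \<Rightarrow> 'a set set \<Rightarrow> nat" where
  "max_degree V E = (SUP v\<in>V. graph_degree E v)"

definition connected_relation :: "'a set \<Rightarrow> 'a set set \<Rightarrow> ('a \<times> 'a) set" where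
  "connected_relation V E = {(u, v). {u, v} \<in> E}\<^sup>* \<inter> V \<times> V"

definition graph_components :: "'a set \<Rightarrow> 'a set set \<Rightarrow> 'a set set" where
  "graph_components V E = V // connected_relation V E"

text \<open>A component is represented by its vertex set \<open>C\<close>; its edges are the edges
  of the graph contained in \<open>C\<close>.\<close>

definition isolated_edge :: "'a set \<Rightarrow> 'a set set \<Rightarrow> 'a set \<Rightarrow> bool" where
  "isolated_edge V E e \<longleftrightarrow> (\<exists>C\<in>graph_components V E. {f \<in> E. f \<subseteq> C} = {e})"

text \<open>The plane is the type of complex numbers. A drawing sends vertices injectively to
  points and edges to arcs (injective continuous images of the unit interval) joining
  the images of their ends. An arc passes through no other vertex, and two arcs
  meet at most in the images of common ends of their edges.\<close>

definition plane_drawing ::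
  "'a set \<Rightarrow> 'a set set \<Rightarrow> ('a \<Rightarrow> complex) \<Rightarrow> ('a set \<Rightarrow> real \<Rightarrow> complex) \<Rightarrow> bool" where
  "plane_drawing V E p \<gamma> \<longleftrightarrow>
     inj_on p V \<and>
     (\<forall>e\<in>E. arc (\<gamma> e) \<and> {pathstart (\<gamma> e), pathfinish (\<gamma> e)} = p ` e \<and>
        path_image (\<gamma> e) \<inter> p ` V = p ` e) \<and>
     (\<forall>e\<in>E. \<forall>f\<in>E. e \<noteq> f \<longrightarrow> path_image (\<gamma> e) \<inter> path_image (\<gamma> f) \<subseteq> p ` (e \<inter> f))"

definition planar :: "'a set \<Rightarrow> 'a set set \<Rightarrow> bool" where
  "planar V E \<longleftrightarrow> (\<exists>p \<gamma>. plane_drawing V E p \<gamma>)"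

definition proper_edge_colouring :: "'a set set \<Rightarrow> nat \<Rightarrow> ('a set \<Rightarrow> nat) \<Rightarrow> bool" where
  "proper_edge_colouring E k c \<longleftrightarrow>
     c ` E \<subseteq> {1..k} \<and>
     (\<forall>e\<in>E. \<forall>f\<in>E. e \<noteq> f \<longrightarrow> e \<inter> f \<noteq> {} \<longrightarrow> c e \<noteq> c f)"

definition nsd_colouring :: "'a set set \<Rightarrow> nat \<Rightarrow> ('a set \<Rightarrow> nat) \<Rightarrow> bool" where
  "nsd_colouring E k c \<longleftrightarrow>
     proper_edge_colouring E k c \<and>
     (\<forall>u v. {u, v} \<in> E \<longrightarrow>
        (\<Sum>e\<in>incident_edges E u. c e) \<noteq> (\<Sum>e\<in>incident_edges E v. c e))"

text \<open>Meaningful only if some \<open>k\<close> admits such a colouring: \<open>LEAST\<close> is unspecified otherwise.\<close>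

definition nsd_index :: "'a set set \<Rightarrow> nat" where
  "nsd_index E = (LEAST k. \<exists>c. nsd_colouring E k c)"

end

theory Submission
  imports Defs
begin

text \<open>
  Write \<open>k = \<Delta> + 1 \<ge> 29\<close> and consider a counterexample with the fewest edges. Call an edge light if
  its ends have total degree less than \<open>k / 2 + 2\<close>: a coloured graph extends over a light edge
  greedily, provided the sums of its ends differ beforehand. Hence light edges form a matching, and
  adjacent vertices of degree at most 8 are matched. At a vertex of large degree one deletes all
  edges to neighbours of degree at most 2 (or one edge per pair of matched neighbours) and recolours
  them simultaneously. Systems of distinct representatives of colour lists have many different sums,
  so all conflicts at the vertex can be avoided unless its neighbourhood is rich: contracting matched
  pairs, a vertex of degree at least 12 with two or more neighbours of degree at most 8 is linked to
  at least 12 objects, each of them a big vertex (adjacent, or joined through contracted small vertices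
  of degree 2) or a contracted small vertex with at least three big neighbours. A planar minor with
  \<open>n\<close> vertices has fewer than \<open>3 n\<close> edges, and fewer than \<open>2 n\<close> if it is
  bipartite; adding both bounds contradicts this lower bound.

  The bounds for minors are instances of Euler's inequality with edge weights, in which the weight of
  each edge set of minimum degree 2 is bounded below. It holds because by Janiszewski's theorem each
  edge borders at most two faces, while the edges bordering a face cannot form a forest if there is
  another face.
\<close>

section \<open>Topology of plane drawings\<close>

text \<open>The bound 28 comes from the vertices of degree at most 8: 2 * (8 + 8) < k + 4 holds from
  k = 29 on, so that all edges between them are light and contract to disjoint bags of at most two
  vertices. Minors are never drawn. Edges to be contracted stay in the given drawing with weight 0,
  the remaining edges have weight 1, and only the weight of edge sets of minimum degree 2 has to be
  estimated. Counting sums is strong as long as \<open>k - deg w\<close> is not small compared with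
  \<open>deg w\<close>. Beyond that, two situations need separate arguments. For neighbours of
  degree at most 2, the failure of the recolouring exposes one common forbidden colour, which is
  then traced to distinct vertices. For diamonds (two adjacent vertices of degree 3 with the same
  two other neighbours) an exchange of colours at \<open>w\<close> shows that there is at most one,
  and none beside neighbours of degree at most 2. The number \<open>k\<close> is a fixed strict
  bound on the degrees, not tied to the maximum degree of the current graph, and isolated edges are
  exempt; thus deleting edges stays within the induction.\<close>

lemma interior_arc_empty:
  fixes g :: "real \<Rightarrow> complex"
  assumes "arc g"
  shows "interior (path_image g) = {}"
proof (rule ccontr)
  assume ne: "interior (path_image g) \<noteq> {}"
  obtain h where h: "homeomorphism {0..1} (path_image g) g h"
    using homeomorphism_arc[OF assms] by blast
  have "inj_on h (path_image g)" "continuous_on (path_image g) h"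
    using h by (auto simp: homeomorphism_def intro: inj_on_inverseI)
  then have "DIM(complex) \<le> DIM(real)"
    using ne by (intro invariance_of_dimension[of "interior (path_image g)" h])
      (auto intro: continuous_on_subset[OF _ interior_subset] inj_on_subset[OF _ interior_subset])
  then show False by simp
qed

text \<open>Janiszewski's theorem: two points separated neither by a compact nor by a closed set are
  not separated by the union if the intersection is connected. An arc alone separates nothing, and
  an intersection of at most one point is connected.\<close>

lemma connected_component_add_arc:
  fixes g :: "real \<Rightarrow> complex"
  assumes "arc g" "compact K" "K \<inter> path_image g \<subseteq> {z}"
    and "connected_component (- K) x y" "x \<notin> path_image g" "y \<notin> path_image g"
  shows "connected_component (- (K \<union> path_image g)) x y"
proof (rule Janiszewski)
  show "connected (K \<inter> path_image g)"
    using assms(3) by (metis connected_empty connected_sing subset_singletonD)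
  have "connected (- path_image g)"
    using assms(1) connected_arc_complement by force
  then show "connected_component (- path_image g) x y"
    using assms(5,6) by (metis ComplI connected_iff_connected_component)
qed (use assms closed_arc_image in auto)

text \<open>Substitute for cycles: an edge set of a simple graph without core subset is a forest.
  Minimum degree 2, unlike being a cycle, passes to contractions by a degree count.\<close>

definition core :: "'a set set \<Rightarrow> bool" where
  "core C \<longleftrightarrow> C \<noteq> {} \<and> (\<forall>v\<in>\<Union>C. 2 \<le> card {e\<in>C. v \<in> e})"

section \<open>Plane drawings as point sets\<close>

locale drawing =
  fixes V :: "'a set" and E :: "'a set set" and p :: "'a \<Rightarrow> complex"
    and \<gamma> :: "'a set \<Rightarrow> real \<Rightarrow> complex"
  assumes simple: "simple_graph V E" and drawn: "plane_drawing V E p \<gamma>"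
begin

abbreviation curve :: "'a set \<Rightarrow> complex set" where
  "curve e \<equiv> path_image (\<gamma> e)"

definition K :: "'a set set \<Rightarrow> complex set" where
  "K D = (\<Union>e\<in>D. curve e)"

definition open_curve :: "'a set \<Rightarrow> complex set" where
  "open_curve e = curve e - p ` e"

lemma finV: "finite V" and edge_sub: "e \<in> E \<Longrightarrow> e \<subseteq> V" and edge_card: "e \<in> E \<Longrightarrow> card e = 2"
  using simple by (auto simp: simple_graph_def)

lemma finE: "finite E"
  by (rule finite_subset[of _ "Pow V"]) (use edge_sub finV in auto)

lemma edgeE:
  assumes "e \<in> E" obtains a b where "e = {a,b}" "a \<noteq> b" "a \<in> V" "b \<in> V"
proof -
  obtain a b where "e = {a,b}" "a \<noteq> b" using edge_card[OF assms] by (meson card_2_iff)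
  then show ?thesis using that edge_sub[OF assms] by auto
qed

lemma inj_p: "inj_on p V"
  and arc_curve: "e \<in> E \<Longrightarrow> arc (\<gamma> e)"
  and curve_ends: "e \<in> E \<Longrightarrow> {pathstart (\<gamma> e), pathfinish (\<gamma> e)} = p ` e"
  and curve_vertices: "e \<in> E \<Longrightarrow> curve e \<inter> p ` V = p ` e"
  and curves_meet: "e \<in> E \<Longrightarrow> f \<in> E \<Longrightarrow> e \<noteq> f \<Longrightarrow> curve e \<inter> curve f \<subseteq> p ` (e \<inter> f)"
  using drawn unfolding plane_drawing_def by auto

lemma curve_meet_K:
  assumes "D \<subseteq> E" "e \<in> E" "e \<notin> D"
  shows "K D \<inter> curve e \<subseteq> p ` (e \<inter> \<Union>D)"
proof
  fix x assume "x \<in> K D \<inter> curve e"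
  then obtain f where f: "f \<in> D" "x \<in> curve f" "x \<in> curve e" by (auto simp: K_def)
  then have "x \<in> p ` (e \<inter> f)" using curves_meet[of e f] assms by auto
  then show "x \<in> p ` (e \<inter> \<Union>D)" using f by auto
qed

lemma compact_K: "D \<subseteq> E \<Longrightarrow> compact (K D)"
  unfolding K_def using finE arc_curve
  by (intro compact_UN) (auto intro: finite_subset compact_arc_image)

lemma closed_K: "D \<subseteq> E \<Longrightarrow> closed (K D)"
  by (simp add: compact_K compact_imp_closed)

lemma K_mono: "D \<subseteq> D' \<Longrightarrow> K D \<subseteq> K D'"
  by (auto simp: K_def)

lemma open_curve:
  assumes "e \<in> E" shows "connected (open_curve e)" "open_curve e \<noteq> {}" "open_curve e \<subseteq> curve e"
    "open_curve e \<inter> p ` V = {}"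
proof -
  have "open_curve e = curve e - {pathstart (\<gamma> e), pathfinish (\<gamma> e)}"
    using curve_ends[OF assms] by (simp add: open_curve_def)
  then show "connected (open_curve e)" "open_curve e \<noteq> {}"
    using arc_curve[OF assms] arc_imp_simple_path connected_simple_path_endless
      nonempty_simple_path_endless by metis+
  show "open_curve e \<subseteq> curve e" by (auto simp: open_curve_def)
  show "open_curve e \<inter> p ` V = {}"
    using curve_vertices[OF assms] by (auto simp: open_curve_def)
qed

lemma open_curve_disjoint:
  assumes "D \<subseteq> E" "e \<in> E" "e \<notin> D" shows "open_curve e \<inter> K D = {}"
  using curve_meet_K[OF assms] by (auto simp: open_curve_def)

definition joined :: "'a set set \<Rightarrow> 'a \<Rightarrow> 'a \<Rightarrow> bool" where
  "joined D a b \<longleftrightarrow> (a, b) \<in> {(u, v). {u, v} \<in> D}\<^sup>*"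

lemma joined_path:
  assumes "D \<subseteq> E" "joined D a b" "a \<noteq> b"
  shows "\<exists>g. path g \<and> path_image g \<subseteq> K D \<and> pathstart g = p a \<and> pathfinish g = p b"
proof -
  have "a = b \<or> path_component (K D) (p a) (p b)"
    using assms(2) unfolding joined_def
  proof (induction rule: rtrancl_induct)
    case (step y z)
    then have e: "{y,z} \<in> D" by auto
    then have arc: "arc (\<gamma> {y,z})" and ends: "{pathstart (\<gamma> {y,z}), pathfinish (\<gamma> {y,z})} = {p y, p z}"
      using arc_curve curve_ends assms(1) by auto
    have *: "path_component (curve {y,z}) (pathstart (\<gamma> {y,z})) (pathfinish (\<gamma> {y,z}))"
      using arc_imp_path[OF arc] unfolding path_component_def by blast
    then have "path_component (curve {y,z}) (p y) (p z)"
      using ends path_component_sym[OF *] by (auto simp: doubleton_eq_iff)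
    then have yz: "path_component (K D) (p y) (p z)"
      by (rule path_component_of_subset[rotated]) (use e in \<open>auto simp: K_def\<close>)
    show ?case
      using step.IH yz path_component_trans[of "K D" "p a" "p y" "p z"] by blast
  qed simp
  then show ?thesis using assms(3) by (auto simp: path_component_def)
qed

lemma joined_refl: "joined D a a"
  and joined_trans: "joined D a b \<Longrightarrow> joined D b c \<Longrightarrow> joined D a c"
  and joined_edge: "{a,b} \<in> D \<Longrightarrow> joined D a b"
  by (auto simp: joined_def)

lemma joined_mono:
  assumes "D \<subseteq> D'" "joined D a b" shows "joined D' a b"
proof -
  have "{(u, v). {u, v} \<in> D}\<^sup>* \<subseteq> {(u, v). {u, v} \<in> D'}\<^sup>*"
    by (rule rtrancl_mono) (use assms in auto)
  then show ?thesis using assms(2) unfolding joined_def by blast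
qed

lemma joined_sym: "joined D a b \<Longrightarrow> joined D b a"
proof -
  have "sym {(u, v). {u, v} \<in> D}" by (auto simp: sym_def insert_commute)
  then show "joined D a b \<Longrightarrow> joined D b a"
    unfolding joined_def using sym_rtrancl symD by metis
qed

text \<open>A connection of the ends within \<open>K D\<close> contains an arc, and the edge closes
  it to a Jordan curve because it meets \<open>K D\<close> only in its ends. Hence the curve meets
  \<open>K D\<close> exactly in that arc; this is the connectedness required by Janiszewski's
  theorem.\<close>

lemma cycle_curve:
  assumes "D \<subseteq> E" "{a,b} \<in> E" "{a,b} \<notin> D" "joined D a b"
  obtains c where "simple_path c" "pathfinish c = pathstart c" "path_image c \<subseteq> K D \<union> curve {a,b}"
    "curve {a,b} \<subseteq> path_image c" "connected (path_image c \<inter> K D)"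
proof -
  let ?e = "{a,b}"
  have ab: "a \<noteq> b" "a \<in> V" "b \<in> V" using edge_card[OF assms(2)] edge_sub[OF assms(2)] by auto
  then have pab: "p a \<noteq> p b" using inj_p by (auto simp: inj_on_def)
  obtain g0 where "path g0" "path_image g0 \<subseteq> K D" "pathstart g0 = p a" "pathfinish g0 = p b"
    using joined_path[OF assms(1,4) ab(1)] by blast
  then obtain g where g: "arc g" "path_image g \<subseteq> K D" "pathstart g = p a" "pathfinish g = p b"
    using pab path_contains_arc by (metis subset_trans)
  have ce: "arc (\<gamma> ?e)" "{pathstart (\<gamma> ?e), pathfinish (\<gamma> ?e)} = {p a, p b}"
    using arc_curve[OF assms(2)] curve_ends[OF assms(2)] by auto
  obtain h where h: "arc h" "path_image h = curve ?e" "pathstart h = p b" "pathfinish h = p a"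
  proof (cases "pathstart (\<gamma> ?e) = p b")
    case True then show ?thesis using that[of "\<gamma> ?e"] ce pab by (auto simp: doubleton_eq_iff)
  next
    case False then show ?thesis
      using that[of "reversepath (\<gamma> ?e)"] ce pab by (auto simp: doubleton_eq_iff arc_reversepath)
  qed
  have meet: "K D \<inter> curve ?e \<subseteq> {p a, p b}"
    using curve_meet_K[OF assms(1-3)] by auto
  have gends: "{p a, p b} \<subseteq> path_image g"
    using g(3,4) pathstart_in_path_image[of g] pathfinish_in_path_image[of g] by auto
  show ?thesis
  proof (rule that[of "g +++ h"])
    show "simple_path (g +++ h)"
      by (rule simple_path_join_loop) (use g h meet in auto)
    have img: "path_image (g +++ h) = path_image g \<union> curve ?e"
      using g h by (simp add: path_image_join)
    have "path_image (g +++ h) \<inter> K D = path_image g"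
      using img g(2) meet gends by blast
    then show "connected (path_image (g +++ h) \<inter> K D)"
      using g(1) by (simp add: connected_arc_image)
    show "path_image (g +++ h) \<subseteq> K D \<union> curve {a, b}" "curve {a, b} \<subseteq> path_image (g +++ h)"
      using img g(2) by auto
  qed (use g h in auto)
qed

text \<open>The edge is added to the part of \<open>D\<close> reachable from \<open>a\<close>, which
  it meets in \<open>p a\<close> at most, and then the rest of \<open>D\<close> is added, which
  meets the result in \<open>p b\<close> at most. Neither addition separates.\<close>

lemma bridge_no_separation:
  assumes D: "D \<subseteq> E" "{a,b} \<in> E" "{a,b} \<notin> D" "\<not> joined D a b"
    and xy: "connected_component (- K D) x y" "x \<notin> curve {a,b}" "y \<notin> curve {a,b}"
  shows "connected_component (- K (insert {a,b} D)) x y"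
proof -
  define D1 D2 where "D1 = {f\<in>D. \<exists>v\<in>f. joined D a v}" and "D2 = D - D1"
  have sub: "D1 \<subseteq> E" "D2 \<subseteq> E" "D1 \<subseteq> D" "D2 \<subseteq> D" "D = D1 \<union> D2"
    using D(1) by (auto simp: D1_def D2_def)
  have D1V: "joined D a v" if "f \<in> D1" "v \<in> f" for f v
  proof -
    obtain u where u: "f \<in> D" "u \<in> f" "joined D a u" using \<open>f \<in> D1\<close> by (auto simp: D1_def)
    obtain s t where "f = {s,t}" using u(1) D(1) by (meson edgeE in_mono)
    then have "u = v \<or> f = {u,v}" using u \<open>v \<in> f\<close> by auto
    then show ?thesis using u joined_edge[of u v D] joined_trans[of D a u v] by auto
  qed
  have D2V: "\<not> joined D a v" if "f \<in> D2" "v \<in> f" for f v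
    using that by (auto simp: D1_def D2_def)
  have bD1: "b \<notin> \<Union>D1" using D1V D(4) by auto
  have aD2: "a \<notin> \<Union>D2" using D2V joined_refl by blast
  have 1: "K D1 \<inter> curve {a,b} \<subseteq> {p a}"
    using curve_meet_K[of D1 "{a,b}"] sub D bD1 by blast
  have 2: "K D2 \<inter> curve {a,b} \<subseteq> {p b}"
    using curve_meet_K[of D2 "{a,b}"] sub D aD2 by blast
  have 3: "K D1 \<inter> K D2 = {}"
  proof -
    have "curve f \<inter> curve f' = {}" if f: "f \<in> D1" "f' \<in> D2" for f f'
    proof -
      have "f \<inter> f' = {}" using D1V D2V f by blast
      moreover have "f \<noteq> {}" using edge_card[of f] f(1) sub(1) by auto
      ultimately show ?thesis using curves_meet[of f f'] f sub by auto
    qed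
    then show ?thesis by (auto simp: K_def)
  qed
  have "connected_component (- K D1) x y" "connected_component (- K D2) x y"
    using xy(1) by (rule connected_component_of_subset; use sub in \<open>auto simp: K_def\<close>)+
  then have "connected_component (- (K D1 \<union> curve {a,b})) x y"
    using connected_component_add_arc[OF arc_curve[OF D(2)] compact_K[OF sub(1)] 1 _ xy(2,3)] by blast
  have "connected_component (- ((K D1 \<union> curve {a,b}) \<union> K D2)) x y"
  proof (rule Janiszewski)
    show "compact (K D1 \<union> curve {a,b})"
      using compact_K[OF sub(1)] arc_curve[OF D(2)] by (simp add: compact_Un compact_arc_image)
    show "closed (K D2)" using closed_K sub by auto
    have "(K D1 \<union> curve {a,b}) \<inter> K D2 \<subseteq> {p b}" using 2 3 by blast
    then show "connected ((K D1 \<union> curve {a,b}) \<inter> K D2)"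
      by (metis connected_empty connected_sing subset_singletonD)
  qed fact+
  moreover have "K (insert {a,b} D) = (K D1 \<union> curve {a,b}) \<union> K D2"
    using sub(5) by (auto simp: K_def)
  ultimately show ?thesis by simp
qed

section \<open>Faces, the edges they touch, and their number\<close>

definition faces :: "'a set set \<Rightarrow> complex set set" where
  "faces D = components (- K D)"

definition touches :: "complex set \<Rightarrow> 'a set \<Rightarrow> bool" where
  "touches F e \<longleftrightarrow> closure F \<inter> open_curve e \<noteq> {}"

text \<open>Once \<open>e\<close> is deleted, faces that touch it are connected with each other
  through its open curve.\<close>

lemma touching_faces_connected:
  assumes D: "D \<subseteq> E" "e \<in> E" "e \<notin> D"
    and F: "F \<in> faces (insert e D)" "touches F e" "x \<in> F"
    and G: "G \<in> faces (insert e D)" "touches G e" "y \<in> G"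
  shows "connected_component (- K D) x y"
proof -
  have ext: "\<exists>T. connected T \<and> z \<in> T \<and> T \<subseteq> - K D \<and> open_curve e \<subseteq> T"
    if H: "H \<in> faces (insert e D)" "touches H e" "z \<in> H" for H z
  proof -
    obtain w where w: "w \<in> closure H" "w \<in> open_curve e" using H(2) by (auto simp: touches_def)
    have conn: "connected H" and sub: "H \<subseteq> - K D"
      using H(1) in_components_connected in_components_subset K_mono[of D "insert e D"] unfolding faces_def by blast+
    have "connected (insert w H)"
      using connected_intermediate_closure[OF conn, of "insert w H"] w(1) closure_subset[of H] by auto
    then have "connected (insert w H \<union> open_curve e)"
      using open_curve(1)[OF D(2)] w(2) by (intro connected_Un) auto
    then show ?thesis
      using sub open_curve_disjoint[OF D] w H(3) by (intro exI[of _ "insert w H \<union> open_curve e"]) auto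
  qed
  obtain T where T: "connected T" "x \<in> T" "T \<subseteq> - K D" "open_curve e \<subseteq> T" using ext[OF F] by blast
  obtain T' where T': "connected T'" "y \<in> T'" "T' \<subseteq> - K D" "open_curve e \<subseteq> T'" using ext[OF G] by blast
  have "connected (T \<union> T')" using T T' open_curve(2)[OF D(2)] by (intro connected_Un) auto
  then show ?thesis using T T' unfolding connected_component_def
    by (intro exI[of _ "T \<union> T'"]) auto
qed

lemma same_face:
  assumes "F \<in> faces D" "G \<in> faces D" "x \<in> F" "y \<in> G" "connected_component (- K D) x y"
  shows "F = G"
proof -
  obtain T where T: "connected T" "T \<subseteq> - K D" "x \<in> T" "y \<in> T"
    using assms(5) by (auto simp: connected_component_def)
  have "T \<subseteq> F" "T \<subseteq> G"
    using assms(1-4) T components_maximal[of _ "- K D" T] unfolding faces_def by blast+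
  then show ?thesis
    using assms(1,2) T(3) components_nonoverlap[of F "- K D" G] unfolding faces_def by blast
qed

text \<open>If \<open>e\<close> closes a cycle, touching faces are told apart by their side of a
  Jordan curve through \<open>e\<close>: two on the same side are separated neither by the curve nor
  by the remaining edges, hence by nothing. If \<open>e\<close> is a bridge, all touching faces
  coincide. The injection into \<open>bool\<close> yields finiteness and the bound at once.\<close>

lemma touching_faces_le_2:
  assumes "D \<subseteq> E" "e \<in> D"
  shows "finite {F\<in>faces D. touches F e} \<and> card {F\<in>faces D. touches F e} \<le> 2"
proof -
  define D' where "D' = D - {e}"
  have D': "D' \<subseteq> E" "e \<in> E" "e \<notin> D'" "insert e D' = D" using assms by (auto simp: D'_def)
  obtain a b where e: "e = {a,b}" using edgeE[OF D'(2)] by metis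
  let ?S = "{F\<in>faces D. touches F e}"
  have ne: "F \<noteq> {}" "F \<inter> K D = {}" "connected F" if "F \<in> faces D" for F
    using that in_components_nonempty in_components_subset in_components_connected unfolding faces_def by blast+
  have "\<exists>h. inj_on (h :: complex set \<Rightarrow> bool) ?S"
  proof (cases "joined D' a b")
    case True
    then obtain c where c: "simple_path c" "pathfinish c = pathstart c" "path_image c \<subseteq> K D' \<union> curve e"
      "curve e \<subseteq> path_image c" "connected (path_image c \<inter> K D')"
      using cycle_curve[of D' a b] D' e by metis
    let ?C = "path_image c"
    have J: "connected (inside ?C)" "connected (outside ?C)" "inside ?C \<union> outside ?C = - ?C"
      "open (inside ?C)" "open (outside ?C)" "inside ?C \<inter> outside ?C = {}"
      using Jordan_inside_outside[OF c(1,2)] by auto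
    have Jsub: "inside ?C \<subseteq> - ?C" "outside ?C \<subseteq> - ?C" using J(3) by blast+
    have KD: "K D = ?C \<union> K D'" using c(3,4) D'(4) by (auto simp: K_def)
    have side: "F \<subseteq> inside ?C \<or> F \<subseteq> outside ?C" if "F \<in> faces D" for F
    proof -
      have "F \<subseteq> inside ?C \<union> outside ?C" using ne(2)[OF that] J(3) KD by blast
      moreover from this have "inside ?C \<inter> F = {} \<or> outside ?C \<inter> F = {}"
        using J(6) by (intro connectedD[OF ne(3)[OF that] J(4,5)]) auto
      ultimately show ?thesis by blast
    qed
    have "inj_on (\<lambda>F. F \<subseteq> inside ?C) ?S"
    proof (rule inj_onI)
      fix F G assume FG: "F \<in> ?S" "G \<in> ?S" "(F \<subseteq> inside ?C) = (G \<subseteq> inside ?C)"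
      then have "F \<noteq> {}" "G \<noteq> {}" using ne(1)[of F] ne(1)[of G] by simp_all
      then obtain x y where xy: "x \<in> F" "y \<in> G" by auto
      have "connected_component (- ?C) x y"
      proof (cases "F \<subseteq> inside ?C")
        case True
        then have "G \<subseteq> inside ?C" using FG by simp
        then show ?thesis using xy True J(1) Jsub(1) unfolding connected_component_def by blast
      next
        case False
        then have "F \<subseteq> outside ?C" "G \<subseteq> outside ?C" using FG side by auto
        then show ?thesis using xy J(2) Jsub(2) unfolding connected_component_def by blast
      qed
      moreover have "connected_component (- K D') x y"
        using touching_faces_connected[OF D'(1-3)] FG xy D'(4) by auto
      ultimately have "connected_component (- (?C \<union> K D')) x y"
        using c(1,5) closed_K[OF D'(1)] by (intro Janiszewski) (auto simp: compact_simple_path_image)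
      then have "connected_component (- K D) x y" unfolding KD .
      then show "F = G" using FG xy same_face[of F D G x y] by blast
    qed
    then show ?thesis by (intro exI[of _ "\<lambda>F. F \<subseteq> inside ?C"])
  next
    case False
    have "inj_on (\<lambda>F. True) ?S"
    proof (rule inj_onI)
      fix F G assume FG: "F \<in> ?S" "G \<in> ?S"
      then have "F \<noteq> {}" "G \<noteq> {}" using ne(1)[of F] ne(1)[of G] by simp_all
      then obtain x y where xy: "x \<in> F" "y \<in> G" by auto
      then have "x \<notin> curve e" "y \<notin> curve e"
        using FG ne(2)[of F] ne(2)[of G] assms(2) unfolding K_def by blast+
      moreover have "connected_component (- K D') x y"
        using touching_faces_connected[OF D'(1-3)] FG xy D'(4) by auto
      ultimately have "connected_component (- K D) x y"
        using bridge_no_separation[of D' a b x y] D' e False by auto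
      then show "F = G" using FG xy same_face[of F D G x y] by blast
    qed
    then show ?thesis by (intro exI[of _ "\<lambda>F. True"])
  qed
  then obtain h :: "complex set \<Rightarrow> bool" where h: "inj_on h ?S" ..
  have "finite ?S" using inj_on_finite[OF h, of UNIV] by simp
  moreover have "card ?S \<le> card (UNIV :: bool set)"
    using h by (intro card_inj_on_le[of h]) auto
  ultimately show ?thesis by simp
qed

text \<open>Induction on the number of edges: a set that is no core has a pendant edge, and this
  edge meets the rest of the drawing in at most one point.\<close>

lemma no_core_connected:
  assumes "D \<subseteq> E" "\<And>C. C \<subseteq> D \<Longrightarrow> \<not> core C"
  shows "connected (- K D)"
proof -
  have "finite D" using assms(1) finE finite_subset by blast
  then show ?thesis using assms
  proof (induction "card D" arbitrary: D)
    case 0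
    then have "K D = {}" by (auto simp: K_def)
    then show ?case by (simp add: connected_UNIV)
  next
    case (Suc n)
    then have "D \<noteq> {}" "\<not> core D" by auto
    then obtain v where v: "v \<in> \<Union>D" "card {e\<in>D. v \<in> e} < 2" by (auto simp: core_def not_le)
    then obtain e where e: "e \<in> D" "v \<in> e" by auto
    have "{e'\<in>D. v \<in> e'} = {e}"
    proof -
      have "card {e'\<in>D. v \<in> e'} \<le> card {e}" using v(2) by simp
      then show ?thesis using e Suc.prems(1) card_seteq[of "{e'\<in>D. v \<in> e'}" "{e}"] by auto
    qed
    then have vD: "v \<notin> \<Union>(D - {e})" by auto
    define D' where "D' = D - {e}"
    have D': "D' \<subseteq> E" "e \<in> E" "e \<notin> D'" "insert e D' = D" using e Suc.prems by (auto simp: D'_def)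
    have conn: "connected (- K D')"
      by (rule Suc.hyps(1)) (use Suc.prems Suc.hyps(2) e in \<open>auto simp: D'_def\<close>)
    obtain a where a: "e = {v, a}" using edgeE[OF D'(2)] e by (metis doubleton_eq_iff insertE singletonD)
    have "K D' \<inter> curve e \<subseteq> {p a}"
      using curve_meet_K[OF D'(1-3)] vD a by (auto simp: D'_def)
    then have add: "connected_component (- (K D' \<union> curve e)) x y"
      if "x \<notin> K D' \<union> curve e" "y \<notin> K D' \<union> curve e" for x y
      using connected_component_add_arc[OF arc_curve[OF D'(2)] compact_K[OF D'(1)]] conn that
      by (metis ComplI UnCI connected_iff_connected_component)
    then have "connected (- (K D' \<union> curve e))"
      unfolding connected_iff_connected_component by blast
    moreover have "K D = K D' \<union> curve e" using D'(4) by (auto simp: K_def)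
    ultimately show ?case by simp
  qed
qed

lemma faces_facts:
  assumes "D \<subseteq> E" "F \<in> faces D"
  shows "open F" "F \<noteq> {}" "connected F" "F \<inter> K D = {}" "frontier F \<subseteq> K D"
  using assms(2) closed_K[OF assms(1)] in_components_nonempty in_components_connected
    in_components_subset[of F "- K D"] frontier_of_components_closed_complement open_components
  unfolding faces_def by blast+

text \<open>If the touched edges formed a forest, the complement of their curves would be connected,
  even after removal of the finitely many vertex points. The vertices are removed because touching
  refers to open curves: every other frontier point of \<open>F\<close> lies on a touched edge. So
  \<open>F\<close> has no frontier in this complement, fills it, and leaves no room for
  \<open>F'\<close>.\<close>

lemma touched_core:
  assumes D: "D \<subseteq> E" and F: "F \<in> faces D" "F' \<in> faces D" "F \<noteq> F'"
  shows "\<exists>C\<subseteq>{e\<in>D. touches F e}. core C"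
proof (rule ccontr)
  let ?T = "{e\<in>D. touches F e}"
  let ?W = "- K ?T - p ` \<Union>D"
  assume "\<not> ?thesis"
  then have "connected (- K ?T)" using D by (intro no_core_connected) auto
  moreover have "open (- K ?T)" using D by (intro open_Compl closed_K) auto
  ultimately have conn: "connected ?W"
    using finV edge_sub D by (intro connected_open_delete_finite) (auto intro: finite_subset)
  have pV: "p ` \<Union>D \<subseteq> K D"
  proof
    fix z assume "z \<in> p ` \<Union>D"
    then obtain v e where v: "z = p v" "v \<in> e" "e \<in> D" by auto
    then have "p v \<in> curve e" using curve_vertices[of e] D by auto
    then show "z \<in> K D" using v by (auto simp: K_def)
  qed
  have sub: "F \<subseteq> ?W" "F' \<subseteq> ?W"
    using faces_facts(4)[OF D F(1)] faces_facts(4)[OF D F(2)] pV K_mono[of ?T D] by blast+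
  have "frontier F \<inter> ?W = {}"
  proof (rule ccontr)
    assume "frontier F \<inter> ?W \<noteq> {}"
    then obtain z where z: "z \<in> frontier F" "z \<notin> K ?T" "z \<notin> p ` \<Union>D" by auto
    then obtain e where e: "e \<in> D" "z \<in> curve e" using faces_facts(5)[OF D F(1)] by (auto simp: K_def)
    then have "z \<in> open_curve e" using z(3) by (auto simp: open_curve_def)
    then have "touches F e" using z(1) unfolding touches_def frontier_def by auto
    then show False using e z(2) by (auto simp: K_def)
  qed
  moreover have "?W \<inter> F \<noteq> {}"
    using sub(1) faces_facts(2)[OF D F(1)] by (simp add: Int_absorb1)
  ultimately have "?W - F = {}"
    using connected_Int_frontier[OF conn, of F] by (metis Int_commute)
  then have "F' \<subseteq> F" using sub(2) by auto
  moreover have "F \<inter> F' = {}"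
    using F components_nonoverlap[of F "- K D" F'] unfolding faces_def by simp
  ultimately show False using faces_facts(2)[OF D F(2)] by auto
qed

lemma finite_faces:
  assumes D: "D \<subseteq> E"
  shows "finite (faces D)"
proof (cases "\<exists>F\<in>faces D. \<exists>F'\<in>faces D. F \<noteq> F'")
  case True
  have "faces D \<subseteq> (\<Union>e\<in>D. {F\<in>faces D. touches F e})"
  proof
    fix F assume F: "F \<in> faces D"
    then obtain F' where "F' \<in> faces D" "F \<noteq> F'" using True by metis
    then obtain C where "C \<subseteq> {e\<in>D. touches F e}" "core C" using touched_core[OF D F] by metis
    then show "F \<in> (\<Union>e\<in>D. {F\<in>faces D. touches F e})" using F unfolding core_def by blast
  qed
  then show ?thesis
    using touching_faces_le_2[OF D] finE D by (elim finite_subset) (auto intro: finite_subset)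
next
  case False
  then show ?thesis by (metis finite.emptyI finite.insertI ex_in_conv insertI1 finite_subset subsetI)
qed

lemma face_of_point:
  assumes "D \<subseteq> E" "x \<notin> K D" obtains F where "F \<in> faces D" "x \<in> F"
  using assms(2) that[of "connected_component_set (- K D) x"] connected_component_refl[of x "- K D"]
  unfolding faces_def by (simp add: componentsI)

text \<open>Every new face lies in exactly one old face. This map is onto, as an old face is open
  and an arc has empty interior. If the edge closes a cycle the map is not injective: a small ball
  around an inner point of the edge lies in one old face but contains points on both sides of the
  Jordan curve.\<close>

lemma faces_insert:
  assumes D: "D \<subseteq> E" "{a,b} \<in> E" "{a,b} \<notin> D"
  shows "card (faces D) \<le> card (faces (insert {a,b} D))"
    and "joined D a b \<Longrightarrow> card (faces D) < card (faces (insert {a,b} D))"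
proof -
  let ?e = "{a,b}"
  define D' where "D' = insert ?e D"
  have D': "D' \<subseteq> E" "D \<subseteq> D'" "K D' = K D \<union> curve ?e" using D by (auto simp: D'_def K_def)
  have "\<exists>U\<in>faces D. F \<subseteq> U" if F: "F \<in> faces D'" for F
  proof -
    obtain x where x: "x \<in> F" using faces_facts(2)[OF D'(1) F] by blast
    have sub: "F \<subseteq> - K D" using faces_facts(4)[OF D'(1) F] D'(3) by auto
    then obtain U where "U \<in> faces D" "x \<in> U" using x face_of_point[OF D(1)] by (metis ComplD subsetD)
    then show ?thesis
      using components_maximal[of U "- K D" F] faces_facts(3)[OF D'(1) F] sub x unfolding faces_def by blast
  qed
  then obtain \<Phi> where \<Phi>: "\<And>F. F \<in> faces D' \<Longrightarrow> \<Phi> F \<in> faces D \<and> F \<subseteq> \<Phi> F" by metis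
  have \<Phi>eq: "\<Phi> F = U" if "F \<in> faces D'" "U \<in> faces D" "x \<in> F" "x \<in> U" for F U x
    using \<Phi>[OF that(1)] that components_nonoverlap[of "\<Phi> F" "- K D" U] unfolding faces_def by blast
  have fin: "finite (faces D')" using finite_faces D' by blast
  have surj: "faces D \<subseteq> \<Phi> ` faces D'"
  proof
    fix U assume U: "U \<in> faces D"
    have "\<not> U \<subseteq> curve ?e"
      using interior_arc_empty[OF arc_curve[OF D(2)]] faces_facts(1,2)[OF D(1) U] interior_maximal by blast
    then obtain x where x: "x \<in> U" "x \<notin> curve ?e" by auto
    moreover have "x \<notin> K D" using faces_facts(4)[OF D(1) U] x by auto
    ultimately obtain F where F: "F \<in> faces D'" "x \<in> F" using face_of_point[OF D'(1)] D'(3) by auto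
    then show "U \<in> \<Phi> ` faces D'" using \<Phi>eq[OF F(1) U F(2) x(1)] by blast
  qed
  have "card (faces D) \<le> card (\<Phi> ` faces D')" using surj fin by (simp add: card_mono)
  also have le: "\<dots> \<le> card (faces D')" using fin card_image_le by blast
  finally show "card (faces D) \<le> card (faces (insert ?e D))" unfolding D'_def .
  assume "joined D a b"
  then obtain c where c: "simple_path c" "pathfinish c = pathstart c" "path_image c \<subseteq> K D \<union> curve ?e"
      "curve ?e \<subseteq> path_image c"
    using cycle_curve[OF D] by metis
  let ?C = "path_image c"
  have J: "frontier (inside ?C) = ?C" "frontier (outside ?C) = ?C" "inside ?C \<inter> outside ?C = {}"
      "open (inside ?C)" "open (outside ?C)"
    using Jordan_inside_outside[OF c(1,2)] by auto
  have J': "inside ?C \<union> outside ?C = - ?C"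
    using Jordan_inside_outside[OF c(1,2)] by blast
  obtain z where z: "z \<in> open_curve ?e" using open_curve(2)[OF D(2)] by auto
  then have "z \<in> - K D" "z \<in> ?C" using open_curve_disjoint[OF D] open_curve(3)[OF D(2)] c(4) by blast+
  moreover have "open (- K D)" using closed_K[OF D(1)] by auto
  ultimately obtain r where r: "r > 0" "ball z r \<subseteq> - K D" by (meson openE)
  have zcl: "z \<in> closure (inside ?C)" "z \<in> closure (outside ?C)"
    using \<open>z \<in> ?C\<close> J(1,2) unfolding frontier_def by blast+
  obtain x where x: "x \<in> inside ?C" "x \<in> ball z r"
    using zcl(1) r(1) unfolding closure_approachable by (auto simp: dist_commute)
  obtain y where y: "y \<in> outside ?C" "y \<in> ball z r"
    using zcl(2) r(1) unfolding closure_approachable by (auto simp: dist_commute)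
  have xy: "x \<notin> ?C" "y \<notin> ?C" "x \<notin> K D" "y \<notin> K D" using x y J' r(2) by blast+
  then have "x \<notin> K D'" "y \<notin> K D'" using D'(3) c(4) by auto
  then obtain F G where FG: "F \<in> faces D'" "x \<in> F" "G \<in> faces D'" "y \<in> G"
    using face_of_point[OF D'(1)] by metis
  have "F \<noteq> G"
  proof
    assume "F = G"
    have "connected F" "F \<inter> ?C = {}" using faces_facts(3,4)[OF D'(1) FG(1)] c(3) D'(3) by auto
    then have "inside ?C \<inter> F = {} \<or> outside ?C \<inter> F = {}"
      using J(3) J' by (intro connectedD[OF _ J(4,5)]) blast+
    then show False using FG x y \<open>F = G\<close> by blast
  qed
  moreover have "\<Phi> F = \<Phi> G"
  proof (rule same_face)
    have "connected (ball z r)" by simp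
    then show "connected_component (- K D) x y"
      using x y r(2) unfolding connected_component_def by blast
  qed (use \<Phi> FG in blast)+
  ultimately have "\<not> inj_on \<Phi> (faces D')" using FG by (auto simp: inj_on_def)
  then have "card (\<Phi> ` faces D') < card (faces D')"
    using le fin eq_card_imp_inj_on by (metis le_neq_implies_less)
  moreover have "card (faces D) \<le> card (\<Phi> ` faces D')" using surj fin by (simp add: card_mono)
  ultimately show "card (faces D) < card (faces (insert ?e D))" unfolding D'_def by simp
qed

section \<open>Connected components and Euler's inequality\<close>

definition comps :: "'a set set \<Rightarrow> 'a set set" where
  "comps D = (\<lambda>a. {b\<in>V. joined D a b}) ` V"

definition merge :: "'a set set \<Rightarrow> 'a set \<Rightarrow> 'a set" where
  "merge D X = {b\<in>V. \<exists>a\<in>X. joined D a b}"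

lemma merge_comp:
  assumes "x \<in> V" "D \<subseteq> D'" shows "merge D' {b\<in>V. joined D x b} = {b\<in>V. joined D' x b}"
proof -
  have "joined D' x y" if "joined D x z" "joined D' z y" for y z
    using that joined_mono[OF assms(2), of x z] joined_trans by blast
  then show ?thesis using assms(1) joined_refl by (auto simp: merge_def)
qed

lemma comps_image: "comps (insert e D) = merge (insert e D) ` comps D"
  unfolding comps_def image_image by (intro image_cong refl merge_comp[symmetric] subset_insertI)

lemma comps_mono: "card (comps (insert e D)) \<le> card (comps D)"
  unfolding comps_image using finV by (intro card_image_le) (simp add: comps_def)

lemma comps_insert:
  assumes "{a,b} \<in> E" "\<not> joined D a b"
  shows "card (comps (insert {a,b} D)) < card (comps D)"
proof -
  let ?D' = "insert {a,b} D"
  have ab: "a \<in> V" "b \<in> V" using edge_sub[OF assms(1)] by auto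
  let ?A = "{v\<in>V. joined D a v}" and ?B = "{v\<in>V. joined D b v}"
  have "joined ?D' a b" by (rule joined_edge) simp
  then have "{v\<in>V. joined ?D' a v} = {v\<in>V. joined ?D' b v}"
    using joined_sym joined_trans by blast
  then have "merge ?D' ?A = merge ?D' ?B"
    using merge_comp[OF ab(1), of D ?D'] merge_comp[OF ab(2), of D ?D'] by auto
  moreover have "?A \<noteq> ?B" using assms(2) ab joined_refl by blast
  ultimately have "\<not> inj_on (merge ?D') (comps D)" using ab by (auto simp: inj_on_def comps_def)
  moreover have "finite (comps D)" using finV by (simp add: comps_def)
  ultimately show ?thesis
    unfolding comps_image using card_image_le[of "comps D" "merge ?D'"] eq_card_imp_inj_on[of "comps D" "merge ?D'"]
    by (metis le_neq_implies_less)
qed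

text \<open>Induction over the edges: an edge whose ends are already joined creates a face, any
  other edge lowers the number of components.\<close>

lemma euler_ineq:
  assumes "D \<subseteq> E"
  shows "card D + card (comps D) + 1 \<le> card V + card (faces D)"
proof -
  have "finite D" using assms finE finite_subset by blast
  then show ?thesis using assms
  proof (induction D rule: finite_induct)
    case empty
    have "K {} = {}" by (simp add: K_def)
    then have "faces {} = {UNIV}" by (simp add: faces_def connected_UNIV components_eq_sing_iff)
    moreover have "card (comps {}) \<le> card V" unfolding comps_def using finV card_image_le by blast
    ultimately show ?case by simp
  next
    case (insert e D)
    then obtain a b where e: "e = {a,b}" using edgeE by (metis insert_subset)
    then have e': "{a,b} \<in> E" "{a,b} \<notin> D" "D \<subseteq> E" using insert by auto
    have card: "card (insert e D) = Suc (card D)" using insert by simp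
    show ?case
    proof (cases "joined D a b")
      case True
      then show ?thesis
        using faces_insert(2)[OF e'(3,1,2) True] comps_mono[of e D] insert.IH e' card e by simp
    next
      case False
      then show ?thesis
        using faces_insert(1)[OF e'(3,1,2)] comps_insert[OF e'(1) False] insert.IH e' card e by simp
    qed
  qed
qed

text \<open>Each face touches a core, hence weight at least \<open>W\<close>, and each edge is
  touched at most twice; so \<open>W\<close> times the number of faces is at most twice the total
  weight. A single face need not touch a core. Then Euler's inequality alone gives the claim, and
  this case fixes the 1 on the left.\<close>

theorem weighted_euler:
  fixes \<omega> :: "'a set \<Rightarrow> nat"
  assumes W: "\<And>C. C \<subseteq> E \<Longrightarrow> core C \<Longrightarrow> W \<le> sum \<omega> C" and V: "V \<noteq> {}"
  shows "W * (card E + 1) \<le> 2 * sum \<omega> E + W * card V"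
proof -
  have "comps E \<noteq> {}" using V by (simp add: comps_def)
  then have "card (comps E) \<ge> 1" using finV by (simp add: comps_def card_gt_0_iff Suc_le_eq)
  then have euler: "card E + 2 \<le> card V + card (faces E)" using euler_ineq[of E] by simp
  have fin: "finite (faces E)" using finite_faces by blast
  show ?thesis
  proof (cases "card (faces E) \<le> 1")
    case True
    then have "card E + 1 \<le> card V" using euler by simp
    then show ?thesis using mult_le_mono2 trans_le_add2 by blast
  next
    case False
    have "W \<le> (\<Sum>e\<in>E. if touches F e then \<omega> e else 0)" if F: "F \<in> faces E" for F
    proof -
      obtain F' where "F' \<in> faces E" "F \<noteq> F'"
        using False F fin by (metis card_le_Suc0_iff_eq One_nat_def)
      then obtain C where C: "C \<subseteq> {e\<in>E. touches F e}" "core C" using touched_core[of E F F'] F by blast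
      have "W \<le> sum \<omega> C" using C W by auto
      also have "\<dots> \<le> sum \<omega> {e\<in>E. touches F e}" using C(1) finE by (intro sum_mono2) auto
      also have "\<dots> = (\<Sum>e\<in>E. if touches F e then \<omega> e else 0)" using finE by (simp add: sum.If_cases Int_def)
      finally show ?thesis .
    qed
    then have "(\<Sum>F\<in>faces E. W) \<le> (\<Sum>F\<in>faces E. \<Sum>e\<in>E. if touches F e then \<omega> e else 0)"
      by (rule sum_mono)
    also have "\<dots> = (\<Sum>e\<in>E. \<Sum>F\<in>faces E. if touches F e then \<omega> e else 0)" by (rule sum.swap)
    also have "\<dots> = (\<Sum>e\<in>E. card {F\<in>faces E. touches F e} * \<omega> e)"
      using fin by (intro sum.cong) (simp_all add: sum.If_cases Int_def)
    also have "\<dots> \<le> (\<Sum>e\<in>E. 2 * \<omega> e)"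
      using touching_faces_le_2[of E] by (intro sum_mono mult_le_mono1) auto
    finally have "card (faces E) * W \<le> 2 * sum \<omega> E" by (simp add: sum_distrib_left)
    moreover have "W * (card E + 1) \<le> W * (card V + card (faces E))"
      using euler by (intro mult_le_mono2) simp
    ultimately show ?thesis by (simp add: algebra_simps)
  qed
qed

end

section \<open>Sparsity of planar minors\<close>

lemma sum_degrees_eq:
  assumes "finite X" "finite C"
  shows "(\<Sum>x\<in>X. card {e\<in>C. x \<in> e}) = (\<Sum>e\<in>C. card (e \<inter> X))"
proof -
  have "(\<Sum>x\<in>X. card {e\<in>C. x \<in> e}) = (\<Sum>x\<in>X. \<Sum>e\<in>C. if x \<in> e then 1 else 0)"
    using assms by (intro sum.cong) (simp_all add: sum.If_cases Int_def)
  also have "\<dots> = (\<Sum>e\<in>C. \<Sum>x\<in>X. if x \<in> e then 1 else 0)" by (rule sum.swap)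
  also have "\<dots> = (\<Sum>e\<in>C. card (e \<inter> X))"
    using assms by (intro sum.cong) (simp_all add: sum.If_cases Int_def conj_commute)
  finally show ?thesis .
qed

lemma drawing_subgraph:
  assumes "simple_graph V E" "planar V E" "V' \<subseteq> V" "E' \<subseteq> E" "\<And>e. e \<in> E' \<Longrightarrow> e \<subseteq> V'"
  obtains p \<gamma> where "drawing V' E' p \<gamma>"
proof -
  obtain p \<gamma> where d: "plane_drawing V E p \<gamma>" using assms(2) by (auto simp: planar_def)
  have sub: "p ` e \<subseteq> p ` V'" "p ` V' \<subseteq> p ` V" "e \<in> E" if "e \<in> E'" for e
    using that assms(3-5) by blast+
  have inj: "inj_on p V" and arcs: "\<And>e. e \<in> E \<Longrightarrow> arc (\<gamma> e)"
      "\<And>e. e \<in> E \<Longrightarrow> {pathstart (\<gamma> e), pathfinish (\<gamma> e)} = p ` e"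
    and verts: "\<And>e. e \<in> E \<Longrightarrow> path_image (\<gamma> e) \<inter> p ` V = p ` e"
    and meet: "\<And>e f. e \<in> E \<Longrightarrow> f \<in> E \<Longrightarrow> e \<noteq> f \<Longrightarrow> path_image (\<gamma> e) \<inter> path_image (\<gamma> f) \<subseteq> p ` (e \<inter> f)"
    using d unfolding plane_drawing_def by auto
  have "path_image (\<gamma> e) \<inter> p ` V' = p ` e" if "e \<in> E'" for e
    using verts[of e] sub[OF that] by blast
  then have "plane_drawing V' E' p \<gamma>"
    unfolding plane_drawing_def using inj_on_subset[OF inj assms(3)] arcs meet assms(4)
    by (intro conjI ballI impI) (simp_all add: subset_iff)
  moreover have "simple_graph V' E'"
    using assms(1,3-5) finite_subset[of V' V] unfolding simple_graph_def by blast
  ultimately show ?thesis using that[of p \<gamma>] by (simp add: drawing_def)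
qed

text \<open>A minor of a planar graph: the branch sets are the rooted trees given by \<open>par\<close>, and
  \<open>rep\<close> picks one edge for each adjacent pair of branch sets.\<close>

locale planar_minor =
  fixes V :: "'a set" and E :: "'a set set" and V' Rt :: "'a set" and par :: "'a \<Rightarrow> 'a"
    and rk :: "'a \<Rightarrow> nat" and \<phi> :: "'a \<Rightarrow> 'b" and J :: "'j set" and rep :: "'j \<Rightarrow> 'a set"
  assumes simple: "simple_graph V E" and planar: "planar V E"
    and V': "V' \<subseteq> V" and Rt: "Rt \<subseteq> V'" "Rt \<noteq> {}" and finJ: "finite J"
    and par: "\<And>v. v \<in> V' - Rt \<Longrightarrow> par v \<in> V' \<and> {v, par v} \<in> E \<and> \<phi> (par v) = \<phi> v \<and> rk (par v) < rk v"
    and rep: "\<And>j. j \<in> J \<Longrightarrow> \<exists>u v. rep j = {u,v} \<and> {u,v} \<in> E \<and> u \<in> V' \<and> v \<in> V' \<and> \<phi> u \<noteq> \<phi> v"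
    and rep_inj: "inj_on (\<lambda>j. \<phi> ` rep j) J"
begin

lemma finV': "finite V'" using simple V' finite_subset by (auto simp: simple_graph_def)

definition T where "T = (\<lambda>v. {v, par v}) ` (V' - Rt)"
definition R where "R = rep ` J"

lemma card_T: "card T + card Rt = card V'"
proof -
  have "inj_on (\<lambda>v. {v, par v}) (V' - Rt)"
  proof (rule inj_onI)
    fix v w assume vw: "v \<in> V' - Rt" "w \<in> V' - Rt" "{v, par v} = {w, par w}"
    show "v = w"
    proof (rule ccontr)
      assume "v \<noteq> w"
      then have "v = par w" "w = par v" using vw(3) by (auto simp: doubleton_eq_iff)
      then show False using par[OF vw(1)] par[OF vw(2)] by simp
    qed
  qed
  then have "card T = card (V' - Rt)" unfolding T_def by (rule card_image)
  then show ?thesis using Rt(1) finV' by (simp add: card_Diff_subset card_mono finite_subset)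
qed

lemma card_R: "card R = card J" and \<phi>_inj_R: "inj_on ((`) \<phi>) R"
proof -
  show "card R = card J" unfolding R_def
    using rep_inj by (intro card_image) (auto simp: inj_on_def)
  show "inj_on ((`) \<phi>) R" unfolding R_def using rep_inj by (auto simp: inj_on_def)
qed

lemma R_edge: "e \<in> R \<Longrightarrow> \<exists>u v. e = {u,v} \<and> u \<in> V' \<and> v \<in> V' \<and> \<phi> u \<noteq> \<phi> v"
  unfolding R_def using rep by blast

lemma T_edge: "e \<in> T \<Longrightarrow> \<exists>v\<in>V' - Rt. e = {v, par v}"
  unfolding T_def by blast

lemma RT_disjoint: "R \<inter> T = {}"
proof -
  { fix e assume "e \<in> R" "e \<in> T"
    then obtain u v w where "e = {u,v}" "\<phi> u \<noteq> \<phi> v" "w \<in> V' - Rt" "e = {w, par w}"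
      using R_edge[of e] T_edge[of e] by auto
    then have False using par[of w] by (auto simp: doubleton_eq_iff) }
  then show ?thesis by auto
qed

text \<open>Contraction keeps minimum degree 2. With \<open>X\<close> the part of a branch set in
  the core, the degrees in \<open>X\<close> add up to at least twice \<open>card X\<close>. Tree
  edges of this branch set account for at most twice \<open>card X - 1\<close>, and an edge of
  \<open>R\<close> for at most 1 since its ends have different labels.\<close>

lemma core_branch_degree:
  assumes C: "C \<subseteq> T \<union> R" "core C" and v: "v \<in> \<Union>C"
  shows "2 \<le> card {e\<in>C \<inter> R. \<phi> v \<in> \<phi> ` e}"
proof -
  define X where "X = {u\<in>\<Union>C. \<phi> u = \<phi> v}"
  define Y where "Y = {x\<in>X \<inter> (V' - Rt). {x, par x} \<in> C}"
  let ?Q = "{e\<in>C \<inter> R. \<phi> v \<in> \<phi> ` e}"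
  have finT: "finite T" and finR: "finite R" using finV' finJ by (auto simp: T_def R_def)
  then have finC: "finite C" using C(1) finite_subset by blast
  have edge: "\<exists>a b. e = {a,b} \<and> a \<in> V' \<and> b \<in> V'" if "e \<in> T \<union> R" for e
    using R_edge[of e] T_edge[of e] par that by blast
  have XV: "X \<subseteq> V'" using edge C(1) unfolding X_def by blast
  then have finX: "finite X" using finV' finite_subset by blast
  have vX: "v \<in> X" using v by (simp add: X_def)
  \<comment> \<open>A vertex of least rank has no edge of the core to its parent, as the parent
    would lie in \<open>X\<close> with smaller rank. Hence there are fewer tree edges than vertices
    of \<open>X\<close>.\<close>
  define x0 where "x0 = arg_min_on rk X"
  have x0: "x0 \<in> X" "\<And>x. x \<in> X \<Longrightarrow> rk x0 \<le> rk x"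
    unfolding x0_def using finX vX arg_min_if_finite(1)[of X rk] arg_min_least[of X _ rk] by auto
  have "x0 \<notin> Y"
  proof
    assume "x0 \<in> Y"
    then have "{x0, par x0} \<in> C" "x0 \<in> V' - Rt" by (auto simp: Y_def)
    then have "par x0 \<in> X" "rk (par x0) < rk x0" using par[of x0] x0(1) by (auto simp: X_def)
    then show False using x0(2)[of "par x0"] by simp
  qed
  then have "Y \<subset> X" using x0(1) by (auto simp: Y_def)
  then have YX: "card Y < card X" using finX psubset_card_mono by blast
  have "2 * card X = (\<Sum>x\<in>X. 2)" by simp
  also have "\<dots> \<le> (\<Sum>x\<in>X. card {e\<in>C. x \<in> e})"
    using C(2) by (intro sum_mono) (auto simp: core_def X_def)
  also have "\<dots> = (\<Sum>e\<in>C. card (e \<inter> X))" by (rule sum_degrees_eq[OF finX finC])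
  also have "\<dots> = (\<Sum>e\<in>C \<inter> T. card (e \<inter> X)) + (\<Sum>e\<in>C \<inter> R. card (e \<inter> X))"
  proof -
    have "C = (C \<inter> T) \<union> (C \<inter> R)" using C(1) by auto
    then show ?thesis using sum.union_disjoint[of "C \<inter> T" "C \<inter> R" "\<lambda>e. card (e \<inter> X)"] finC RT_disjoint
      by (metis Int_assoc Int_commute Int_empty_right finite_Int)
  qed
  also have "(\<Sum>e\<in>C \<inter> T. card (e \<inter> X)) \<le> 2 * card Y"
  proof -
    have "(\<Sum>e\<in>C \<inter> T. card (e \<inter> X)) \<le> (\<Sum>e\<in>C \<inter> T. if e \<in> (\<lambda>x. {x, par x}) ` Y then 2 else 0)"
    proof (rule sum_mono)
      fix e assume e: "e \<in> C \<inter> T"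
      then obtain w where w: "w \<in> V' - Rt" "e = {w, par w}" using T_edge by blast
      show "card (e \<inter> X) \<le> (if e \<in> (\<lambda>x. {x, par x}) ` Y then 2 else 0)"
      proof (cases "\<phi> w = \<phi> v")
        case True
        then have "w \<in> Y" using w e by (auto simp: Y_def X_def)
        moreover have "card (e \<inter> X) \<le> card e" using w by (intro card_mono) auto
        moreover have "card e \<le> 2" using w by (simp add: card_insert_if)
        ultimately show ?thesis using w by auto
      next
        case False
        then have "e \<inter> X = {}" using w par[of w] by (auto simp: X_def)
        then show ?thesis by simp
      qed
    qed
    also have "\<dots> = 2 * card (C \<inter> T \<inter> (\<lambda>x. {x, par x}) ` Y)"
      using finC by (simp add: sum.If_cases Int_assoc)
    also have "\<dots> \<le> 2 * card ((\<lambda>x. {x, par x}) ` Y)"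
      using finX by (intro mult_le_mono2 card_mono) (auto simp: Y_def)
    also have "\<dots> \<le> 2 * card Y" using finX by (intro mult_le_mono2 card_image_le) (auto simp: Y_def)
    finally show ?thesis .
  qed
  also have "(\<Sum>e\<in>C \<inter> R. card (e \<inter> X)) \<le> card ?Q"
  proof -
    have "(\<Sum>e\<in>C \<inter> R. card (e \<inter> X)) \<le> (\<Sum>e\<in>C \<inter> R. if \<phi> v \<in> \<phi> ` e then 1 else 0)"
    proof (rule sum_mono)
      fix e assume "e \<in> C \<inter> R"
      then obtain a b where ab: "e = {a,b}" "\<phi> a \<noteq> \<phi> b" using R_edge[of e] by auto
      show "card (e \<inter> X) \<le> (if \<phi> v \<in> \<phi> ` e then 1 else 0)"
      proof (cases "\<phi> v \<in> \<phi> ` e")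
        case True
        have "e \<inter> X \<subseteq> {a} \<or> e \<inter> X \<subseteq> {b}" using ab by (auto simp: X_def)
        then have "card (e \<inter> X) \<le> 1" by (metis card.empty card_mono finite.emptyI finite.insertI is_singletonI is_singleton_altdef)
        then show ?thesis using True by simp
      next
        case False
        then have "e \<inter> X = {}" unfolding X_def by (smt (verit) disjoint_iff image_eqI mem_Collect_eq)
        then show ?thesis by simp
      qed
    qed
    also have "\<dots> = card ?Q" using finC by (simp add: sum.If_cases Int_def conj_assoc)
    finally show ?thesis .
  qed
  finally have "2 * card X \<le> 2 * card Y + card ?Q" by simp
  then show ?thesis using YX by simp
qed

text \<open>The contracted core is a simple graph of minimum degree 2. An edge \<open>e\<close> and
  further edges \<open>f\<close>, \<open>g\<close> at its two ends are distinct, because parallel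
  edges are excluded. With two sides, the far ends of \<open>f\<close> and \<open>g\<close> lie on
  different sides, so a second edge at the far end of \<open>f\<close> is a fourth one.\<close>

lemma card_core_R:
  assumes C: "C \<subseteq> T \<union> R" "core C"
  shows "3 \<le> card (C \<inter> R)"
    and "(\<And>u v. {u,v} \<in> R \<Longrightarrow> (side :: 'b \<Rightarrow> bool) (\<phi> u) \<noteq> side (\<phi> v)) \<Longrightarrow> 4 \<le> card (C \<inter> R)"
proof -
  have fin: "finite (C \<inter> R)" using finJ by (simp add: R_def)
  have other: "\<exists>f. f \<in> C \<inter> R \<and> \<phi> v \<in> \<phi> ` f \<and> f \<noteq> e" if "v \<in> \<Union>C" for v e
  proof (rule ccontr)
    assume "\<not> ?thesis"
    then have "{e\<in>C \<inter> R. \<phi> v \<in> \<phi> ` e} \<subseteq> {e}" by auto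
    then have "card {e\<in>C \<inter> R. \<phi> v \<in> \<phi> ` e} \<le> 1" using card_mono[of "{e}"] by fastforce
    then show False using core_branch_degree[OF C that] by simp
  qed
  obtain e0 v0 where "e0 \<in> C" "v0 \<in> e0"
    using C by (metis R_edge T_edge UnE all_not_in_conv core_def insertI1 subsetD)
  then obtain e where e: "e \<in> C \<inter> R" using other[of v0 "{}"] by blast
  then obtain a b where ab: "e = {a,b}" "\<phi> a \<noteq> \<phi> b" using R_edge[of e] by auto
  then have "a \<in> \<Union>C" "b \<in> \<Union>C" using e by auto
  then obtain f g where f: "f \<in> C \<inter> R" "\<phi> a \<in> \<phi> ` f" "f \<noteq> e" and g: "g \<in> C \<inter> R" "\<phi> b \<in> \<phi> ` g" "g \<noteq> e"
    using other by metis
  obtain c c' where c: "f = {c',c}" "\<phi> c' = \<phi> a" "\<phi> c \<noteq> \<phi> a"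
  proof -
    obtain s t where st: "f = {s,t}" "\<phi> s \<noteq> \<phi> t" using R_edge[of f] f by auto
    show ?thesis
    proof (cases "\<phi> s = \<phi> a")
      case True then show ?thesis using that[of s t] st by auto
    next
      case False then show ?thesis using that[of t s] st f(2) by (auto simp: insert_commute)
    qed
  qed
  obtain d d' where d: "g = {d',d}" "\<phi> d' = \<phi> b" "\<phi> d \<noteq> \<phi> b"
  proof -
    obtain s t where st: "g = {s,t}" "\<phi> s \<noteq> \<phi> t" using R_edge[of g] g by auto
    show ?thesis
    proof (cases "\<phi> s = \<phi> b")
      case True then show ?thesis using that[of s t] st by auto
    next
      case False then show ?thesis using that[of t s] st g(2) by (auto simp: insert_commute)
    qed
  qed
  have cb: "\<phi> c \<noteq> \<phi> b"
  proof
    assume "\<phi> c = \<phi> b"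
    then have "\<phi> ` f = \<phi> ` e" using c ab by auto
    then show False using \<phi>_inj_R f e by (auto simp: inj_on_def)
  qed
  have fg: "f \<noteq> g"
    using c d ab cb by (metis image_insert insertI1 insert_iff image_empty empty_iff)
  then have "card {e,f,g} = 3" using f g by auto
  moreover have "{e,f,g} \<subseteq> C \<inter> R" using e f g by auto
  ultimately show "3 \<le> card (C \<inter> R)" using fin by (metis card_mono)
  assume side: "\<And>u v. {u,v} \<in> R \<Longrightarrow> side (\<phi> u) \<noteq> side (\<phi> v)"
  obtain h where h: "h \<in> C \<inter> R" "\<phi> c \<in> \<phi> ` h" "h \<noteq> f" using other[of c f] f c by auto
  have "h \<noteq> e" using h(2) ab c(3) cb by auto
  moreover have "h \<noteq> g"
  proof
    assume "h = g"
    then have "\<phi> c = \<phi> d" using h(2) d cb by auto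
    moreover have "side (\<phi> a) \<noteq> side (\<phi> b)" "side (\<phi> c') \<noteq> side (\<phi> c)" "side (\<phi> d') \<noteq> side (\<phi> d)"
      using side[of a b] side[of c' c] side[of d' d] ab e c f d g by auto
    ultimately show False using c d by (metis (full_types))
  qed
  ultimately have "card {e,f,g,h} = 4" using fg f g h by auto
  moreover have "{e,f,g,h} \<subseteq> C \<inter> R" using e f g h by auto
  ultimately show "4 \<le> card (C \<inter> R)" using fin by (metis card_mono)
qed

text \<open>Weight 1 on \<open>R\<close> and 0 on \<open>T\<close> in Euler's inequality. Each tree
  edge cancels against a vertex that is not a root, so that only the branch sets remain.\<close>

lemma card_J_bound:
  assumes W: "\<And>C. C \<subseteq> T \<union> R \<Longrightarrow> core C \<Longrightarrow> W \<le> card (C \<inter> R)"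
  shows "W * (card J + 1) \<le> 2 * card J + W * card Rt"
proof -
  have sub: "T \<union> R \<subseteq> E" unfolding T_def R_def using par rep by fastforce
  have esub: "e \<subseteq> V'" if "e \<in> T \<union> R" for e
    using R_edge[of e] T_edge[of e] par that by blast
  obtain p \<gamma> where "drawing V' (T \<union> R) p \<gamma>"
    by (rule drawing_subgraph[OF simple planar V' sub esub])
  then interpret drawing V' "T \<union> R" p \<gamma> .
  let ?\<omega> = "\<lambda>e. if e \<in> R then 1 else 0 :: nat"
  have fin: "finite T" "finite R" using finV' finJ by (auto simp: T_def R_def)
  have sum: "sum ?\<omega> C = card (C \<inter> R)" if "C \<subseteq> T \<union> R" for C
    using that fin finite_subset[of C "T \<union> R"] by (simp add: sum.If_cases)
  have "W * (card (T \<union> R) + 1) \<le> 2 * sum ?\<omega> (T \<union> R) + W * card V'"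
    using W sum Rt by (intro weighted_euler) auto
  moreover have "card (T \<union> R) = card T + card J"
    using card_Un_disjoint[OF fin] RT_disjoint card_R by (simp add: Int_commute)
  moreover have "sum ?\<omega> (T \<union> R) = card J" using sum[of "T \<union> R"] card_R by (simp add: Int_absorb1)
  ultimately have "W * (card T + card J + 1) \<le> 2 * card J + W * (card T + card Rt)"
    by (simp add: card_T)
  then show ?thesis by (simp add: algebra_simps)
qed

theorem card_J_less: "card J < 3 * card Rt"
  using card_J_bound[of 3] card_core_R(1) by simp

theorem card_J_less_bipartite:
  fixes side :: "'b \<Rightarrow> bool"
  assumes "\<And>u v. {u,v} \<in> R \<Longrightarrow> side (\<phi> u) \<noteq> side (\<phi> v)"
  shows "card J < 2 * card Rt"
  using card_J_bound[of 4] card_core_R(2)[of _ side] assms by simp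

end

text \<open>Vertices of the minor are the members of \<open>B\<close> and the bags in
  \<open>Q0\<close>. Its edges are \<open>H\<close>, the adjacencies between bags in
  \<open>Q0\<close> and \<open>B\<close>, and the pairs in \<open>P\<close>. Each pair in
  \<open>P\<close> is joined through a bag of its own outside \<open>Q0\<close>, which is contracted
  into one of the two ends. Without \<open>H\<close> and \<open>P\<close> the minor is
  bipartite.\<close>

theorem bag_minor_bound:
  fixes V :: "'a set" and E :: "'a set set" and con :: "'a set \<Rightarrow> 'a set"
  assumes G: "simple_graph V E" "planar V E" and B: "B \<subseteq> V" "B \<noteq> {}"
    and Q: "\<And>X. X \<in> Q \<Longrightarrow> X \<subseteq> V - B \<and> (\<exists>u v. X = {u,v} \<and> (u = v \<or> {u,v} \<in> E))"
    and disj: "\<And>X Y. X \<in> Q \<Longrightarrow> Y \<in> Q \<Longrightarrow> X \<noteq> Y \<Longrightarrow> X \<inter> Y = {}"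
    and Q0: "Q0 \<subseteq> Q" and H: "\<And>e. e \<in> H \<Longrightarrow> e \<in> E \<and> e \<subseteq> B"
    and P: "\<And>e. e \<in> P \<Longrightarrow> e \<subseteq> B \<and> card e = 2 \<and> con e \<in> Q - Q0 \<and> (\<forall>b\<in>e. \<exists>v\<in>con e. {v,b} \<in> E)"
    and con: "inj_on con P" and HP: "H \<inter> P = {}"
  shows "card H + card P + (\<Sum>X\<in>Q0. card {b\<in>B. \<exists>v\<in>X. {v,b} \<in> E}) < 3 * (card B + card Q0)"
    and "H = {} \<Longrightarrow> P = {} \<Longrightarrow> (\<Sum>X\<in>Q0. card {b\<in>B. \<exists>v\<in>X. {v,b} \<in> E}) < 2 * (card B + card Q0)"
proof -
  have finV: "finite V" using G(1) by (simp add: simple_graph_def)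
  have finB: "finite B" using B(1) finV finite_subset by blast
  have "Q \<subseteq> Pow V" using Q by blast
  then have finQ: "finite Q0" using finV Q0 by (meson finite_Pow_iff finite_subset subset_trans)
  have finHP: "finite H" "finite P"
    using finite_subset[of H "Pow B"] finite_subset[of P "Pow B"] H P finB by auto
  have ne: "X \<noteq> {}" if "X \<in> Q" for X using Q[OF that] by blast
  define bag where "bag v = (THE X. X \<in> Q \<and> v \<in> X)" for v
  have bag: "bag v = X" if "X \<in> Q" "v \<in> X" for v X
    unfolding bag_def using that disj by (intro the_equality) blast+
  have "\<exists>a b y. e = {a,b} \<and> a \<noteq> b \<and> y \<in> con e \<and> {y,a} \<in> E" if eP: "e \<in> P" for e
  proof -
    obtain a b where "e = {a,b}" "a \<noteq> b" using P[OF eP] by (metis card_2_iff)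
    then show ?thesis using P[OF eP] by blast
  qed
  then obtain a b y where aby: "\<And>e. e \<in> P \<Longrightarrow> e = {a e, b e} \<and> a e \<noteq> b e \<and> y e \<in> con e \<and> {y e, a e} \<in> E"
    by metis
  define pr where "pr X = the_inv_into P con X" for X
  have pr: "pr (con e) = e" if "e \<in> P" for e unfolding pr_def using con that by (rule the_inv_into_f_f)
  define rt where "rt X = (if X \<in> Q0 then (SOME v. v \<in> X) else y (pr X))" for X
  define V' where "V' = B \<union> \<Union>Q0 \<union> \<Union>(con ` P)"
  \<comment> \<open>A bag serving a pair \<open>e\<close> hangs on the big vertex \<open>a e\<close>
    by its vertex \<open>y e\<close>; a second vertex hangs on \<open>y e\<close>. In a bag from
    \<open>Q0\<close> an arbitrary vertex is the root and any second one hangs on it.\<close>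
  define par where "par v = (if v = rt (bag v) then a (pr (bag v)) else rt (bag v))" for v
  \<comment> \<open>Branch sets are labelled by sets: a singleton for a big vertex with whatever is
    contracted into it, and the bag itself for bags in \<open>Q0\<close>. Bags avoid
    \<open>B\<close>, so labels of the two kinds differ.\<close>
  define \<phi> where "\<phi> v = (if v \<in> B then {v} else if bag v \<in> Q0 then bag v else {a (pr (bag v))})" for v
  define rk where "rk v = (if v \<in> B then 0 else if v = rt (bag v) then 1 else 2 :: nat)" for v
  define Rt where "Rt = B \<union> rt ` Q0"
  \<comment> \<open>An edge of the minor is the set of its two labels. As a representative is mapped
    by \<open>\<phi>\<close> to exactly this set, the representatives of distinct edges are not
    parallel.\<close>
  define J where "J = (`) (\<lambda>v. {v}) ` (H \<union> P) \<union> (\<Union>X\<in>Q0. (\<lambda>x. {{x}, X}) ` {x\<in>B. \<exists>v\<in>X. {v,x} \<in> E})"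
  have rt0: "rt X \<in> X" if "X \<in> Q0" for X
    using ne[of X] Q0 that some_in_eq[of X] by (auto simp: rt_def)
  have rt1: "rt (con e) = y e" if "e \<in> P" for e using P[OF that] pr[OF that] by (simp add: rt_def)
  have nB: "v \<notin> B" if "X \<in> Q" "v \<in> X" for X v using Q[OF that(1)] that(2) by blast
  have \<phi>B: "\<phi> v = {v}" if "v \<in> B" for v using that by (simp add: \<phi>_def)
  have \<phi>0: "\<phi> v = X" if "X \<in> Q0" "v \<in> X" for v X
    using that nB[of X v] bag[of X v] Q0 by (auto simp: \<phi>_def)
  have \<phi>1: "\<phi> v = {a e}" if "e \<in> P" "v \<in> con e" for v e
    using that nB[of "con e" v] bag[of "con e" v] P[of e] pr[of e] by (auto simp: \<phi>_def)
  have adj: "{v,w} \<in> E" if h: "X \<in> Q" "v \<in> X" "w \<in> X" "v \<noteq> w" for X v w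
  proof -
    obtain s t where "X = {s,t}" "s = t \<or> {s,t} \<in> E" using Q[OF h(1)] by blast
    then show ?thesis using h(2-4) by (auto simp: insert_commute)
  qed
  have sing: "{x} \<noteq> X" if "X \<in> Q" "x \<in> B" for x X using nB[OF that(1)] that(2) by auto
  have reps: "\<exists>e. (\<exists>u v. e = {u,v} \<and> {u,v} \<in> E \<and> u \<in> V' \<and> v \<in> V' \<and> \<phi> u \<noteq> \<phi> v) \<and> \<phi> ` e = j" if j: "j \<in> J" for j
  proof -
    have mk: ?thesis if "{u,v} \<in> E" "u \<in> V'" "v \<in> V'" "\<phi> u \<noteq> \<phi> v" "\<phi> ` {u,v} = j" for u v
      using that by (intro exI[of _ "{u,v}"] conjI exI[of _ u] exI[of _ v]) simp_all
    from j consider e where "e \<in> H" "j = (\<lambda>v. {v}) ` e" | e where "e \<in> P" "j = (\<lambda>v. {v}) ` e"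
      | X x v where "X \<in> Q0" "x \<in> B" "v \<in> X" "{v,x} \<in> E" "j = {{x}, X}"
      unfolding J_def by blast
    then show ?thesis
    proof cases
      case 1
      then have e: "e \<in> E" "e \<subseteq> B" using H by auto
      then obtain u v where uv: "e = {u,v}" "u \<noteq> v" using G(1) by (metis card_2_iff simple_graph_def)
      have "\<phi> ` e = j" using 1(2) e(2) \<phi>B by (auto simp: image_def)
      then have "\<phi> ` {u,v} = j" unfolding uv(1) .
      moreover have "u \<in> B" "v \<in> B" using e(2) uv(1) by auto
      ultimately show ?thesis using uv e(1) \<phi>B by (intro mk[of u v]) (auto simp: V'_def)
    next
      case 2
      note e = aby[OF 2(1)] and p = P[OF 2(1)]
      then obtain v where v: "v \<in> con e" "{v, b e} \<in> E" by blast
      have bB: "a e \<in> B" "b e \<in> B" using e p by auto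
      have f: "\<phi> v = {a e}" "\<phi> (b e) = {b e}" using \<phi>1[OF 2(1) v(1)] \<phi>B[OF bB(2)] by auto
      have "\<phi> ` {v, b e} = (\<lambda>v. {v}) ` {a e, b e}" using f by simp
      then have "\<phi> ` {v, b e} = j" using 2(2) e by metis
      moreover have "v \<in> V'" "b e \<in> V'" using v(1) 2(1) bB by (auto simp: V'_def)
      moreover have "\<phi> v \<noteq> \<phi> (b e)" using f e by simp
      ultimately show ?thesis using v(2) by (intro mk[of v "b e"])
    next
      case 3
      have "X \<in> Q" using 3(1) Q0 by auto
      then have "\<phi> v \<noteq> \<phi> x" using \<phi>0[OF 3(1,3)] \<phi>B[OF 3(2)] sing 3(2) by metis
      moreover have "\<phi> ` {v,x} = j" using \<phi>0[OF 3(1,3)] \<phi>B[OF 3(2)] 3(5) by auto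
      moreover have "v \<in> V'" "x \<in> V'" using 3 by (auto simp: V'_def)
      ultimately show ?thesis using 3(4) by (intro mk[of v x])
    qed
  qed
  then obtain rep where repj: "\<And>j. j \<in> J \<Longrightarrow> (\<exists>u v. rep j = {u,v} \<and> {u,v} \<in> E \<and> u \<in> V' \<and> v \<in> V' \<and> \<phi> u \<noteq> \<phi> v) \<and> \<phi> ` rep j = j"
    by metis
  have finJ: "finite J" using finHP finQ finB by (auto simp: J_def)
  interpret planar_minor V E V' Rt par rk \<phi> J rep
  proof
    show "V' \<subseteq> V" using B(1) Q Q0 P unfolding V'_def by blast
    show "Rt \<subseteq> V'" using rt0 unfolding Rt_def V'_def by blast
    show "Rt \<noteq> {}" using B(2) by (simp add: Rt_def)
    show "inj_on (\<lambda>j. \<phi> ` rep j) J" using repj by (simp add: inj_on_def)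
    fix v assume v: "v \<in> V' - Rt"
    then have vB: "v \<notin> B" by (auto simp: Rt_def)
    consider X where "X \<in> Q0" "v \<in> X" | e where "e \<in> P" "v \<in> con e" using v vB unfolding V'_def by blast
    then show "par v \<in> V' \<and> {v, par v} \<in> E \<and> \<phi> (par v) = \<phi> v \<and> rk (par v) < rk v"
    proof cases
      case 1
      then have XQ: "X \<in> Q" using Q0 by auto
      note bv = bag[OF XQ 1(2)]
      have vr: "v \<noteq> rt X" using v 1(1) by (auto simp: Rt_def)
      then have pv: "par v = rt X" using bv by (simp add: par_def)
      have "rt X \<in> X" by (rule rt0[OF 1(1)])
      moreover have "bag (rt X) = X" by (rule bag[OF XQ \<open>rt X \<in> X\<close>])
      ultimately show ?thesis
        using pv adj[OF XQ 1(2) _ vr] \<phi>0[OF 1] \<phi>0[OF 1(1)] nB[OF XQ] vB bv vr 1(1)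
        by (auto simp: V'_def rk_def)
    next
      case 2
      have cQ: "con e \<in> Q" using P[OF 2(1)] by auto
      note bv = bag[OF cQ 2(2)]
      note e = aby[OF 2(1)]
      have aB: "a e \<in> B" using e P[OF 2(1)] by auto
      show ?thesis
      proof (cases "v = y e")
        case True
        then have "par v = a e" using bv rt1[OF 2(1)] pr[OF 2(1)] by (simp add: par_def)
        then show ?thesis using True e aB \<phi>B[OF aB] \<phi>1[OF 2] vB bv by (auto simp: V'_def rk_def)
      next
        case False
        then have pv: "par v = y e" using bv rt1[OF 2(1)] by (simp add: par_def)
        have ye: "y e \<in> con e" using e by simp
        have "rk (y e) = 1" using bag[OF cQ ye] nB[OF cQ ye] rt1[OF 2(1)] by (simp add: rk_def)
        moreover have "rk v = 2" using bv vB rt1[OF 2(1)] False by (simp add: rk_def)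
        ultimately show ?thesis
          using pv adj[OF cQ 2(2) ye False] \<phi>1[OF 2(1) ye] \<phi>1[OF 2] ye 2(1) by (auto simp: V'_def)
      qed
    qed
  qed (use G finJ repj in auto)
  have cardRt: "card Rt = card B + card Q0"
  proof -
    have "inj_on rt Q0" using rt0 disj Q0 unfolding inj_on_def by (metis IntI empty_iff subsetD)
    moreover have "B \<inter> rt ` Q0 = {}" using nB rt0 Q0 by blast
    ultimately show ?thesis unfolding Rt_def using finB finQ by (simp add: card_Un_disjoint card_image)
  qed
  have cardJ: "card J = card H + card P + (\<Sum>X\<in>Q0. card {b\<in>B. \<exists>v\<in>X. {v,b} \<in> E})"
  proof -
    let ?A = "(`) (\<lambda>v. {v}) ` (H \<union> P)"
    let ?F = "\<lambda>X. (\<lambda>x. {{x}, X}) ` {x\<in>B. \<exists>v\<in>X. {v,x} \<in> E}"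
    have "inj_on ((`) (\<lambda>v. {v})) (H \<union> P)"
      by (rule inj_on_subset[OF _ subset_UNIV]) (rule inj_image_eq_iff[THEN iffD1, THEN injI], auto)
    then have 1: "card ?A = card H + card P"
      using card_Un_disjoint[OF finHP HP] by (simp add: card_image)
    have 2: "card (\<Union>X\<in>Q0. ?F X) = (\<Sum>X\<in>Q0. card (?F X))"
    proof (rule card_UN_disjoint[OF finQ])
      show "\<forall>X\<in>Q0. finite (?F X)" using finB by auto
      show "\<forall>X\<in>Q0. \<forall>Y\<in>Q0. X \<noteq> Y \<longrightarrow> ?F X \<inter> ?F Y = {}"
        using sing Q0 by (auto simp: doubleton_eq_iff)
    qed
    have 3: "card (?F X) = card {x\<in>B. \<exists>v\<in>X. {v,x} \<in> E}" if "X \<in> Q0" for X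
      using sing[of X] that Q0 by (intro card_image) (auto simp: inj_on_def doubleton_eq_iff)
    have "?A \<inter> (\<Union>X\<in>Q0. ?F X) = {}"
    proof -
      have no: "False" if h: "e \<in> H \<union> P" "X \<in> Q0" "(\<lambda>v. {v}) ` e = {{x}, X}" for e X x
      proof -
        have "X \<in> (\<lambda>v. {v}) ` e" using h(3) by auto
        then obtain v where "v \<in> e" "X = {v}" by auto
        moreover have "e \<subseteq> B" using H P h(1) by blast
        ultimately show False using sing[of X v] h(2) Q0 by auto
      qed
      show ?thesis
      proof (rule equals0I)
        fix j assume "j \<in> ?A \<inter> (\<Union>X\<in>Q0. ?F X)"
        then have jA: "j \<in> ?A" and jF: "j \<in> (\<Union>X\<in>Q0. ?F X)" by simp_all
        from jA obtain e where e: "j = (\<lambda>v. {v}) ` e" "e \<in> H \<union> P" by (rule imageE)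
        from jF obtain X where X: "X \<in> Q0" "j \<in> ?F X" by (rule UN_E)
        from X(2) obtain x where "j = {{x}, X}" by (rule imageE)
        then show False using no[of e X x] e X(1) by simp
      qed
    qed
    moreover have "finite ?A" "finite (\<Union>X\<in>Q0. ?F X)" using finHP finQ finB by auto
    ultimately have "card J = card ?A + card (\<Union>X\<in>Q0. ?F X)" unfolding J_def by (simp add: card_Un_disjoint)
    then show ?thesis using 1 2 3 by simp
  qed
  show "card H + card P + (\<Sum>X\<in>Q0. card {b\<in>B. \<exists>v\<in>X. {v,b} \<in> E}) < 3 * (card B + card Q0)"
    using card_J_less cardRt cardJ by simp
  assume HPe: "H = {}" "P = {}"
  define side where "side X \<longleftrightarrow> (\<exists>x\<in>B. X = {x})" for X :: "'a set"
  have "side (\<phi> u) \<noteq> side (\<phi> v)" if uv: "{u,v} \<in> R" for u v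
  proof -
    obtain j where j: "j \<in> J" "{u,v} = rep j" using uv unfolding R_def by auto
    then obtain X x where X: "X \<in> Q0" "x \<in> B" "j = {{x}, X}" unfolding J_def HPe by auto
    have "\<phi> ` {u,v} = {{x}, X}" unfolding j(2) X(3)[symmetric] by (rule repj[OF j(1), THEN conjunct2])
    then have "{\<phi> u, \<phi> v} = {{x}, X}" by simp
    then have "(\<phi> u = {x} \<and> \<phi> v = X) \<or> (\<phi> u = X \<and> \<phi> v = {x})" by (auto simp: doubleton_eq_iff)
    moreover have "side {x}" "\<not> side X" using X sing[of X] Q0 by (auto simp: side_def)
    ultimately show ?thesis by auto
  qed
  then have "card J < 2 * card Rt" by (rule card_J_less_bipartite)
  then show "(\<Sum>X\<in>Q0. card {b\<in>B. \<exists>v\<in>X. {v,b} \<in> E}) < 2 * (card B + card Q0)"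
    using cardRt cardJ HPe by simp
qed

section \<open>Partial colourings and light edges\<close>

text \<open>The vertex set is dropped, as degrees, sums and colourings depend on the edges
  alone.\<close>

definition simple_edges :: "'a set set \<Rightarrow> bool" where
  "simple_edges E \<longleftrightarrow> finite E \<and> (\<forall>e\<in>E. card e = 2)"

abbreviation deg :: "'a set set \<Rightarrow> 'a \<Rightarrow> nat" where "deg \<equiv> graph_degree"

definition nb :: "'a set set \<Rightarrow> 'a \<Rightarrow> 'a set" where "nb E v = {u. {v, u} \<in> E}"

definition csum :: "'a set set \<Rightarrow> ('a set \<Rightarrow> nat) \<Rightarrow> 'a \<Rightarrow> nat" where
  "csum E c v = (\<Sum>e\<in>incident_edges E v. c e)"

lemma simple_edges_mono: "simple_edges E \<Longrightarrow> D \<subseteq> E \<Longrightarrow> simple_edges D"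
  using finite_subset by (auto simp: simple_edges_def)

lemma simple_edges_neq: "simple_edges E \<Longrightarrow> {u, v} \<in> E \<Longrightarrow> u \<noteq> v"
  by (auto simp: simple_edges_def)

lemma simple_edges_cases:
  assumes "simple_edges E" "e \<in> E" obtains u v where "e = {u, v}" "u \<noteq> v"
  using assms by (metis simple_edges_def card_2_iff)

lemma finite_incident: "simple_edges E \<Longrightarrow> finite (incident_edges E v)"
  by (auto simp: simple_edges_def incident_edges_def)

lemma incident_edges_eq:
  assumes "simple_edges E" shows "incident_edges E v = (\<lambda>u. {v, u}) ` nb E v"
proof -
  have "e \<in> (\<lambda>u. {v, u}) ` nb E v" if e: "e \<in> E" "v \<in> e" for e
  proof -
    obtain a b where "e = {a,b}" using assms e(1) by (rule simple_edges_cases)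
    then have "\<exists>u. e = {v, u}" using e(2) by auto
    then show ?thesis using e(1) by (auto simp: nb_def)
  qed
  then show ?thesis by (auto simp: incident_edges_def nb_def)
qed

lemma finite_nb: "simple_edges E \<Longrightarrow> finite (nb E v)"
  and card_nb: "simple_edges E \<Longrightarrow> card (nb E v) = deg E v"
proof -
  have inj: "inj_on (\<lambda>u. {v, u}) (nb E v)" for E :: "'a set set" and v
    by (auto simp: inj_on_def doubleton_eq_iff)
  show "simple_edges E \<Longrightarrow> finite (nb E v)"
    using finite_incident[of E v] incident_edges_eq[of E v] inj[where E = E and v = v] finite_imageD by metis
  show "simple_edges E \<Longrightarrow> card (nb E v) = deg E v"
    unfolding graph_degree_def using incident_edges_eq[of E v] card_image[OF inj[where E = E and v = v]] by simp
qed

lemma incident_insert: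
  "incident_edges (insert e E) v = (if v \<in> e then insert e (incident_edges E v) else incident_edges E v)"
  by (auto simp: incident_edges_def)

lemma csum_cong:
  assumes "\<And>e. e \<in> D \<Longrightarrow> v \<in> e \<Longrightarrow> e \<in> D' \<and> c e = c' e" "\<And>e. e \<in> D' \<Longrightarrow> v \<in> e \<Longrightarrow> e \<in> D"
  shows "csum D c v = csum D' c' v"
proof -
  have "incident_edges D v = incident_edges D' v" using assms by (auto simp: incident_edges_def)
  then show ?thesis unfolding csum_def using assms by (intro sum.cong) (auto simp: incident_edges_def)
qed

lemma deg_cong:
  assumes "\<And>e. v \<in> e \<Longrightarrow> e \<in> D \<longleftrightarrow> e \<in> D'" shows "deg D v = deg D' v"
proof -
  have "incident_edges D v = incident_edges D' v" using assms by (auto simp: incident_edges_def)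
  then show ?thesis by (simp add: graph_degree_def)
qed

lemma csum_insert:
  assumes "simple_edges D" "e \<notin> D"
  shows "csum (insert e D) (c(e := x)) v = csum D c v + (if v \<in> e then x else 0)"
proof -
  have "(\<Sum>f\<in>incident_edges D v. (c(e := x)) f) = csum D c v"
    unfolding csum_def using assms by (intro sum.cong) (auto simp: incident_edges_def)
  moreover have "e \<notin> incident_edges D v" using assms by (simp add: incident_edges_def)
  ultimately show ?thesis
    using finite_incident[OF assms(1), of v] by (simp add: csum_def incident_insert)
qed

lemma deg_insert:
  assumes "simple_edges D" "e \<notin> D"
  shows "deg (insert e D) v = deg D v + (if v \<in> e then 1 else 0)"
  using assms finite_incident[OF assms(1), of v]
  by (simp add: graph_degree_def incident_insert) (simp add: incident_edges_def)

lemma deg_mono: "simple_edges E \<Longrightarrow> D \<subseteq> E \<Longrightarrow> deg D v \<le> deg E v"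
  unfolding graph_degree_def using finite_incident by (intro card_mono) (auto simp: incident_edges_def)

lemma deg_remove:
  assumes "simple_edges E" "e \<in> E" "v \<in> e" shows "deg (E - {e}) v + 1 = deg E v"
  using deg_insert[of "E - {e}" e v] simple_edges_mono[OF assms(1), of "E - {e}"] assms(2,3)
  by (simp add: insert_absorb[OF assms(2)])

lemma proper_neq:
  assumes "proper_edge_colouring E k c" "e \<in> E" "f \<in> E" "v \<in> e" "v \<in> f" "e \<noteq> f"
  shows "c e \<noteq> c f"
proof -
  have "e \<inter> f \<noteq> {}" using assms(4,5) by auto
  then show ?thesis using assms unfolding proper_edge_colouring_def by metis
qed

lemma proper_mono:
  assumes "proper_edge_colouring E k c" "D \<subseteq> E" shows "proper_edge_colouring D k c"
proof -
  have "c ` D \<subseteq> {1..k}" using assms by (auto simp: proper_edge_colouring_def)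
  then show ?thesis using assms unfolding proper_edge_colouring_def by (meson subsetD)
qed

lemma proper_inj_incident:
  assumes "proper_edge_colouring E k c" shows "inj_on c (incident_edges E v)"
  using proper_neq[OF assms] by (auto simp: inj_on_def incident_edges_def)

lemma proper_range:
  assumes "proper_edge_colouring E k c" "e \<in> E" shows "1 \<le> c e" "c e \<le> k"
  using assms by (auto simp: proper_edge_colouring_def image_subset_iff)

lemma csum_le:
  assumes "proper_edge_colouring E k c" shows "csum E c v \<le> deg E v * k"
  unfolding csum_def graph_degree_def
  using sum_bounded_above[of "incident_edges E v" c k] proper_range[OF assms] by (simp add: incident_edges_def)

lemma csum_ge_deg:
  assumes "proper_edge_colouring E k c" shows "deg E v \<le> csum E c v"
  unfolding csum_def graph_degree_def
  using sum_bounded_below[of "incident_edges E v" 1 c] proper_range[OF assms] by (simp add: incident_edges_def)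

lemma sum_distinct_pos:
  fixes A :: "nat set"
  assumes "finite A" "\<And>a. a \<in> A \<Longrightarrow> 1 \<le> a"
  shows "card A * (card A + 1) \<le> 2 * \<Sum>A"
  using assms
proof (induction "card A" arbitrary: A)
  case (Suc n)
  then have ne: "A \<noteq> {}" by auto
  let ?m = "Max A"
  have m: "?m \<in> A" using ne Suc.prems by simp
  have "A \<subseteq> {1..?m}" using Suc.prems by auto
  then have "card A \<le> ?m" using card_mono[of "{1..?m}" A] by simp
  moreover have "n * (n + 1) \<le> 2 * \<Sum>(A - {?m})"
  proof -
    have n: "card (A - {?m}) = n" using Suc.prems(1) Suc.hyps(2) m by (simp add: card_Diff_singleton)
    then show ?thesis using Suc.hyps(1)[of "A - {?m}"] Suc.prems by simp
  qed
  moreover have "\<Sum>A = ?m + \<Sum>(A - {?m})" using sum.remove[OF Suc.prems(1) m, of "\<lambda>x. x"] by simp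
  ultimately show ?case unfolding Suc.hyps(2)[symmetric] by (simp add: algebra_simps)
qed simp

lemma csum_ge:
  assumes "simple_edges E" "proper_edge_colouring E k c"
  shows "deg E v * (deg E v + 1) \<le> 2 * csum E c v"
proof -
  have inj: "inj_on c (incident_edges E v)" by (rule proper_inj_incident[OF assms(2)])
  have "card (c ` incident_edges E v) * (card (c ` incident_edges E v) + 1) \<le> 2 * \<Sum>(c ` incident_edges E v)"
    using finite_incident[OF assms(1)] proper_range[OF assms(2)]
    by (intro sum_distinct_pos) (auto simp: incident_edges_def)
  then show ?thesis using inj by (simp add: card_image sum.reindex csum_def graph_degree_def)
qed

text \<open>A vertex of degree at most 2 has sum at most \<open>2 * k\<close>, so it never conflicts
  with a neighbour of degree at least k / 2. The sum of such a neighbour is at least k * (k + 2) /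
  8, and k + 2 exceeds 16.\<close>

lemma csum_heavy:
  assumes "simple_edges D" "proper_edge_colouring D k c" "29 \<le> k" "k \<le> 2 * deg D v"
  shows "2 * k < csum D c v"
proof -
  have "k * (k + 2) \<le> (2 * deg D v) * (2 * deg D v + 2)" using assms(4) by (intro mult_le_mono) auto
  moreover have "(2 * deg D v) * (2 * deg D v + 2) = 4 * (deg D v * (deg D v + 1))" by algebra
  moreover have "k * 31 \<le> k * (k + 2)" using assms(3) by (intro mult_le_mono2) simp
  ultimately show ?thesis using csum_ge[OF assms(1,2), of v] assms(3) by linarith
qed

text \<open>The set \<open>X\<close> collects the vertices whose sums are still to be changed. Isolated edges are
  exempt, so that the notion is inherited by subgraphs.\<close>

definition good_off :: "nat \<Rightarrow> 'a set set \<Rightarrow> ('a set \<Rightarrow> nat) \<Rightarrow> 'a set \<Rightarrow> bool" where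
  "good_off k E c X \<longleftrightarrow> proper_edge_colouring E k c \<and>
     (\<forall>u v. {u,v} \<in> E \<longrightarrow> u \<notin> X \<longrightarrow> v \<notin> X \<longrightarrow> csum E c u \<noteq> csum E c v \<or> deg E u = 1 \<and> deg E v = 1)"

lemma good_off_mono: "good_off k E c X \<Longrightarrow> X \<subseteq> Y \<Longrightarrow> good_off k E c Y"
  by (auto simp: good_off_def)

text \<open>The condition on the ends of an edge still to be coloured: its colour is added to both
  sums and so preserves their difference. If both ends have degree 0, the edge becomes isolated and
  is exempt.\<close>

definition diff_at :: "'a set set \<Rightarrow> ('a set \<Rightarrow> nat) \<Rightarrow> 'a \<Rightarrow> 'a \<Rightarrow> bool" where
  "diff_at E c u v \<longleftrightarrow> csum E c u \<noteq> csum E c v \<or> deg E u = 0 \<and> deg E v = 0"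

lemma proper_insert:
  assumes "proper_edge_colouring D k c" "e \<notin> D" "x \<in> {1..k}"
    and "\<And>v. v \<in> e \<Longrightarrow> x \<notin> c ` incident_edges D v"
  shows "proper_edge_colouring (insert e D) k (c(e := x))"
proof -
  have "x \<noteq> c f" if "f \<in> D" "e \<inter> f \<noteq> {}" for f
    using assms(4) that by (auto simp: incident_edges_def)
  moreover have "(c(e := x)) ` insert e D \<subseteq> {1..k}"
    using assms(1-3) by (auto simp: proper_edge_colouring_def)
  ultimately show ?thesis
    using assms(1,2) unfolding proper_edge_colouring_def
    by (auto simp: Int_commute)
qed

text \<open>Excluded for the new colour are \<open>Z\<close>, the colours at both ends and, for each
  end outside \<open>X\<close>, one value per neighbour that would equalise their sums. Hence the
  degree of an end counts twice outside \<open>X\<close> and once inside.\<close>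

lemma extend_edge:
  assumes D: "simple_edges D" "{u,v} \<notin> D" "u \<noteq> v"
    and good: "good_off k D c (X \<union> {u,v})" and Z: "finite Z"
    and diff: "u \<in> X \<or> v \<in> X \<or> diff_at D c u v"
    and card: "card Z + deg D u + deg D v + (if u \<in> X then 0 else deg D u) + (if v \<in> X then 0 else deg D v) < k"
  obtains x where "x \<notin> Z" "good_off k (insert {u,v} D) (c({u,v} := x)) X"
proof -
  \<comment> \<open>Truncated subtraction is harmless: where the difference would be negative it
    gives 0, which only excludes a value that is no colour.\<close>
  let ?F = "\<lambda>u. if u \<in> X then {} else (\<lambda>z. csum D c z - csum D c u) ` nb D u"
  let ?B = "Z \<union> c ` incident_edges D u \<union> c ` incident_edges D v \<union> ?F u \<union> ?F v"
  have fin: "finite ?B" using Z finite_incident[OF D(1)] finite_nb[OF D(1)] by auto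
  have F: "card (?F u) \<le> (if u \<in> X then 0 else deg D u)" for u
    using card_image_le[OF finite_nb[OF D(1), of u], of "\<lambda>z. csum D c z - csum D c u"] card_nb[OF D(1), of u] by auto
  have C: "card (c ` incident_edges D u) \<le> deg D u" for u
    unfolding graph_degree_def using card_image_le finite_incident[OF D(1)] by blast
  have "card ?B \<le> card Z + card (c ` incident_edges D u) + card (c ` incident_edges D v) + card (?F u) + card (?F v)"
    by (intro order.trans[OF card_Un_le] add_mono order.refl)
  then have "card ?B < k" using card F[of u] F[of v] C[of u] C[of v] by linarith
  then have "\<not> {1..k} \<subseteq> ?B" using card_mono[OF fin, of "{1..k}"] by auto
  then obtain x where x: "x \<in> {1..k}" "x \<notin> ?B" by blast
  let ?D = "insert {u,v} D" and ?c = "c({u,v} := x)"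
  have prp: "proper_edge_colouring ?D k ?c"
    using good x by (intro proper_insert[OF _ D(2)]) (auto simp: good_off_def)
  note cs = csum_insert[OF D(1,2), of c x]
  note dg = deg_insert[OF D(1,2)]
  have conf: "csum D c a + x \<noteq> csum D c z" if "a \<in> {u,v}" "a \<notin> X" "{a,z} \<in> D" for a z
  proof
    assume "csum D c a + x = csum D c z"
    then have "x = csum D c z - csum D c a" by simp
    moreover have "z \<in> nb D a" using that(3) by (simp add: nb_def)
    ultimately have "x \<in> ?F a" using that(2) by auto
    then show False using x(2) that(1) by blast
  qed
  have "good_off k ?D ?c X"
    unfolding good_off_def
  proof (intro conjI allI impI prp)
    fix a b assume ab: "{a,b} \<in> ?D" "a \<notin> X" "b \<notin> X"
    show "csum ?D ?c a \<noteq> csum ?D ?c b \<or> deg ?D a = 1 \<and> deg ?D b = 1"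
    proof (cases "{a,b} = {u,v}")
      case True
      then show ?thesis using diff ab(2,3) unfolding cs dg diff_at_def by (auto simp: doubleton_eq_iff)
    next
      case False
      then have abD: "{a,b} \<in> D" "{b,a} \<in> D" using ab(1) by (auto simp: insert_commute)
      then have ne: "a \<noteq> b" using D(1) simple_edges_neq by metis
      consider "a \<in> {u,v}" "b \<notin> {u,v}" | "a \<notin> {u,v}" "b \<in> {u,v}" | "a \<notin> {u,v}" "b \<notin> {u,v}"
        using False ne by (auto simp: insert_commute)
      then show ?thesis
      proof cases
        case 1 then show ?thesis using conf[of a b] ab(2) abD(1) unfolding cs by simp
      next
        case 2 then show ?thesis using conf[of b a] ab(3) abD(2) unfolding cs by simp
      next
        case 3
        then have "csum D c a \<noteq> csum D c b \<or> deg D a = 1 \<and> deg D b = 1"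
          using good ab(2,3) abD(1) unfolding good_off_def by blast
        then show ?thesis using 3 unfolding cs dg by simp
      qed
    qed
  qed
  then show ?thesis using that x(2) by blast
qed

text \<open>Without the edge the ends have degrees smaller by at least 1, and each counts twice in
  \<open>extend_edge\<close>: at most 2 * (deg u - 1) + 2 * (deg v - 1) values are excluded, which
  is less than \<open>k\<close> exactly under this condition.\<close>

definition light :: "nat \<Rightarrow> 'a set set \<Rightarrow> 'a \<Rightarrow> 'a \<Rightarrow> bool" where
  "light k E u v \<longleftrightarrow> {u,v} \<in> E \<and> 2 * (deg E u + deg E v) < k + 4"

lemma light_sym: "light k E u v \<longleftrightarrow> light k E v u"
  by (auto simp: light_def insert_commute add.commute)

text \<open>The edges are coloured one after another. Ends of the edges still missing stay exempt,
  and since the edges are disjoint their sums are not changed by the colours already given.\<close>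

lemma extend_light_matching:
  assumes E: "simple_edges E" and M: "M \<subseteq> E"
    and light: "\<And>u v. {u,v} \<in> M \<Longrightarrow> light k E u v"
    and disj: "\<And>e f. e \<in> M \<Longrightarrow> f \<in> M \<Longrightarrow> e \<noteq> f \<Longrightarrow> e \<inter> f = {}"
    and good: "good_off k (E - M) c (\<Union>M)"
    and diff: "\<And>u v. {u,v} \<in> M \<Longrightarrow> diff_at (E - M) c u v"
  shows "\<exists>c. good_off k E c {}"
proof -
  have "finite M" using E M finite_subset by (auto simp: simple_edges_def)
  then show ?thesis using assms(2-)
  proof (induction M arbitrary: c rule: finite_induct)
    case empty then show ?case by auto
  next
    case (insert e M)
    let ?D = "E - insert e M"
    have D: "simple_edges ?D" using E simple_edges_mono by blast
    have eE: "e \<in> E" using insert.prems by simp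
    then obtain u v where e: "e = {u,v}" "u \<noteq> v" using E by (meson simple_edges_cases)
    have ins: "insert e ?D = E - M" using insert.hyps eE by auto
    have dg: "deg ?D a + 1 \<le> deg E a" if "a \<in> e" for a
    proof -
      have "deg ?D a \<le> deg (E - {e}) a" by (rule deg_mono) (use simple_edges_mono[OF E] in auto)
      then show ?thesis using deg_remove[OF E eE that] by simp
    qed
    have "2 * (deg E u + deg E v) < k + 4" using insert.prems(2)[of u v] e by (simp add: light_def)
    then have small: "card ({} :: nat set) + deg ?D u + deg ?D v + (if u \<in> \<Union>M then 0 else deg ?D u)
        + (if v \<in> \<Union>M then 0 else deg ?D v) < k"
      using dg[of u] dg[of v] e by auto
    have "good_off k ?D c (\<Union>M \<union> {u,v})" using insert.prems(4) e by (simp add: Un_commute)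
    moreover have "diff_at ?D c u v" using insert.prems(5)[of u v] e by auto
    moreover have "{u,v} \<notin> ?D" using e by simp
    ultimately obtain x where x: "good_off k (insert {u,v} ?D) (c({u,v} := x)) (\<Union>M)"
      using extend_edge[OF D _ e(2) _ finite.emptyI _ small, of c] by metis
    have nin: "a \<notin> e" if "{a,b} \<in> M" for a b
      using insert.prems(3)[of "{a,b}" e] insert.hyps that by auto
    show ?case
    proof (rule insert.IH)
      show "good_off k (E - M) (c(e := x)) (\<Union>M)" using x e ins by simp
      fix a b assume ab: "{a,b} \<in> M"
      then have "{b,a} \<in> M" by (simp add: insert_commute)
      then have "csum (E - M) (c(e := x)) a = csum ?D c a" "csum (E - M) (c(e := x)) b = csum ?D c b"
          "deg (E - M) a = deg ?D a" "deg (E - M) b = deg ?D b"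
        using csum_insert[OF D, of e c x] deg_insert[OF D, of e] nin[of a b] nin[of b a] ab ins by simp_all
      then show "diff_at (E - M) (c(e := x)) a b" using insert.prems(5)[of a b] ab by (simp add: diff_at_def)
    qed (use insert.prems in auto)
  qed
qed

lemma good_offD:
  assumes "good_off k E c X" "{u,v} \<in> E" "u \<notin> X" "v \<notin> X"
  shows "csum E c u \<noteq> csum E c v \<or> deg E u = 1 \<and> deg E v = 1"
  using assms unfolding good_off_def by blast

lemma good_off_proper: "good_off k E c X \<Longrightarrow> proper_edge_colouring E k c"
  by (simp add: good_off_def)

text \<open>The exchange permutes the colours at \<open>w\<close>. Only the sums at \<open>u\<close>
  and \<open>v\<close> change, by opposite amounts, which is how equal sums are made different
  later.\<close>

lemma swap_colours:
  assumes D: "simple_edges D" "proper_edge_colouring D k c"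
    and e: "{u,w} \<in> D" "{v,w} \<in> D" "u \<noteq> v"
    and free: "c {v,w} \<notin> c ` (incident_edges D u - {{u,w}})" "c {u,w} \<notin> c ` (incident_edges D v - {{v,w}})"
  defines "c' \<equiv> c({u,w} := c {v,w}, {v,w} := c {u,w})"
  shows "proper_edge_colouring D k c'"
    and "z \<notin> {u,v} \<Longrightarrow> csum D c' z = csum D c z"
    and "csum D c' u + c {u,w} = csum D c u + c {v,w}"
    and "csum D c' v + c {v,w} = csum D c v + c {u,w}"
    and "good_off k D c X \<Longrightarrow> good_off k D c' (X \<union> {u,v})"
proof -
  let ?e = "{u,w}" and ?f = "{v,w}"
  have uw: "u \<noteq> w" "v \<noteq> w" using simple_edges_neq[OF D(1)] e by auto
  have ef: "?e \<noteq> ?f" using e(3) by (auto simp: doubleton_eq_iff)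
  have c': "c' ?e = c ?f" "c' ?f = c ?e" "\<And>g. g \<noteq> ?e \<Longrightarrow> g \<noteq> ?f \<Longrightarrow> c' g = c g"
    using ef by (auto simp: c'_def)
  have *: "c' h \<noteq> c' g" if hg: "h \<in> D" "g \<in> D" "h \<noteq> g" "x \<in> h" "x \<in> g" "h \<in> {?e, ?f}" for g h x
  proof (cases "g \<in> {?e, ?f}")
    case True
    then have "{c' h, c' g} = {c ?e, c ?f}" using hg(3,6) c' by auto
    moreover have "c ?e \<noteq> c ?f" using proper_neq[OF D(2) e(1,2), of w] ef by auto
    ultimately show ?thesis by (auto simp: doubleton_eq_iff)
  next
    case False
    then have g: "c' g = c g" using c' by auto
    show ?thesis
    proof (cases "x = w")
      case True
      then have "c ?e \<noteq> c g" "c ?f \<noteq> c g"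
        using proper_neq[OF D(2) e(1) hg(2), of w] proper_neq[OF D(2) e(2) hg(2), of w] hg(5) False by auto
      then show ?thesis using hg(6) c'(1,2) g by auto
    next
      case nw: False
      show ?thesis
      proof (cases "h = ?e")
        case True
        then have "x = u" using nw hg(4) by auto
        then have "g \<in> incident_edges D u - {?e}" using hg False by (auto simp: incident_edges_def)
        then have "c g \<noteq> c ?f" using free(1) by (metis imageI)
        then show ?thesis using True c'(1) g by simp
      next
        case hf: False
        then have "x = v" "h = ?f" using nw hg(4,6) by auto
        then have "g \<in> incident_edges D v - {?f}" using hg False by (auto simp: incident_edges_def)
        then have "c g \<noteq> c ?e" using free(2) by (metis imageI)
        then show ?thesis using \<open>h = ?f\<close> c'(2) g by simp
      qed
    qed
  qed
  show prp: "proper_edge_colouring D k c'"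
    unfolding proper_edge_colouring_def
  proof (intro conjI ballI impI)
    have "c' g \<in> {1..k}" if "g \<in> D" for g
      using D(2) e that c' unfolding proper_edge_colouring_def by (metis image_subset_iff)
    then show "c' ` D \<subseteq> {1..k}" by auto
    fix h g assume hg: "h \<in> D" "g \<in> D" "h \<noteq> g" "h \<inter> g \<noteq> {}"
    then obtain x where x: "x \<in> h" "x \<in> g" by auto
    consider "h \<in> {?e,?f}" | "g \<in> {?e,?f}" | "h \<notin> {?e,?f}" "g \<notin> {?e,?f}" by blast
    then show "c' h \<noteq> c' g"
    proof cases
      case 1 then show ?thesis using *[OF hg(1-3) x] by blast
    next
      case 2 then show ?thesis using *[OF hg(2,1) _ x(2,1)] hg(3) by metis
    next
      case 3 then show ?thesis using proper_neq[OF D(2) hg(1,2) x hg(3)] c'(3) by simp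
    qed
  qed
  have fin: "finite (incident_edges D z)" for z by (rule finite_incident[OF D(1)])
  show other: "csum D c' z = csum D c z" if z: "z \<notin> {u,v}" for z
  proof (cases "z = w")
    case True
    have mem: "?e \<in> incident_edges D w" "?f \<in> incident_edges D w - {?e}"
      using e ef by (auto simp: incident_edges_def)
    have "csum D c'' w = c'' ?e + (c'' ?f + sum c'' (incident_edges D w - {?e} - {?f}))" for c'' :: "'a set \<Rightarrow> nat"
      unfolding csum_def using sum.remove[OF fin mem(1), of c''] sum.remove[OF _ mem(2), of c''] fin[of w] by simp
    moreover have "sum c' (incident_edges D w - {?e} - {?f}) = sum c (incident_edges D w - {?e} - {?f})"
      using c'(3) by (intro sum.cong) auto
    ultimately show ?thesis using True c' by simp
  next
    case False
    then show ?thesis using z c'(3) by (intro csum_cong) auto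
  qed
  have mem: "?e \<in> incident_edges D u" "?f \<in> incident_edges D v" using e by (auto simp: incident_edges_def)
  have "c' g = c g" if "g \<in> incident_edges D u - {?e}" for g
    using that c'(3)[of g] e(3) uw by (auto simp: incident_edges_def)
  then have "sum c' (incident_edges D u - {?e}) = sum c (incident_edges D u - {?e})"
    by (intro sum.cong) simp_all
  then show "csum D c' u + c {u,w} = csum D c u + c {v,w}"
    unfolding csum_def using sum.remove[OF fin mem(1), of c] sum.remove[OF fin mem(1), of c'] c' by simp
  have "c' g = c g" if "g \<in> incident_edges D v - {?f}" for g
  proof (rule c'(3))
    show "g \<noteq> ?e" "g \<noteq> ?f" using that e(3) uw by (auto simp: incident_edges_def)
  qed
  then have "sum c' (incident_edges D v - {?f}) = sum c (incident_edges D v - {?f})"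
    by (intro sum.cong) simp_all
  then show "csum D c' v + c {v,w} = csum D c v + c {u,w}"
    unfolding csum_def using sum.remove[OF fin mem(2), of c] sum.remove[OF fin mem(2), of c'] c' by simp
  show "good_off k D c' (X \<union> {u,v})" if "good_off k D c X"
    unfolding good_off_def
  proof (intro conjI allI impI prp)
    fix a b assume "{a,b} \<in> D" "a \<notin> X \<union> {u,v}" "b \<notin> X \<union> {u,v}"
    then show "csum D c' a \<noteq> csum D c' b \<or> deg D a = 1 \<and> deg D b = 1"
      using good_offD[OF that, of a b] other[of a] other[of b] by simp
  qed
qed

lemma good_off_restrict:
  assumes E: "good_off k E c X" and M: "M \<subseteq> E"
  shows "good_off k (E - M) c (X \<union> \<Union>M)"
proof -
  have *: "csum (E - M) c v = csum E c v \<and> deg (E - M) v = deg E v" if "v \<notin> \<Union>M" for v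
    using that by (intro conjI csum_cong deg_cong) auto
  have prp: "proper_edge_colouring (E - M) k c"
    by (rule proper_mono[of E]) (use E in \<open>simp_all add: good_off_def\<close>)
  show ?thesis
    unfolding good_off_def
  proof (intro conjI allI impI prp)
    fix a b assume ab: "{a,b} \<in> E - M" "a \<notin> X \<union> \<Union>M" "b \<notin> X \<union> \<Union>M"
    then have "csum E c a \<noteq> csum E c b \<or> deg E a = 1 \<and> deg E b = 1"
      by (intro good_offD[OF E]) auto
    then show "csum (E - M) c a \<noteq> csum (E - M) c b \<or> deg (E - M) a = 1 \<and> deg (E - M) b = 1"
      using *[of a] *[of b] ab by simp
  qed
qed

section \<open>The minimal counterexample and its light edges\<close>

locale minimal_counterexample =
  fixes E :: "'a set set" and k :: nat
  assumes E: "simple_edges E" and deg_less: "\<And>v. deg E v < k" and k: "29 \<le> k"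
    and IH: "\<And>D. D \<subset> E \<Longrightarrow> \<exists>c. good_off k D c {}"
    and none: "\<not> (\<exists>c. good_off k E c {})"
begin

lemma sub: "D \<subseteq> E \<Longrightarrow> simple_edges D" using E simple_edges_mono by blast

lemma minus_good:
  assumes "M \<subseteq> E" "M \<noteq> {}" obtains c where "good_off k (E - M) c {}"
  using IH[of "E - M"] assms by blast

lemma edge_neq: "{u,v} \<in> E \<Longrightarrow> u \<noteq> v" using E simple_edges_neq by metis

text \<open>The source of most contradictions below: a light edge could be added back if its ends
  differed, so in every suitable colouring without it their sums agree.\<close>

lemma light_stuck:
  assumes "light k E u v" "good_off k (E - {{u,v}}) c {u,v}"
  shows "csum (E - {{u,v}}) c u = csum (E - {{u,v}}) c v"
    and "deg (E - {{u,v}}) u \<noteq> 0 \<or> deg (E - {{u,v}}) v \<noteq> 0"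
proof -
  have "\<not> diff_at (E - {{u,v}}) c u v"
  proof
    assume "diff_at (E - {{u,v}}) c u v"
    then have "\<exists>c. good_off k E c {}"
      using assms light_sym[of k E u v]
      by (intro extend_light_matching[OF E, of "{{u,v}}"]) (auto simp: light_def doubleton_eq_iff diff_at_def)
    then show False using none by blast
  qed
  then show "csum (E - {{u,v}}) c u = csum (E - {{u,v}}) c v"
    "deg (E - {{u,v}}) u \<noteq> 0 \<or> deg (E - {{u,v}}) v \<noteq> 0"
    by (auto simp: diff_at_def)
qed

text \<open>Otherwise \<open>u\<close> has degree and sum 0 once the edge is removed. The sum at
  \<open>v\<close> is then 0 as well, which forces degree 0 at both ends.\<close>

lemma light_deg_ge_2:
  assumes "light k E u v" shows "2 \<le> deg E u"
proof (rule ccontr)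
  assume *: "\<not> ?thesis"
  have e: "{u,v} \<in> E" using assms by (simp add: light_def)
  let ?D = "E - {{u,v}}"
  obtain c where c: "good_off k ?D c {}" using minus_good[of "{{u,v}}"] e by auto
  note st = light_stuck[OF assms good_off_mono[OF c]]
  have "deg ?D u = 0" using deg_remove[OF E e, of u] * by simp
  moreover have "proper_edge_colouring ?D k c" using c by (simp add: good_off_def)
  ultimately show False using st csum_le[of ?D k c u] csum_ge_deg[of ?D k c v] by simp
qed

text \<open>Delete \<open>uv\<close> and \<open>uy\<close>, then recolour \<open>uy\<close> so that
  the sums at \<open>u\<close> and \<open>v\<close> differ. The end \<open>u\<close> is exempt and
  has lost two edges, \<open>y\<close> has lost one; with the one extra value, at most 1 + (deg u -
  2) + 2 * (deg y - 1) colours are excluded, fewer than \<open>k\<close> under the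
  hypothesis.\<close>

lemma light_only:
  assumes light: "light k E u v" and y: "{u,y} \<in> E" "deg E u + 2 * deg E y \<le> k + 2"
  shows "y = v"
proof (rule ccontr)
  assume "y \<noteq> v"
  have e: "{u,v} \<in> E" using light by (simp add: light_def)
  let ?M = "{{u,v},{u,y}}"
  let ?D = "E - ?M"
  have ne: "{u,v} \<noteq> {u,y}" using \<open>y \<noteq> v\<close> by (auto simp: doubleton_eq_iff)
  have uy: "u \<noteq> y" "u \<noteq> v" using edge_neq y e by auto
  obtain c where c: "good_off k ?D c {}" using minus_good[of ?M] e y by auto
  have D: "simple_edges ?D" using sub by auto
  have ins: "insert {u,y} ?D = E - {{u,v}}" using y ne by auto
  have E1: "simple_edges (E - {{u,v}})" using sub by auto
  have "{u,y} \<in> E - {{u,v}}" using y ne by auto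
  then have "deg (E - {{u,v}} - {{u,y}}) u + 1 = deg (E - {{u,v}}) u" "deg (E - {{u,v}} - {{u,y}}) y + 1 = deg (E - {{u,v}}) y"
    using deg_remove[OF E1] by auto
  moreover have "E - {{u,v}} - {{u,y}} = ?D" by auto
  moreover have "deg (E - {{u,v}}) u + 1 = deg E u" using deg_remove[OF E e] by auto
  moreover have "deg (E - {{u,v}}) y \<le> deg E y" using deg_mono[OF E] by auto
  ultimately have dg: "deg ?D u + 2 = deg E u" "deg ?D y + 1 \<le> deg E y" by auto
  let ?Z = "{csum ?D c v - csum ?D c u}"
  have "card ?Z + deg ?D u + deg ?D y + (if u \<in> {u,v} then 0 else deg ?D u) + (if y \<in> {u,v} then 0 else deg ?D y) < k"
    using dg y(2) uy \<open>y \<noteq> v\<close> by auto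
  moreover have "{u,y} \<notin> ?D" by auto
  ultimately obtain x where x: "x \<notin> ?Z" "good_off k (insert {u,y} ?D) (c({u,y} := x)) {u,v}"
    using extend_edge[OF D _ uy(1) good_off_mono[OF c], of "{u,v}" ?Z] by auto
  have g: "good_off k (E - {{u,v}}) (c({u,y} := x)) {u,v}" using x(2) ins by simp
  have "csum (E - {{u,v}}) (c({u,y} := x)) u = csum ?D c u + x"
    "csum (E - {{u,v}}) (c({u,y} := x)) v = csum ?D c v"
    using csum_insert[OF D, of "{u,y}" c x] ins uy \<open>y \<noteq> v\<close> by auto
  then show False using light_stuck(1)[OF light g] x(1) by auto
qed

lemma light_unique:
  assumes "light k E u v" "light k E u y" shows "y = v"
  using light_only[OF assms(1), of y] assms(2) light_deg_ge_2[OF assms(1)] by (simp add: light_def)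

text \<open>With \<open>uv\<close> deleted, the sum at \<open>u\<close> is the colour of
  \<open>uw\<close> and equals the sum at \<open>v\<close>. So this colour cannot occur at
  \<open>v\<close> beside the positive colour of \<open>vw\<close>, and exchanging the colours of
  \<open>uw\<close> and \<open>vw\<close> is proper and makes the two sums differ.\<close>

lemma light_pendant_triangle:
  assumes light: "light k E u v" and "deg E u = 2" "{u,w} \<in> E" "{v,w} \<in> E"
  shows False
proof -
  have e: "{u,v} \<in> E" using light by (simp add: light_def)
  let ?D = "E - {{u,v}}"
  have D: "simple_edges ?D" using sub by auto
  have ne: "u \<noteq> v" "u \<noteq> w" "v \<noteq> w" using edge_neq assms e by auto
  obtain c where c: "good_off k ?D c {}" using minus_good[of "{{u,v}}"] e by auto
  then have prp: "proper_edge_colouring ?D k c" by (simp add: good_off_def)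
  have mem: "{u,w} \<in> ?D" "{v,w} \<in> ?D" using assms ne by (auto simp: doubleton_eq_iff)
  have cuv: "csum ?D c u = csum ?D c v" using light_stuck(1)[OF light good_off_mono[OF c]] by simp
  have "card (incident_edges ?D u) = 1" using deg_remove[OF E e, of u] assms(2) by (simp add: graph_degree_def)
  moreover have "{u,w} \<in> incident_edges ?D u" using mem by (simp add: incident_edges_def)
  ultimately have inc: "incident_edges ?D u = {{u,w}}" by (metis card_1_singletonE singletonD)
  then have cu: "csum ?D c u = c {u,w}" by (simp add: csum_def)
  have "{v,w} \<in> incident_edges ?D v" using mem by (simp add: incident_edges_def)
  then have cv: "csum ?D c v = c {v,w} + sum c (incident_edges ?D v - {{v,w}})"
    using finite_incident[OF D] by (simp add: csum_def sum.remove)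
  have "c {u,w} \<noteq> c {v,w}" using proper_neq[OF prp mem, of w] ne by (auto simp: doubleton_eq_iff)
  have "c {u,w} \<notin> c ` (incident_edges ?D v - {{v,w}})"
  proof
    assume "c {u,w} \<in> c ` (incident_edges ?D v - {{v,w}})"
    then obtain f where f: "f \<in> incident_edges ?D v - {{v,w}}" "c {u,w} = c f" by auto
    then have "c f \<le> sum c (incident_edges ?D v - {{v,w}})"
      using finite_incident[OF D] by (intro member_le_sum) auto
    then show False using cu cv cuv f(2) proper_range[OF prp mem(2)] by simp
  qed
  then have sw: "csum ?D (c({u,w} := c {v,w}, {v,w} := c {u,w})) u + c {u,w} = csum ?D c u + c {v,w}"
    "csum ?D (c({u,w} := c {v,w}, {v,w} := c {u,w})) v + c {v,w} = csum ?D c v + c {u,w}"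
    "good_off k ?D (c({u,w} := c {v,w}, {v,w} := c {u,w})) ({} \<union> {u,v})"
    using swap_colours(3-5)[OF D prp mem ne(1), of] inc c by auto
  have "csum ?D (c({u,w} := c {v,w}, {v,w} := c {u,w})) u = csum ?D (c({u,w} := c {v,w}, {v,w} := c {u,w})) v"
    using light_stuck(1)[OF light] sw(3) by simp
  then show False using sw(1,2) cuv \<open>c {u,w} \<noteq> c {v,w}\<close> by simp
qed

end

section \<open>Recolouring the edges at a vertex\<close>

lemma distinct_sums_many:
  fixes L :: "'i \<Rightarrow> nat set"
  assumes "finite I" "card I \<le> n" "\<And>i. i \<in> I \<Longrightarrow> finite (L i) \<and> n \<le> card (L i)"
  shows "\<exists>S. finite S \<and> card S = card I * (n - card I) + 1 \<and>
    (\<forall>s\<in>S. \<exists>x. inj_on x I \<and> (\<forall>i\<in>I. x i \<in> L i) \<and> sum x I = s)"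
  using assms
proof (induction "card I" arbitrary: I n L)
  case 0
  then have "I = {}" by simp
  then show ?case by (intro exI[of _ "{0}"]) simp
next
  case (Suc t)
  let ?U = "\<Union>i\<in>I. L i"
  have I: "I \<noteq> {}" "finite ?U" using Suc.hyps(2) Suc.prems by auto
  then obtain i0 where "i0 \<in> I" by auto
  have "1 \<le> card (L i0)" using Suc.prems(2,3)[of ] Suc.hyps(2) Suc.prems(3)[OF \<open>i0 \<in> I\<close>] by linarith
  then have "L i0 \<noteq> {}" by auto
  then have ne: "?U \<noteq> {}" using \<open>i0 \<in> I\<close> by auto
  define a where "a = Min ?U"
  have "a \<in> ?U" unfolding a_def by (rule Min_in[OF I(2) ne])
  have amin: "\<And>b. b \<in> ?U \<Longrightarrow> a \<le> b" unfolding a_def by (rule Min_le[OF I(2)])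
  from \<open>a \<in> ?U\<close> obtain j where j: "j \<in> I" "a \<in> L j" by auto
  define I' where "I' = I - {j}"
  have I': "finite I'" "card I' = t" "I = insert j I'" "j \<notin> I'"
    using j Suc.prems(1) Suc.hyps(2) by (auto simp: I'_def)
  have "\<exists>S. finite S \<and> card S = card I' * (n - 1 - card I') + 1 \<and>
    (\<forall>s\<in>S. \<exists>x. inj_on x I' \<and> (\<forall>i\<in>I'. x i \<in> L i - {a}) \<and> sum x I' = s)"
  proof (rule Suc.hyps(1))
    show "card I' \<le> n - 1" using I' Suc.hyps(2) Suc.prems(2) by simp
    fix i assume "i \<in> I'"
    then have "finite (L i)" "n \<le> card (L i)" using Suc.prems(3)[of i] I'(3) by auto
    then show "finite (L i - {a}) \<and> n - 1 \<le> card (L i - {a})"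
      using card_Diff1_le[of "L i" a] by (auto simp: card_Diff_singleton_if)
  qed (use I' in auto)
  then obtain S where S: "finite S" "card S = t * (n - 1 - t) + 1"
    "\<And>s. s \<in> S \<Longrightarrow> \<exists>x. inj_on x I' \<and> (\<forall>i\<in>I'. x i \<in> L i - {a}) \<and> sum x I' = s"
    using I'(2) by auto
  have "S \<noteq> {}" using S(2) by auto
  define m where "m = Max S"
  have m: "m \<in> S" "\<And>s. s \<in> S \<Longrightarrow> s \<le> m" unfolding m_def using S(1) \<open>S \<noteq> {}\<close> by auto
  obtain x where x: "inj_on x I'" "\<And>i. i \<in> I' \<Longrightarrow> x i \<in> L i - {a}" "sum x I' = m" using S(3)[OF m(1)] by blast
  have Lj: "finite (L j)" "n \<le> card (L j)" using Suc.prems(3)[OF j(1)] by auto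
  have "card (x ` I' \<union> {a}) \<le> t + 1"
    using I' card_image_le[of I' x] card_insert_le_m1 by (simp add: card_insert_if le_SucI)
  then have "n - (t + 1) \<le> card (L j - (x ` I' \<union> {a}))"
    using diff_card_le_card_Diff[of "x ` I' \<union> {a}" "L j"] I'(1) Lj by simp
  then obtain B where B: "B \<subseteq> L j - (x ` I' \<union> {a})" "card B = n - (t + 1)" "finite B"
    by (meson obtain_subset_with_card_n)
  let ?S = "(\<lambda>s. s + a) ` S \<union> (\<lambda>b. m + b) ` B"
  have "s + a \<noteq> m + b" if "s \<in> S" "b \<in> B" for s b
  proof -
    have "b \<in> ?U" "b \<noteq> a" using B(1) that(2) j(1) by auto
    then show ?thesis using amin[of b] m(2)[OF that(1)] by simp
  qed
  then have "card ?S = card S + card B"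
    using S(1) B(3) by (subst card_Un_disjoint) (auto simp: card_image inj_on_def)
  also have "\<dots> = Suc t * (n - Suc t) + 1" using S(2) B(2) by simp
  finally have card: "card ?S = card I * (n - card I) + 1" using Suc.hyps(2) by simp
  have ext: "\<exists>y. inj_on y I \<and> (\<forall>i\<in>I. y i \<in> L i) \<and> sum y I = s + b"
    if "inj_on z I'" "\<And>i. i \<in> I' \<Longrightarrow> z i \<in> L i" "sum z I' = s" "b \<in> L j" "b \<notin> z ` I'" for z s b
  proof (intro exI conjI ballI)
    let ?y = "z(j := b)"
    have eq: "?y i = z i" if "i \<in> I'" for i using that I'(4) by auto
    show "inj_on ?y I" unfolding I'(3) using that(1,5) I'(4) by (auto simp: inj_on_def)
    show "?y i \<in> L i" if "i \<in> I" for i using that \<open>b \<in> L j\<close> I'(3) \<open>\<And>i. i \<in> I' \<Longrightarrow> z i \<in> L i\<close> by auto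
    have "sum ?y I = b + sum ?y I'" using I' by simp
    also have "sum ?y I' = sum z I'" using eq by (rule sum.cong[OF refl])
    finally show "sum ?y I = s + b" using that(3) by simp
  qed
  have "\<exists>y. inj_on y I \<and> (\<forall>i\<in>I. y i \<in> L i) \<and> sum y I = q" if q: "q \<in> ?S" for q
  proof -
    from q consider s where "s \<in> S" "q = s + a" | b where "b \<in> B" "q = m + b" by auto
    then show ?thesis
    proof cases
      case 1
      then obtain z where z: "inj_on z I'" "\<And>i. i \<in> I' \<Longrightarrow> z i \<in> L i - {a}" "sum z I' = s"
        using S(3) by blast
      have "a \<notin> z ` I'" using z(2) by blast
      then show ?thesis using ext[OF z(1) _ z(3) j(2)] z(2) 1(2) by auto
    next
      case 2
      then have "b \<in> L j" "b \<notin> x ` I'" using B(1) by auto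
      then show ?thesis using ext[OF x(1) _ x(3)] x(2) 2(2) by auto
    qed
  qed
  then show ?case using card S(1) B(3) by (intro exI[of _ ?S]) auto
qed

lemma distinct_choice_avoiding:
  fixes L :: "'i \<Rightarrow> nat set"
  assumes "finite I" "card I \<le> n" "\<And>i. i \<in> I \<Longrightarrow> finite (L i) \<and> n \<le> card (L i)"
    and "finite Z" "card Z \<le> card I * (n - card I)"
  shows "\<exists>x. inj_on x I \<and> (\<forall>i\<in>I. x i \<in> L i) \<and> sum x I \<notin> Z"
proof -
  have "\<exists>S. finite S \<and> card S = card I * (n - card I) + 1 \<and>
    (\<forall>s\<in>S. \<exists>x. inj_on x I \<and> (\<forall>i\<in>I. x i \<in> L i) \<and> sum x I = s)"
    by (rule distinct_sums_many[OF assms(1-3)])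
  then obtain S where S: "finite S" "card S = card I * (n - card I) + 1"
    "\<forall>s\<in>S. \<exists>x. inj_on x I \<and> (\<forall>i\<in>I. x i \<in> L i) \<and> sum x I = s"
    by (elim exE conjE)
  have "\<not> S \<subseteq> Z" using card_mono[OF assms(4), of S] S(2) assms(5) by auto
  then obtain s where s: "s \<in> S" "s \<notin> Z" by auto
  then obtain x where "inj_on x I" "\<forall>i\<in>I. x i \<in> L i" "sum x I = s" using S(3) by blast
  then show ?thesis using s(2) by blast
qed

text \<open>A bijection with the fewest forbidden values has none: exchanging the value at a
  violated place with that at a place where this value is allowed repairs it.\<close>

lemma bijection_avoiding:
  fixes A :: "'i \<Rightarrow> 'c set"
  assumes "finite I" "finite P" "card I = card P"
    and A: "\<And>i. i \<in> I \<Longrightarrow> \<exists>a. A i \<subseteq> {a}" and common: "\<And>a. a \<in> P \<Longrightarrow> \<exists>i\<in>I. a \<notin> A i"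
  obtains f where "bij_betw f I P" "\<And>i. i \<in> I \<Longrightarrow> f i \<notin> A i"
proof -
  define bad where "bad f = card {i\<in>I. f i \<in> A i}" for f
  obtain f0 where f0: "bij_betw f0 I P" using assms(1-3) finite_same_card_bij by blast
  define f where "f = arg_min bad (\<lambda>f. bij_betw f I P)"
  have f: "bij_betw f I P" and fmin: "\<And>g. bij_betw g I P \<Longrightarrow> bad f \<le> bad g"
    unfolding f_def using arg_min_natI[of "\<lambda>f. bij_betw f I P" f0 bad] f0
      arg_min_nat_le[of "\<lambda>f. bij_betw f I P" _ bad] by auto
  have "f i \<notin> A i" if i: "i \<in> I" for i
  proof
    assume fi: "f i \<in> A i"
    have "f i \<in> P" using f i by (auto simp: bij_betw_def)
    then obtain j where j: "j \<in> I" "f i \<notin> A j" using common by blast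
    have ij: "i \<noteq> j" using fi j by auto
    define g where "g = f(i := f j, j := f i)"
    have "bij_betw g I P"
    proof -
      have inj: "inj_on f I" and im: "f ` I = P" using f by (auto simp: bij_betw_def)
      have "inj_on g I"
        unfolding g_def inj_on_def using inj_onD[OF inj] i j(1) by auto
      moreover have "g ` I \<subseteq> P" unfolding g_def using im i j(1) by auto
      ultimately show ?thesis
        using card_subset_eq[OF assms(2), of "g ` I"] card_image[of g I] assms(3) by (simp add: bij_betw_def)
    qed
    moreover have "bad g < bad f"
    proof -
      have "f j \<notin> A i"
      proof
        assume "f j \<in> A i"
        then have "f i = f j" using fi A[OF i] by blast
        then show False using f i j(1) ij by (auto simp: bij_betw_def inj_on_def)
      qed
      then have "{i\<in>I. g i \<in> A i} \<subset> {i\<in>I. f i \<in> A i}"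
        using i fi j ij by (auto simp: g_def split: if_splits)
      then show ?thesis unfolding bad_def using assms(1) by (intro psubset_card_mono) auto
    qed
    ultimately show False using fmin[of g] by simp
  qed
  then show ?thesis using that f by blast
qed

context minimal_counterexample
begin

text \<open>The edges from \<open>w\<close> to \<open>I\<close> are recoloured simultaneously, and
  the light edges at \<open>J\<close> are added back last, which is why their ends may conflict with
  others in between. A vertex of \<open>I - J\<close> has a sum too small to equal that of a
  neighbour. There remain conflicts of \<open>w\<close> itself, and only with neighbours
  \<open>z\<close> whose largest possible sum reaches the least possible sum at
  \<open>w\<close>.\<close>

lemma recolour_star:
  assumes I: "finite I" "I \<noteq> {}" "\<And>i. i \<in> I \<Longrightarrow> {w,i} \<in> E \<and> deg E i \<le> 3"
    and J: "J \<subseteq> I" "\<And>i. i \<in> J \<Longrightarrow> light k E i (\<rho> i) \<and> \<rho> i \<noteq> w \<and> \<rho> i \<notin> I"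
    and NJ: "\<And>i. i \<in> I - J \<Longrightarrow> deg E i \<le> 2 \<and> k \<le> 2 * deg E w \<and>
      (\<forall>x. {i,x} \<in> E \<longrightarrow> x \<noteq> w \<longrightarrow> k \<le> 2 * deg E x)"
    and D_def: "D = E - ((\<lambda>i. {w,i}) ` I \<union> (\<lambda>i. {i, \<rho> i}) ` J)"
    and c: "good_off k D c {}"
    and x: "inj_on x I" "\<And>i. i \<in> I \<Longrightarrow> x i \<in> {1..k} - c ` incident_edges D w - c ` incident_edges D i"
      "\<And>i. i \<in> J \<Longrightarrow> x i + csum D c i \<noteq> csum D c (\<rho> i)"
      "\<And>z. z \<in> nb E w - I - \<rho> ` J \<Longrightarrow> deg E w * (deg E w + 1) \<le> 2 * (deg E z * k) \<Longrightarrow>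
        csum D c w + sum x I \<noteq> csum D c z"
  shows False
proof -
  let ?star = "(\<lambda>i. {w,i}) ` I"
  let ?M = "(\<lambda>i. {i, \<rho> i}) ` J"
  define D1 where "D1 = E - ?M"
  define c1 where "c1 e = (if e \<in> ?star then x (THE i. i \<in> I \<and> e = {w,i}) else c e)" for e
  have iw: "i \<noteq> w" "{w,i} \<in> E" if "i \<in> I" for i using I(3)[OF that] edge_neq[of w i] by auto
  have ME: "?M \<subseteq> E" using J(2) by (auto simp: light_def)
  have sM: "?star \<inter> ?M = {}"
  proof -
    have "{w,i} \<noteq> {j, \<rho> j}" if "i \<in> I" "j \<in> J" for i j
      using iw(1)[of j] J that by (auto simp: doubleton_eq_iff)
    then show ?thesis by auto
  qed
  have D1: "D1 = D \<union> ?star" "D \<inter> ?star = {}" "D \<subseteq> D1"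
    using sM iw(2) by (auto simp: D_def D1_def)
  have sD: "simple_edges D" "simple_edges D1" using sub by (auto simp: D_def D1_def)
  have c1i: "c1 {w,i} = x i" if "i \<in> I" for i
  proof -
    have "(THE j. j \<in> I \<and> {w,i} = {w,j}) = i"
      using that by (intro the_equality) (auto simp: doubleton_eq_iff)
    then show ?thesis using that by (simp add: c1_def)
  qed
  have c1D: "c1 e = c e" if "e \<in> D" for e using D1(2) that by (auto simp: c1_def)
  have prpD: "proper_edge_colouring D k c" by (rule good_off_proper[OF c])
  have xI: "x i \<in> {1..k}" "\<And>f. f \<in> D \<Longrightarrow> w \<in> f \<Longrightarrow> x i \<noteq> c f" "\<And>f. f \<in> D \<Longrightarrow> i \<in> f \<Longrightarrow> x i \<noteq> c f" if "i \<in> I" for i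
    using x(2)[OF that] by (auto simp: incident_edges_def)
  have new: "c1 {w,i} \<noteq> c1 f" if h: "i \<in> I" "f \<in> D1" "f \<noteq> {w,i}" "v \<in> {w,i}" "v \<in> f" for i f v
  proof (cases "f \<in> D")
    case True
    then show ?thesis using xI(2,3)[OF h(1), of f] h(4,5) c1i[OF h(1)] c1D by auto
  next
    case False
    then obtain j where j: "j \<in> I" "f = {w,j}" using h(2) D1(1) by auto
    then have "x i \<noteq> x j" using h(1,3) inj_onD[OF x(1), of i j] by auto
    then show ?thesis using c1i h(1) j by auto
  qed
  have prp: "proper_edge_colouring D1 k c1"
    unfolding proper_edge_colouring_def
  proof (intro conjI ballI impI)
    have "c1 e \<in> {1..k}" if "e \<in> D1" for e
      using that D1(1) c1i c1D xI(1) proper_range[OF prpD] by fastforce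
    then show "c1 ` D1 \<subseteq> {1..k}" by auto
    fix e f assume ef: "e \<in> D1" "f \<in> D1" "e \<noteq> f" "e \<inter> f \<noteq> {}"
    then obtain v where v: "v \<in> e" "v \<in> f" by auto
    consider i where "i \<in> I" "e = {w,i}" | i where "i \<in> I" "f = {w,i}" | "e \<in> D" "f \<in> D"
      using ef(1,2) D1(1) by auto
    then show "c1 e \<noteq> c1 f"
    proof cases
      case 1 then show ?thesis using new[of i f v] ef v by auto
    next
      case 2
      then have "c1 f \<noteq> c1 e" using new[of i e v] ef v by auto
      then show ?thesis by simp
    next
      case 3 then show ?thesis using proper_neq[OF prpD 3 v ef(3)] c1D by simp
    qed
  qed
  have csD: "sum c1 (incident_edges D v) = csum D c v" for v
    unfolding csum_def using c1D by (intro sum.cong) (auto simp: incident_edges_def)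
  have fin: "finite (incident_edges D v)" for v by (rule finite_incident[OF sD(1)])
  have csw: "csum D1 c1 w = csum D c w + sum x I"
  proof -
    have "incident_edges D1 w = incident_edges D w \<union> ?star" using D1(1) by (auto simp: incident_edges_def)
    moreover have "incident_edges D w \<inter> ?star = {}" using D1(2) by (auto simp: incident_edges_def)
    ultimately have "csum D1 c1 w = sum c1 (incident_edges D w) + sum c1 ?star"
      unfolding csum_def using fin[of w] I(1) by (simp add: sum.union_disjoint)
    also have "sum c1 ?star = sum (\<lambda>i. c1 {w,i}) I"
      by (rule sum.reindex_cong[OF _ refl refl]) (auto simp: inj_on_def doubleton_eq_iff)
    also have "\<dots> = sum x I" using c1i by (rule sum.cong[OF refl])
    finally show ?thesis using csD by simp
  qed
  have csi: "csum D1 c1 i = csum D c i + x i" if "i \<in> I" for i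
  proof -
    have "incident_edges D1 i = insert {w,i} (incident_edges D i)"
      using D1(1) iw[OF that] that by (auto simp: incident_edges_def)
    moreover have "{w,i} \<notin> incident_edges D i" using D1(2) that by (auto simp: incident_edges_def)
    ultimately show ?thesis unfolding csum_def[of D1] using fin[of i] csD[of i] c1i[OF that] by simp
  qed
  have cso: "csum D1 c1 z = csum D c z" "deg D1 z = deg D z" if "z \<notin> I" "z \<noteq> w" for z
  proof -
    have "incident_edges D1 z = incident_edges D z" using D1(1) that by (auto simp: incident_edges_def)
    then show "csum D1 c1 z = csum D c z" "deg D1 z = deg D z"
      using csD[of z] by (simp_all add: csum_def graph_degree_def)
  qed
  have degE: "deg D1 z = deg E z" if "z \<notin> \<Union>?M" for z
    using that by (intro deg_cong) (auto simp: D1_def)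
  have wM: "w \<notin> \<Union>?M" using iw(1) J by auto
  have k2: "csum D1 c1 z * 2 \<le> 2 * (deg E z * k)" for z
  proof -
    have "deg D1 z * k \<le> deg E z * k" using deg_mono[OF E, of D1 z] by (simp add: D1_def)
    then show ?thesis using csum_le[OF prp, of z] by linarith
  qed
  have big: "csum D1 c1 i < csum D1 c1 z" if "deg E i \<le> 2" "k \<le> 2 * deg E z" "z \<notin> \<Union>?M" for i z
  proof -
    have "csum D1 c1 i \<le> 2 * k"
      using k2[of i] mult_le_mono1[OF that(1), of k] by linarith
    also have "\<dots> < csum D1 c1 z"
      by (rule csum_heavy[OF sD(2) prp k]) (use that(2) degE[OF that(3)] in simp)
    finally show ?thesis .
  qed
  have good: "good_off k D1 c1 (\<Union>?M)"
    unfolding good_off_def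
  proof (intro conjI allI impI prp)
    have main: "csum D1 c1 a \<noteq> csum D1 c1 b \<or> deg D1 a = 1 \<and> deg D1 b = 1"
      if ab: "{a,b} \<in> D1" "a \<notin> \<Union>?M" "b \<notin> \<Union>?M" "a = w \<or> a \<in> I \<and> b \<noteq> w" for a b
    proof (cases "a = w")
      case aw: True
      have bE: "{w,b} \<in> E" using ab(1) aw by (simp add: D1_def)
      show ?thesis
      proof (cases "b \<in> I")
        case True
        then have "b \<notin> J" using ab(3) by auto
        then show ?thesis using big[OF _ _ wM, of b] NJ[of b] True aw by auto
      next
        case False
        have bw: "b \<noteq> w" using edge_neq[OF bE] by auto
        have z: "b \<in> nb E w - I - \<rho> ` J" using bE ab(3) False by (auto simp: nb_def)
        show ?thesis
        proof (cases "deg E w * (deg E w + 1) \<le> 2 * (deg E b * k)")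
          case True
          then show ?thesis using x(4)[OF z] csw cso[OF False bw] aw by simp
        next
          case small: False
          have "deg E w * (deg E w + 1) \<le> 2 * csum D1 c1 w"
            using csum_ge[OF sD(2) prp, of w] degE[OF wM] by simp
          then show ?thesis using small k2[of b] aw by simp
        qed
      qed
    next
      case False
      then have aI: "a \<in> I" "b \<noteq> w" using ab(4) by auto
      then have "a \<notin> J" using ab(2) by auto
      moreover have "{a,b} \<in> E" using ab(1) by (simp add: D1_def)
      ultimately have "deg E a \<le> 2" "k \<le> 2 * deg E b" using NJ[of a] aI by auto
      then show ?thesis using big[OF _ _ ab(3), of a] by simp
    qed
    fix a b assume ab: "{a,b} \<in> D1" "a \<notin> \<Union>?M" "b \<notin> \<Union>?M"
    have ba: "{b,a} \<in> D1" using ab(1) by (simp add: insert_commute)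
    show "csum D1 c1 a \<noteq> csum D1 c1 b \<or> deg D1 a = 1 \<and> deg D1 b = 1"
    proof (cases "a = w \<or> b = w \<or> a \<in> I \<or> b \<in> I")
      case True
      then have "(a = w \<or> a \<in> I \<and> b \<noteq> w) \<or> (b = w \<or> b \<in> I \<and> a \<noteq> w)" by auto
      then show ?thesis using main[OF ab] main[OF ba ab(3,2)] by metis
    next
      case False
      then have "{a,b} \<in> D" using ab(1) D1(1) by (auto simp: doubleton_eq_iff)
      then show ?thesis using good_offD[OF c, of a b] cso False by simp
    qed
  qed
  have lightM: "light k E a b" if h: "{a,b} \<in> ?M" for a b
  proof -
    obtain i where "i \<in> J" "{a,b} = {i, \<rho> i}" using h by auto
    then show ?thesis using J(2)[of i] light_sym[of k E i "\<rho> i"] by (auto simp: doubleton_eq_iff)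
  qed
  have "\<exists>c. good_off k E c {}"
  proof (rule extend_light_matching[OF E ME lightM])
    show "good_off k (E - ?M) c1 (\<Union>?M)" using good by (simp add: D1_def)
    show "e \<inter> f = {}" if h: "e \<in> ?M" "f \<in> ?M" "e \<noteq> f" for e f
    proof (rule ccontr)
      assume "e \<inter> f \<noteq> {}"
      then obtain v where v: "v \<in> e" "v \<in> f" by auto
      obtain i j where ij: "i \<in> J" "j \<in> J" "e = {i, \<rho> i}" "f = {j, \<rho> j}" using h by auto
      obtain a b where ab: "e = {v,a}" "f = {v,b}" using v ij by (metis insert_commute insertE singletonD)
      then have "a = b" using light_unique[OF lightM lightM, of v a b] h by auto
      then show False using ab h by simp
    qed
    fix a b assume "{a,b} \<in> ?M"
    then obtain i where i: "i \<in> J" "{a,b} = {i, \<rho> i}" by auto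
    then have "csum D1 c1 i \<noteq> csum D1 c1 (\<rho> i)"
      using csi[of i] cso[of "\<rho> i"] J x(3)[OF i(1)] by (auto simp: add.commute)
    then show "diff_at (E - ?M) c1 a b"
      unfolding diff_at_def D1_def[symmetric] using i(2) by (auto simp: doubleton_eq_iff)
  qed auto
  then show False using none by blast
qed

end

section \<open>Recolouring a star from lists of free colours\<close>

definition forbidden :: "'a set set \<Rightarrow> ('a set \<Rightarrow> nat) \<Rightarrow> 'a set \<Rightarrow> ('a \<Rightarrow> 'a) \<Rightarrow> 'a \<Rightarrow> nat set" where
  "forbidden D c J \<rho> i = c ` incident_edges D i \<union> (if i \<in> J then {csum D c (\<rho> i) - csum D c i} else {})"

context minimal_counterexample
begin

definition star_rest :: "'a \<Rightarrow> 'a set \<Rightarrow> 'a set \<Rightarrow> ('a \<Rightarrow> 'a) \<Rightarrow> 'a set set" where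
  "star_rest w I J \<rho> = E - ((\<lambda>i. {w,i}) ` I \<union> (\<lambda>i. {i, \<rho> i}) ` J)"

definition star_ok :: "'a \<Rightarrow> 'a set \<Rightarrow> 'a set \<Rightarrow> ('a \<Rightarrow> 'a) \<Rightarrow> bool" where
  "star_ok w I J \<rho> \<longleftrightarrow> I \<noteq> {} \<and> (\<forall>i\<in>I. {w,i} \<in> E \<and> deg E i \<le> 3) \<and> J \<subseteq> I \<and>
     (\<forall>i\<in>J. light k E i (\<rho> i) \<and> \<rho> i \<noteq> w \<and> \<rho> i \<notin> I) \<and>
     (\<forall>i\<in>I - J. deg E i \<le> 2 \<and> k \<le> 2 * deg E w \<and> (\<forall>x. {i,x} \<in> E \<longrightarrow> x \<noteq> w \<longrightarrow> k \<le> 2 * deg E x))"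

text \<open>Deleting the light edge at a vertex of \<open>J\<close> removes one colour there and
  introduces one value to be avoided, namely the one equalising the sums with the partner. So the
  bound on forbidden values is the same inside and outside \<open>J\<close>.\<close>

lemma star_facts:
  assumes ok: "star_ok w I J \<rho>"
  defines "D \<equiv> star_rest w I J \<rho>"
  shows "finite I" "deg D w + card I \<le> deg E w" "D \<subset> E"
    and "i \<in> I \<Longrightarrow> finite (forbidden D c J \<rho> i) \<and> card (forbidden D c J \<rho> i) + 1 \<le> deg E i"
proof -
  have nbI: "I \<subseteq> nb E w" using ok by (auto simp: star_ok_def nb_def)
  then show fin: "finite I" using finite_nb[OF E] finite_subset by blast
  have inj: "inj_on (\<lambda>i. {w,i}) I" by (auto simp: inj_on_def doubleton_eq_iff)
  have star: "(\<lambda>i. {w,i}) ` I \<subseteq> incident_edges E w" using nbI by (auto simp: nb_def incident_edges_def)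
  have "incident_edges D w \<subseteq> incident_edges E w - (\<lambda>i. {w,i}) ` I"
    by (auto simp: D_def star_rest_def incident_edges_def)
  then have "deg D w \<le> card (incident_edges E w - (\<lambda>i. {w,i}) ` I)"
    unfolding graph_degree_def using finite_incident[OF E] by (intro card_mono) auto
  also have "\<dots> = deg E w - card I"
    unfolding graph_degree_def using star fin by (simp add: card_Diff_subset card_image[OF inj])
  finally have "deg D w \<le> deg E w - card I" .
  moreover have "card I \<le> deg E w"
    using card_mono[OF finite_nb[OF E] nbI] card_nb[OF E] by simp
  ultimately show "deg D w + card I \<le> deg E w" by simp
  obtain i0 where "i0 \<in> I" "{w,i0} \<in> E" using ok by (auto simp: star_ok_def)
  then have "{w,i0} \<in> E - D" by (auto simp: D_def star_rest_def)
  moreover have "D \<subseteq> E" by (auto simp: D_def star_rest_def)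
  ultimately show "D \<subset> E" by auto
  assume i: "i \<in> I"
  have iE: "{w,i} \<in> E" "i \<noteq> w" using ok i edge_neq[of w i] by (auto simp: star_ok_def)
  have sD: "simple_edges D" using \<open>D \<subset> E\<close> sub by auto
  have cD: "finite (c ` incident_edges D i)" "card (c ` incident_edges D i) \<le> deg D i"
    using finite_incident[OF sD] card_image_le by (auto simp: graph_degree_def)
  show "finite (forbidden D c J \<rho> i) \<and> card (forbidden D c J \<rho> i) + 1 \<le> deg E i"
  proof (cases "i \<in> J")
    case True
    then have r: "{i, \<rho> i} \<in> E" "\<rho> i \<noteq> w" using ok by (auto simp: star_ok_def light_def)
    have "{{w,i},{i,\<rho> i}} \<subseteq> incident_edges E i" using iE r by (auto simp: incident_edges_def)
    moreover have "incident_edges D i \<subseteq> incident_edges E i - {{w,i},{i,\<rho> i}}"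
      using i True by (auto simp: D_def star_rest_def incident_edges_def)
    then have "deg D i \<le> card (incident_edges E i - {{w,i},{i,\<rho> i}})"
      unfolding graph_degree_def using finite_incident[OF E] by (intro card_mono) auto
    moreover have "card {{w,i},{i,\<rho> i}} = 2" using r iE by (auto simp: doubleton_eq_iff)
    ultimately have "deg D i + 2 \<le> deg E i"
      using card_mono[OF finite_incident[OF E], of "{{w,i},{i,\<rho> i}}" i]
      by (simp add: card_Diff_subset graph_degree_def)
    moreover have "card (forbidden D c J \<rho> i) \<le> card (c ` incident_edges D i) + 1"
      using True cD(1) by (simp add: forbidden_def card_insert_if)
    ultimately show ?thesis using cD True by (simp add: forbidden_def)
  next
    case False
    have "incident_edges D i \<subseteq> incident_edges E i - {{w,i}}"
      using i by (auto simp: D_def star_rest_def incident_edges_def)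
    then have "deg D i \<le> card (incident_edges E i - {{w,i}})"
      unfolding graph_degree_def using finite_incident[OF E] by (intro card_mono) auto
    moreover have "{w,i} \<in> incident_edges E i" using iE by (auto simp: incident_edges_def)
    ultimately have "deg D i + 1 \<le> deg E i"
      using card_gt_0_iff[of "incident_edges E i"] finite_incident[OF E, of i]
      by (auto simp: card_Diff_singleton graph_degree_def)
    then show ?thesis using cD False by (simp add: forbidden_def)
  qed
qed

lemma star_choice_fails:
  assumes ok: "star_ok w I J \<rho>" and c: "good_off k (star_rest w I J \<rho>) c {}"
    and x: "inj_on x I" "\<And>i. i \<in> I \<Longrightarrow> x i \<in> {1..k} - c ` incident_edges (star_rest w I J \<rho>) w - forbidden (star_rest w I J \<rho>) c J \<rho> i"
      "\<And>z. z \<in> nb E w - I - \<rho> ` J \<Longrightarrow> deg E w * (deg E w + 1) \<le> 2 * (deg E z * k) \<Longrightarrow>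
         sum x I \<noteq> csum (star_rest w I J \<rho>) c z - csum (star_rest w I J \<rho>) c w"
  shows False
proof (rule recolour_star[of I w J \<rho> _ c x])
  show "star_rest w I J \<rho> = E - ((\<lambda>i. {w, i}) ` I \<union> (\<lambda>i. {i, \<rho> i}) ` J)" by (simp add: star_rest_def)
  show "finite I" by (rule star_facts[OF ok])
  show "x i + csum (star_rest w I J \<rho>) c i \<noteq> csum (star_rest w I J \<rho>) c (\<rho> i)" if "i \<in> J" for i
  proof -
    have "i \<in> I" using that ok by (auto simp: star_ok_def)
    then have "x i \<noteq> csum (star_rest w I J \<rho>) c (\<rho> i) - csum (star_rest w I J \<rho>) c i"
      using x(2)[of i] that by (simp add: forbidden_def)
    then show ?thesis by simp
  qed
  show "x i \<in> {1..k} - c ` incident_edges (star_rest w I J \<rho>) w - c ` incident_edges (star_rest w I J \<rho>) i" if "i \<in> I" for i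
    using x(2)[OF that] by (simp add: forbidden_def)
  show "csum (star_rest w I J \<rho>) c w + sum x I \<noteq> csum (star_rest w I J \<rho>) c z"
    if "z \<in> nb E w - I - \<rho> ` J" "deg E w * (deg E w + 1) \<le> 2 * (deg E z * k)" for z
    using x(3)[OF that] by auto
qed (use ok c x(1) in \<open>simp_all add: star_ok_def\<close>)

lemma star_free_colours:
  assumes ok: "star_ok w I J \<rho>"
  shows "k - deg E w + card I \<le> card ({1..k} - c ` incident_edges (star_rest w I J \<rho>) w)"
proof -
  let ?C = "c ` incident_edges (star_rest w I J \<rho>) w"
  have fin: "finite (incident_edges (star_rest w I J \<rho>) w)"
    using finite_incident[of "star_rest w I J \<rho>" w] sub star_facts(3)[OF ok] by blast
  have "card ?C \<le> deg (star_rest w I J \<rho>) w"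
    unfolding graph_degree_def by (rule card_image_le[OF fin])
  moreover have "k - card ?C \<le> card ({1..k} - ?C)"
    using diff_card_le_card_Diff[of ?C "{1..k}"] fin by simp
  ultimately show ?thesis using star_facts(2)[OF ok] deg_less[of w] by linarith
qed

text \<open>At \<open>w\<close> at least \<open>k - deg E w + card I\<close> colours are free, and
  at most \<open>a\<close> of them are forbidden at each \<open>i\<close>. The number of different
  sums then exceeds the number of neighbours whose sums are to be avoided.\<close>

lemma star_count:
  assumes ok: "star_ok w I J \<rho>" and a: "\<And>i. i \<in> I \<Longrightarrow> deg E i \<le> a + 1" "a \<le> k - deg E w"
    and few: "card (nb E w - I - \<rho> ` J) \<le> card I * (k - deg E w - a)"
  shows False
proof -
  let ?D = "star_rest w I J \<rho>"
  obtain c where c: "good_off k ?D c {}" using IH[OF star_facts(3)[OF ok]] by auto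
  let ?P = "{1..k} - c ` incident_edges ?D w"
  let ?Z = "(\<lambda>z. csum ?D c z - csum ?D c w) ` (nb E w - I - \<rho> ` J)"
  define n where "n = card I + (k - deg E w - a)"
  have L: "finite (?P - forbidden ?D c J \<rho> i) \<and> n \<le> card (?P - forbidden ?D c J \<rho> i)" if i: "i \<in> I" for i
  proof -
    have "card ?P - card (forbidden ?D c J \<rho> i) \<le> card (?P - forbidden ?D c J \<rho> i)"
      using star_facts(4)[OF ok i] by (intro diff_card_le_card_Diff) auto
    moreover have "card (forbidden ?D c J \<rho> i) \<le> a" using star_facts(4)[OF ok i, of c] a(1)[OF i] by simp
    ultimately have "n \<le> card (?P - forbidden ?D c J \<rho> i)"
      using star_free_colours[OF ok, of c] a(2) unfolding n_def by linarith
    then show ?thesis by simp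
  qed
  have In: "card I \<le> n" by (simp add: n_def)
  have finZ: "finite ?Z" using finite_nb[OF E] by auto
  have cZ: "card ?Z \<le> card I * (n - card I)"
    using few card_image_le[of "nb E w - I - \<rho> ` J" "\<lambda>z. csum ?D c z - csum ?D c w"] finite_nb[OF E]
    by (simp add: n_def)
  have "\<exists>x. inj_on x I \<and> (\<forall>i\<in>I. x i \<in> ?P - forbidden ?D c J \<rho> i) \<and> sum x I \<notin> ?Z"
    by (rule distinct_choice_avoiding[OF star_facts(1)[OF ok] In _ finZ cZ]) (rule L)
  then obtain x where x: "inj_on x I" "\<forall>i\<in>I. x i \<in> ?P - forbidden ?D c J \<rho> i" "sum x I \<notin> ?Z"
    by (elim exE conjE)
  show False
    by (rule star_choice_fails[OF ok c x(1)]) (use x(2,3) in auto)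
qed

text \<open>Each edge has at most one forbidden value, and at least \<open>card I + 1\<close>
  colours are free at \<open>w\<close>. Using all but one of \<open>card I + 1\<close> free colours
  gives \<open>card I + 1\<close> different sums, and one of them avoids every conflict. The colours
  can be distributed over the edges unless some value is forbidden everywhere.\<close>

lemma star_common_forbidden:
  assumes ok: "star_ok w I J \<rho>" and deg2: "\<And>i. i \<in> I \<Longrightarrow> deg E i \<le> 2"
    and few: "card {z \<in> nb E w - I - \<rho> ` J. deg E w * (deg E w + 1) \<le> 2 * (deg E z * k)} \<le> card I"
  obtains c \<gamma> where "good_off k (star_rest w I J \<rho>) c {}"
    "\<And>i. i \<in> I \<Longrightarrow> \<gamma> \<in> forbidden (star_rest w I J \<rho>) c J \<rho> i"
proof -
  let ?D = "star_rest w I J \<rho>"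
  obtain c where c: "good_off k ?D c {}" using IH[OF star_facts(3)[OF ok]] by auto
  let ?P = "{1..k} - c ` incident_edges ?D w"
  let ?N = "{z \<in> nb E w - I - \<rho> ` J. deg E w * (deg E w + 1) \<le> 2 * (deg E z * k)}"
  let ?Z = "(\<lambda>z. csum ?D c z - csum ?D c w) ` ?N"
  have "\<exists>\<gamma>. \<forall>i\<in>I. \<gamma> \<in> forbidden ?D c J \<rho> i"
  proof (rule ccontr)
    assume no: "\<not> ?thesis"
    have "card I + 1 \<le> card ?P" using star_free_colours[OF ok, of c] deg_less[of w] by simp
    then obtain P0 where P0: "P0 \<subseteq> ?P" "card P0 = card I + 1" "finite P0"
      by (meson obtain_subset_with_card_n)
    have finN: "finite ?N" using finite_nb[OF E] by auto
    have "card ?Z < card P0" using P0(2) few card_image_le[OF finN, of "\<lambda>z. csum ?D c z - csum ?D c w"] by simp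
    moreover have "inj_on (\<lambda>\<beta>. \<Sum>P0 - \<beta>) P0"
      using member_le_sum[of _ P0 "\<lambda>x. x"] P0(3) by (auto simp: inj_on_def) (metis diff_diff_cancel)
    then have "card ((\<lambda>\<beta>. \<Sum>P0 - \<beta>) ` P0) = card P0" by (rule card_image)
    ultimately have "\<not> (\<lambda>\<beta>. \<Sum>P0 - \<beta>) ` P0 \<subseteq> ?Z"
      using card_mono[of ?Z "(\<lambda>\<beta>. \<Sum>P0 - \<beta>) ` P0"] finN by auto
    then obtain \<beta> where \<beta>: "\<beta> \<in> P0" "\<Sum>P0 - \<beta> \<notin> ?Z" by auto
    have A: "\<exists>a. forbidden ?D c J \<rho> i \<subseteq> {a}" if "i \<in> I" for i
    proof -
      have "finite (forbidden ?D c J \<rho> i)" "card (forbidden ?D c J \<rho> i) \<le> 1"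
        using star_facts(4)[OF ok that, of c] deg2[OF that] by auto
      then show ?thesis by (metis card_le_Suc0_iff_eq One_nat_def insertI1 subsetI singleton_iff all_not_in_conv)
    qed
    obtain f where f: "bij_betw f I (P0 - {\<beta>})" "\<And>i. i \<in> I \<Longrightarrow> f i \<notin> forbidden ?D c J \<rho> i"
    proof (rule bijection_avoiding[OF star_facts(1)[OF ok], of "P0 - {\<beta>}" "forbidden ?D c J \<rho>"])
      show "card I = card (P0 - {\<beta>})" using P0 \<beta>(1) by simp
      show "\<exists>i\<in>I. a \<notin> forbidden ?D c J \<rho> i" for a using no by auto
    qed (use P0(3) A in auto)
    have "sum f I = \<Sum>(P0 - {\<beta>})" using f(1) sum.reindex_bij_betw[OF f(1), of "\<lambda>x. x"] by simp
    then have sum: "sum f I = \<Sum>P0 - \<beta>" using P0(3) \<beta>(1) by (simp add: sum_diff1_nat)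
    show False
    proof (rule star_choice_fails[OF ok c])
      show "inj_on f I" using f(1) by (simp add: bij_betw_def)
      show "f i \<in> ?P - forbidden ?D c J \<rho> i" if "i \<in> I" for i
        using f(2)[OF that] bij_betw_apply[OF f(1) that] P0(1) by blast
      show "sum f I \<noteq> csum ?D c z - csum ?D c w"
        if "z \<in> nb E w - I - \<rho> ` J" "deg E w * (deg E w + 1) \<le> 2 * (deg E z * k)" for z
        using \<beta>(2) that sum by auto
    qed
  qed
  then show ?thesis using that c by blast
qed

section \<open>Diamonds\<close>

definition diamond :: "'a \<Rightarrow> 'a \<Rightarrow> 'a \<Rightarrow> 'a \<Rightarrow> bool" where
  "diamond u v w x \<longleftrightarrow> {u,v} \<in> E \<and> {u,w} \<in> E \<and> {u,x} \<in> E \<and> {v,w} \<in> E \<and> {v,x} \<in> E \<and>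
     w \<noteq> x \<and> deg E u = 3 \<and> deg E v = 3"

lemma diamond_sym: "diamond u v w x \<Longrightarrow> diamond v u w x"
  by (simp add: diamond_def insert_commute)

lemma diamond_distinct: "diamond u v w x \<Longrightarrow> distinct [u,v,w,x]"
  using edge_neq unfolding diamond_def by (metis distinct_length_2_or_more distinct_singleton)

lemma diamond_light: "diamond u v w x \<Longrightarrow> light k E u v"
  using k by (simp add: diamond_def light_def)

lemma diamond_incident:
  assumes d: "diamond u v w x" and M: "{u,v} \<in> M" "{u,w} \<notin> M" "{u,x} \<notin> M"
  shows "incident_edges (E - M) u = {{u,w},{u,x}}"
proof -
  note dist = diamond_distinct[OF d]
  have "{{u,v},{u,w},{u,x}} \<subseteq> incident_edges E u" using d by (auto simp: diamond_def incident_edges_def)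
  moreover have "card {{u,v},{u,w},{u,x}} = 3" using dist by (auto simp: doubleton_eq_iff)
  ultimately have inc: "incident_edges E u = {{u,v},{u,w},{u,x}}"
    using card_subset_eq[OF finite_incident[OF E], of "{{u,v},{u,w},{u,x}}" u] d
    by (auto simp: diamond_def graph_degree_def)
  have "incident_edges (E - M) u = incident_edges E u - M" by (auto simp: incident_edges_def)
  then show ?thesis using inc M by auto
qed

lemma diamond_csum:
  assumes "diamond u v w x" "{u,v} \<in> M" "{u,w} \<notin> M" "{u,x} \<notin> M"
  shows "csum (E - M) c u = c {u,w} + c {u,x}"
  using diamond_incident[OF assms] diamond_distinct[OF assms(1)]
  by (simp add: csum_def doubleton_eq_iff)

lemma diamond_rest:
  assumes "diamond u v w x" "{u,v} \<in> M" "{u,w} \<notin> M" "{u,x} \<notin> M"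
  shows "incident_edges (E - M) u - {{u,w}} = {{u,x}}"
proof -
  have "{u,w} \<noteq> {u,x}" using diamond_distinct[OF assms(1)] by (simp add: doubleton_eq_iff)
  then show ?thesis unfolding diamond_incident[OF assms] by simp
qed

lemma diamond_sides:
  assumes "diamond u v w x"
  shows "{u,v} \<in> {{u,v}}" "{u,w} \<notin> {{u,v}}" "{u,x} \<notin> {{u,v}}"
    "{v,u} \<in> {{u,v}}" "{v,w} \<notin> {{u,v}}" "{v,x} \<notin> {{u,v}}"
  using diamond_distinct[OF assms] by (auto simp: doubleton_eq_iff)

text \<open>Exchanging the colours of \<open>uw\<close> and \<open>vw\<close> keeps the sum at \<open>w\<close>, so it must be blocked: the
  four-cycle through \<open>u, w, v, x\<close> is coloured alternately.\<close>

lemma diamond_pattern: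
  assumes d: "diamond u v w x" and c: "good_off k (E - {{u,v}}) c {}"
  shows "c {u,w} = c {v,x}" "c {u,x} = c {v,w}"
proof -
  let ?D = "E - {{u,v}}"
  note dist = diamond_distinct[OF d]
  have cu: "csum ?D c u = c {u,w} + c {u,x}"
    by (rule diamond_csum[OF d diamond_sides(1-3)[OF d]])
  have cv: "csum ?D c v = c {v,w} + c {v,x}"
    by (rule diamond_csum[OF diamond_sym[OF d] diamond_sides(4-6)[OF d]])
  have eq: "csum ?D c u = csum ?D c v"
    using light_stuck(1)[OF diamond_light[OF d] good_off_mono[OF c]] by simp
  have D: "simple_edges ?D" using sub by auto
  note prp = good_off_proper[OF c]
  have mem: "{u,w} \<in> ?D" "{v,w} \<in> ?D" using d dist by (auto simp: diamond_def doubleton_eq_iff)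
  have iu: "incident_edges ?D u - {{u,w}} = {{u,x}}"
    by (rule diamond_rest[OF d diamond_sides(1-3)[OF d]])
  have iv: "incident_edges ?D v - {{v,w}} = {{v,x}}"
    by (rule diamond_rest[OF diamond_sym[OF d] diamond_sides(4-6)[OF d]])
  show 1: "c {u,w} = c {v,x}"
  proof (rule ccontr)
    assume ne: "c {u,w} \<noteq> c {v,x}"
    then have ne': "c {v,w} \<noteq> c {u,x}" using cu cv eq by simp
    let ?c = "c({u,w} := c {v,w}, {v,w} := c {u,w})"
    have uv: "u \<noteq> v" using dist by simp
    have f1: "c {v,w} \<notin> c ` (incident_edges ?D u - {{u,w}})" using iu ne' by simp
    have f2: "c {u,w} \<notin> c ` (incident_edges ?D v - {{v,w}})" using iv ne by simp
    note sw = swap_colours[OF D prp mem uv f1 f2]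
    have "csum ?D ?c u = csum ?D ?c v"
      using light_stuck(1)[OF diamond_light[OF d]] sw(5)[OF c] by simp
    then have "c {u,w} = c {v,w}" using sw(3,4) eq by simp
    then show False using proper_neq[OF prp mem, of w] dist by (auto simp: doubleton_eq_iff)
  qed
  then show "c {u,x} = c {v,w}" using cu cv eq by simp
qed

text \<open>Exchanging the colours of \<open>uw\<close> and \<open>zw\<close> changes the sum at
  \<open>u\<close> but not at \<open>v\<close>, so the light edge \<open>uv\<close> can be added
  back. At \<open>z\<close> nothing goes wrong: its sum is at most \<open>2 * k\<close> and its
  neighbours have large degree.\<close>

lemma diamond_swap_heavy:
  assumes d: "diamond u v w x" and c: "good_off k (E - {{u,v}}) c {}"
    and z: "{z,w} \<in> E" "z \<notin> {u,v}" "deg E z \<le> 2" "k \<le> 2 * deg E w"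
    and heavy: "\<And>y. {z,y} \<in> E \<Longrightarrow> y \<noteq> w \<Longrightarrow> k \<le> 2 * deg E y \<and> c {z,y} \<noteq> c {u,w}"
  shows False
proof -
  let ?D = "E - {{u,v}}" and ?c = "c({u,w} := c {z,w}, {z,w} := c {u,w})"
  note dist = diamond_distinct[OF d]
  have D: "simple_edges ?D" using sub by auto
  note prp = good_off_proper[OF c]
  have zw: "z \<noteq> w" using edge_neq z by auto
  have mem: "{u,w} \<in> ?D" "{z,w} \<in> ?D" "{v,w} \<in> ?D"
    using d dist z by (auto simp: diamond_def doubleton_eq_iff)
  have iu: "incident_edges ?D u - {{u,w}} = {{u,x}}"
    by (rule diamond_rest[OF d diamond_sides(1-3)[OF d]])
  have "c {v,w} \<noteq> c {z,w}"
    using proper_neq[OF prp mem(3,2), of w] z(2) zw by (auto simp: doubleton_eq_iff)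
  then have f1: "c {z,w} \<notin> c ` (incident_edges ?D u - {{u,w}})"
    using iu diamond_pattern(2)[OF d c] by simp
  have f2: "c {u,w} \<notin> c ` (incident_edges ?D z - {{z,w}})"
  proof
    assume "c {u,w} \<in> c ` (incident_edges ?D z - {{z,w}})"
    then obtain f where f: "f \<in> E" "z \<in> f" "f \<noteq> {z,w}" "c {u,w} = c f" by (auto simp: incident_edges_def)
    obtain y where y: "f = {z,y}" using simple_edges_cases[OF E f(1)] f(2) by (metis insert_commute insertE singletonD)
    then show False using heavy[of y] f by auto
  qed
  have uz: "u \<noteq> z" using z(2) by auto
  note sw = swap_colours[OF D prp mem(1,2) uz f1 f2]
  have g: "good_off k ?D ?c {u,z}" using sw(5)[OF c] by simp
  have dgE: "deg ?D b = deg E b" if "b \<notin> {u,v}" for b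
    using that by (intro deg_cong) auto
  have "csum ?D ?c z \<le> deg ?D z * k" by (rule csum_le[OF good_off_proper[OF g]])
  also have "\<dots> \<le> 2 * k" using dgE[OF z(2)] z(3) by (intro mult_le_mono1) simp
  finally have small: "csum ?D ?c z \<le> 2 * k" .
  have big: "csum ?D ?c z < csum ?D ?c b" if b: "b \<notin> {u,v}" "k \<le> 2 * deg E b" for b
    using small csum_heavy[OF D good_off_proper[OF g] k, of b] dgE[OF b(1)] b(2) by simp
  have big': "csum ?D ?c z < csum ?D ?c b" if b: "{z,b} \<in> E" "b \<notin> {u,v}" for b
    using big[OF b(2)] heavy[OF b(1)] z(4) by blast
  have "good_off k ?D ?c {u,v}"
    unfolding good_off_def
  proof (intro conjI allI impI good_off_proper[OF g])
    fix a b assume ab: "{a,b} \<in> ?D" "a \<notin> {u,v}" "b \<notin> {u,v}"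
    then have "{a,b} \<in> E" "{b,a} \<in> E" by (auto simp: insert_commute)
    then show "csum ?D ?c a \<noteq> csum ?D ?c b \<or> deg ?D a = 1 \<and> deg ?D b = 1"
      using big'[of a] big'[of b] ab good_offD[OF g ab(1)] by (cases "a = z"; cases "b = z") auto
  qed
  then have "csum ?D ?c u = csum ?D ?c v" by (rule light_stuck(1)[OF diamond_light[OF d]])
  moreover have "csum ?D c u = csum ?D c v"
    using light_stuck(1)[OF diamond_light[OF d] good_off_mono[OF c]] by simp
  moreover have "csum ?D ?c v = csum ?D c v" using sw(2)[of v] z(2) dist by auto
  ultimately have "c {u,w} = c {z,w}" using sw(3) by simp
  then show False using proper_neq[OF prp mem(1,2), of w] uz by (auto simp: doubleton_eq_iff)
qed

text \<open>The same exchange with the light edge at \<open>z\<close> deleted as well; both light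
  edges are then added back together. This requires the sums at \<open>z\<close> and
  \<open>y\<close> to differ after the exchange, which is the last hypothesis.\<close>

lemma diamond_swap_light:
  assumes d: "diamond u v w x" and c: "good_off k (E - {{u,v}}) c {}"
    and z: "{z,w} \<in> E" "z \<notin> {u,v}" "light k E z y" "y \<noteq> w" "y \<notin> {u,v}"
    and D_def: "D = E - {{u,v},{z,y}}"
    and free: "c {u,w} \<notin> c ` (incident_edges D z - {{z,w}})"
    and diff: "csum D c z + c {u,w} \<noteq> csum D c y + c {z,w}"
  shows False
proof -
  let ?c = "c({u,w} := c {z,w}, {z,w} := c {u,w})" and ?M = "{{u,v},{z,y}}"
  note dist = diamond_distinct[OF d]
  have D: "simple_edges D" using sub by (auto simp: D_def)
  have zy: "{z,y} \<in> E" "z \<noteq> y" using z(3) edge_neq by (auto simp: light_def)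
  have zw: "z \<noteq> w" using edge_neq z by auto
  have uz: "u \<noteq> z" using z(2) by auto
  have uv: "{u,v} \<in> E" using d by (simp add: diamond_def)
  have gD: "good_off k D c {u,v,z,y}"
  proof -
    have "good_off k (E - {{u,v}} - {{z,y}}) c ({} \<union> \<Union>{{z,y}})"
      using zy z(2,5) by (intro good_off_restrict[OF c]) (auto simp: doubleton_eq_iff)
    moreover have "E - {{u,v}} - {{z,y}} = D" by (auto simp: D_def)
    ultimately show ?thesis by (auto intro: good_off_mono)
  qed
  note prp = good_off_proper[OF gD]
  have mem: "{u,w} \<in> D" "{z,w} \<in> D" "{v,w} \<in> D"
    using d dist z zw by (auto simp: D_def diamond_def doubleton_eq_iff)
  have iu: "incident_edges D u = {{u,w},{u,x}}" unfolding D_def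
    using dist z uz zy by (intro diamond_incident[OF d]) (auto simp: doubleton_eq_iff)
  have iv: "incident_edges D v = {{v,w},{v,x}}" unfolding D_def
    using dist z zy by (intro diamond_incident[OF diamond_sym[OF d]]) (auto simp: doubleton_eq_iff)
  have "c {v,w} \<noteq> c {z,w}"
    using proper_neq[OF prp mem(3,2), of w] z(2) zw by (auto simp: doubleton_eq_iff)
  then have f1: "c {z,w} \<notin> c ` (incident_edges D u - {{u,w}})"
    using iu diamond_pattern(2)[OF d c] dist by (auto simp: doubleton_eq_iff)
  note sw = swap_colours[OF D prp mem(1,2) uz f1 free]
  have g: "good_off k D ?c {u,v,z,y}"
    by (rule good_off_mono[OF sw(5)[OF gD]]) auto
  have "csum D c u = csum D c v"
    using iu iv dist diamond_pattern[OF d c] by (simp add: csum_def doubleton_eq_iff)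
  moreover have "csum D ?c v = csum D c v" using sw(2)[of v] z(2) dist by auto
  moreover have "c {u,w} \<noteq> c {z,w}"
    using proper_neq[OF prp mem(1,2), of w] uz by (auto simp: doubleton_eq_iff)
  ultimately have duv: "csum D ?c u \<noteq> csum D ?c v" using sw(3) by simp
  have dzy: "csum D ?c z \<noteq> csum D ?c y"
    using sw(4) sw(2)[of y] z(5) zy(2) diff by auto
  have "\<exists>c. good_off k E c {}"
  proof (rule extend_light_matching[OF E, of ?M])
    show "good_off k (E - ?M) ?c (\<Union>?M)" using g by (simp add: D_def insert_commute)
    show "diff_at (E - ?M) ?c a b" if "{a,b} \<in> ?M" for a b
      unfolding diff_at_def D_def[symmetric] using that duv dzy by (auto simp: doubleton_eq_iff)
    show "light k E a b" if "{a,b} \<in> ?M" for a b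
      using that z(3) diamond_light[OF d] light_sym[of k E u v] light_sym[of k E z y] by (auto simp: doubleton_eq_iff)
    show "e \<inter> f = {}" if "e \<in> ?M" "f \<in> ?M" "e \<noteq> f" for e f
      using that z(2,5) by auto
  qed (use uv zy in auto)
  then show False using none by blast
qed

text \<open>Either \<open>uw\<close> or \<open>vw\<close> can be exchanged with \<open>zw\<close>.
  Each exchange is blocked by at most one value, the colour of \<open>zy\<close> or the sum at
  \<open>y\<close> without \<open>zy\<close>, and the colours of \<open>uw\<close> and
  \<open>vw\<close> differ.\<close>

lemma diamond_no_small:
  assumes d: "diamond u v w x" and z: "{z,w} \<in> E" "z \<notin> {u,v}" "deg E z \<le> 2" "k \<le> 2 * deg E w"
  shows False
proof -
  note dist = diamond_distinct[OF d]
  have uv: "{u,v} \<in> E" using d by (simp add: diamond_def)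
  obtain c where c: "good_off k (E - {{u,v}}) c {}" using minus_good[of "{{u,v}}"] uv by auto
  then have c': "good_off k (E - {{v,u}}) c {}" by (simp add: insert_commute)
  note d' = diamond_sym[OF d]
  have z': "z \<notin> {v,u}" using z(2) by auto
  have mem: "{u,w} \<in> E - {{u,v}}" "{v,w} \<in> E - {{u,v}}"
    using d dist by (auto simp: diamond_def doubleton_eq_iff)
  have ne: "c {u,w} \<noteq> c {v,w}"
    using proper_neq[OF good_off_proper[OF c] mem, of w] dist by (auto simp: doubleton_eq_iff)
  show False
  proof (cases "\<exists>y. {z,y} \<in> E \<and> y \<noteq> w")
    case False
    then show ?thesis using diamond_swap_heavy[OF d c z] by blast
  next
    case True
    then obtain y where y: "{z,y} \<in> E" "y \<noteq> w" by auto
    have zw: "z \<noteq> w" "z \<noteq> y" using edge_neq z(1) y by auto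
    have inc: "incident_edges E z = {{z,w},{z,y}}"
    proof -
      have "{{z,w},{z,y}} \<subseteq> incident_edges E z" using z(1) y by (auto simp: incident_edges_def)
      moreover have "card {{z,w},{z,y}} = 2" using y by (auto simp: doubleton_eq_iff)
      ultimately show ?thesis
        using card_seteq[OF finite_incident[OF E], of "{{z,w},{z,y}}" z] z(3) by (auto simp: graph_degree_def)
    qed
    have only: "b = y" if "{z,b} \<in> E" "b \<noteq> w" for b
    proof -
      have "{z,b} \<in> incident_edges E z" using that by (simp add: incident_edges_def)
      then show ?thesis using inc that by (auto simp: doubleton_eq_iff)
    qed
    show ?thesis
    proof (cases "light k E z y")
      case False
      then have heavy: "k \<le> 2 * deg E y" using z(3) y by (simp add: light_def)
      show ?thesis
      proof (cases "c {z,y} = c {u,w}")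
        case True
        show ?thesis
          by (rule diamond_swap_heavy[OF d' c' z(1) z' z(3,4)]) (use only heavy True ne in auto)
      next
        case False
        show ?thesis
          by (rule diamond_swap_heavy[OF d c z]) (use only heavy False in auto)
      qed
    next
      case True
      have yz: "light k E y z" and uv: "light k E u v" and vu: "light k E v u"
        using True diamond_light[OF d] light_sym[of k E z y] light_sym[of k E u v] by simp_all
      have "y \<noteq> u" using light_unique[of u z v] yz uv z(2) by auto
      moreover have "y \<noteq> v" using light_unique[of v z u] yz vu z(2) by auto
      ultimately have yuv: "y \<notin> {u,v}" by simp
      let ?D = "E - {{u,v},{z,y}}"
      have "incident_edges ?D z = incident_edges E z - {{u,v},{z,y}}" by (auto simp: incident_edges_def)
      moreover have "{z,w} \<notin> {{u,v},{z,y}}" using y z(2) by (auto simp: doubleton_eq_iff)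
      ultimately have iz: "incident_edges ?D z = {{z,w}}" unfolding inc by (simp add: insert_Diff_if)
      then have cz: "csum ?D c z = c {z,w}" by (simp add: csum_def)
      show ?thesis
      proof (cases "c {u,w} = csum ?D c y")
        case True': True
        have "E - {{v,u},{z,y}} = ?D" by (simp add: insert_commute)
        then show ?thesis
          using diamond_swap_light[OF d' c' z(1) z' True y(2) _ refl] yuv iz cz True' ne by auto
      next
        case False
        then show ?thesis
          using diamond_swap_light[OF d c z(1,2) True y(2) yuv refl] iz cz by auto
      qed
    qed
  qed
qed

text \<open>Suppose all four exchanges between the diamonds at \<open>w\<close> are blocked. For
  \<open>u'\<close>, the different colours of \<open>uw\<close> and \<open>vw\<close> must be that
  of \<open>u'x'\<close> and its complement in the sum at \<open>v'\<close> without
  \<open>u'v'\<close>; thus they add up to this sum. Using \<open>v'\<close> instead, they add up to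
  the sum at \<open>u'\<close> without \<open>u'v'\<close>. But \<open>u'\<close> and
  \<open>v'\<close> have different sums.\<close>

lemma diamond_unique:
  assumes d: "diamond u v w x" and d2: "diamond u' v' w x'" and disj: "{u,v} \<inter> {u',v'} = {}"
  shows False
proof -
  have uv: "{u,v} \<in> E" using d by (simp add: diamond_def)
  obtain c where c: "good_off k (E - {{u,v}}) c {}" using minus_good[of "{{u,v}}"] uv by auto
  let ?D = "E - {{u,v},{u',v'}}"
  have ne: "u \<noteq> u'" "u \<noteq> v'" "v \<noteq> u'" "v \<noteq> v'" using disj by auto
  have step: False
    if d: "diamond s t w x" and d2: "diamond s' t' w x'" and c: "good_off k (E - {{s,t}}) c {}"
      and D: "E - {{s,t},{s',t'}} = ?D" and ne: "s' \<notin> {s,t}" "t' \<notin> {s,t}"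
      and "c {s,w} \<noteq> c {s',x'}" "c {s,w} + c {s',x'} \<noteq> c {t',w} + c {t',x'}"
    for s t s' t'
  proof -
    note dist = diamond_distinct[OF d2]
    have M: "{s',t'} \<in> {{s,t},{s',t'}}" "{s',w} \<notin> {{s,t},{s',t'}}" "{s',x'} \<notin> {{s,t},{s',t'}}"
        "{t',s'} \<in> {{s,t},{s',t'}}" "{t',w} \<notin> {{s,t},{s',t'}}" "{t',x'} \<notin> {{s,t},{s',t'}}"
      using dist ne by (auto simp: doubleton_eq_iff)
    have i1: "incident_edges (E - {{s,t},{s',t'}}) s' - {{s',w}} = {{s',x'}}"
      by (rule diamond_rest[OF d2 M(1-3)])
    have s1: "csum (E - {{s,t},{s',t'}}) c s' = c {s',w} + c {s',x'}"
      by (rule diamond_csum[OF d2 M(1-3)])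
    have s2: "csum (E - {{s,t},{s',t'}}) c t' = c {t',w} + c {t',x'}"
      by (rule diamond_csum[OF diamond_sym[OF d2] M(4-6)])
    have "{s',w} \<in> E" "t' \<noteq> w" using d2 dist by (auto simp: diamond_def)
    then show False
      by (rule diamond_swap_light[OF d c _ ne(1) diamond_light[OF d2] _ ne(2) refl])
        (use i1 s1 s2 that(7,8) in simp_all)
  qed
  have e': "E - {{v,u},{u',v'}} = ?D" "E - {{u,v},{v',u'}} = ?D" "E - {{v,u},{v',u'}} = ?D"
    by (auto simp: insert_commute)
  have c': "good_off k (E - {{v,u}}) c {}" using c by (simp add: insert_commute)
  note ds = diamond_sym[OF d] and d2s = diamond_sym[OF d2]
  have "c {u,w} = c {u',x'} \<or> c {u,w} + c {u',x'} = c {v',w} + c {v',x'}"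
    using step[OF d d2 c refl] ne by auto
  moreover have "c {v,w} = c {u',x'} \<or> c {v,w} + c {u',x'} = c {v',w} + c {v',x'}"
    using step[OF ds d2 c' e'(1)] ne by auto
  moreover have "c {u,w} = c {v',x'} \<or> c {u,w} + c {v',x'} = c {u',w} + c {u',x'}"
    using step[OF d d2s c e'(2)] ne by auto
  moreover have "c {v,w} = c {v',x'} \<or> c {v,w} + c {v',x'} = c {u',w} + c {u',x'}"
    using step[OF ds d2s c' e'(3)] ne by auto
  moreover have "c {u,w} \<noteq> c {v,w}"
  proof -
    have "{u,w} \<in> E - {{u,v}}" "{v,w} \<in> E - {{u,v}}"
      using d diamond_distinct[OF d] by (auto simp: diamond_def doubleton_eq_iff)
    from proper_neq[OF good_off_proper[OF c] this, of w] show ?thesis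
      using diamond_distinct[OF d] by (auto simp: doubleton_eq_iff)
  qed
  moreover have "c {u',w} + c {u',x'} \<noteq> c {v',w} + c {v',x'}"
  proof -
    note dist = diamond_distinct[OF d2]
    have i: "incident_edges (E - {{u,v}}) a = incident_edges E a" if "a \<notin> {u,v}" for a
      using that by (auto simp: incident_edges_def)
    have full: "csum (E - {{u,v}}) c a = c {a,b} + (c {a,w} + c {a,x'})" "deg (E - {{u,v}}) a = 3"
      if da: "diamond a b w x'" "a \<notin> {u,v}" for a b
    proof -
      show "deg (E - {{u,v}}) a = 3" using i[OF da(2)] da(1) by (simp add: diamond_def graph_degree_def)
      have mem: "{a,b} \<in> incident_edges E a" using da(1) by (auto simp: diamond_def incident_edges_def)
      have "incident_edges E a - {{a,b}} = incident_edges (E - {{a,b}}) a" by (auto simp: incident_edges_def)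
      then have "csum E c a = c {a,b} + csum (E - {{a,b}}) c a"
        unfolding csum_def using sum.remove[OF finite_incident[OF E] mem, of c] by simp
      moreover have "csum (E - {{a,b}}) c a = c {a,w} + c {a,x'}"
        using diamond_distinct[OF da(1)] by (intro diamond_csum[OF da(1)]) (auto simp: doubleton_eq_iff)
      ultimately show "csum (E - {{u,v}}) c a = c {a,b} + (c {a,w} + c {a,x'})"
        using i[OF da(2)] by (simp add: csum_def)
    qed
    have "{u',v'} \<in> E - {{u,v}}" using d2 ne by (auto simp: diamond_def doubleton_eq_iff)
    from good_offD[OF c this] full[OF d2] full[OF d2s] ne show ?thesis by (auto simp: insert_commute)
  qed
  ultimately show False by linarith
qed

end

section \<open>Bags of small vertices and the count of charges\<close>

context minimal_counterexample
begin

text \<open>The threshold is the largest degree for which \<open>k\<close> at least 29 makes all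
  edges between small vertices light.\<close>

definition Bg :: "'a set" where "Bg = {v. 9 \<le> deg E v}"
definition Sm :: "'a set" where "Sm = {v. 1 \<le> deg E v \<and> deg E v \<le> 8}"

text \<open>Bags are contracted in the counting argument. Adjacent small vertices of degree at least 4 stay
  separate, since each of them has three big neighbours.\<close>

definition bag :: "'a \<Rightarrow> 'a set" where
  "bag v = insert v {u\<in>Sm. {v,u} \<in> E \<and> (deg E u \<le> 3 \<or> deg E v \<le> 3)}"

definition ends :: "'a set \<Rightarrow> 'a set" where "ends Q = {b\<in>Bg. \<exists>v\<in>Q. {v,b} \<in> E}"

lemma nb_sym: "u \<in> nb E v \<longleftrightarrow> v \<in> nb E u"
  by (simp add: nb_def insert_commute)

lemma nb_Bg_or_Sm: "u \<in> nb E v \<Longrightarrow> u \<in> Bg \<or> u \<in> Sm"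
proof -
  assume "u \<in> nb E v"
  then have "nb E u \<noteq> {}" using nb_sym by blast
  then have "deg E u \<noteq> 0" using card_nb[OF E, of u] finite_nb[OF E, of u] by auto
  then show "u \<in> Bg \<or> u \<in> Sm" by (auto simp: Bg_def Sm_def)
qed

lemma Bg_Sm_disjoint: "Bg \<inter> Sm = {}" by (auto simp: Bg_def Sm_def)

lemma small_light: "u \<in> Sm \<Longrightarrow> v \<in> Sm \<Longrightarrow> {u,v} \<in> E \<Longrightarrow> light k E u v"
  using k by (auto simp: light_def Sm_def)

lemma small_unique:
  assumes "u \<in> Sm" "v \<in> Sm" "v' \<in> Sm" "{u,v} \<in> E" "{u,v'} \<in> E" shows "v = v'"
  using light_unique small_light assms by metis

lemma bag_cases:
  assumes v: "v \<in> Sm"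
  obtains (single) "bag v = {v}" "\<And>u. u \<in> Sm \<Longrightarrow> {v,u} \<in> E \<Longrightarrow> 4 \<le> deg E u \<and> 4 \<le> deg E v"
    | (pair) u where "u \<in> Sm" "{v,u} \<in> E" "bag v = {v,u}" "bag u = {v,u}" "deg E u \<le> 3 \<or> deg E v \<le> 3"
proof (cases "\<exists>u\<in>Sm. {v,u} \<in> E \<and> (deg E u \<le> 3 \<or> deg E v \<le> 3)")
  case True
  then obtain u where u: "u \<in> Sm" "{v,u} \<in> E" "deg E u \<le> 3 \<or> deg E v \<le> 3" by blast
  have "bag v = {v,u}" unfolding bag_def using u small_unique[OF v u(1) _ u(2)] by blast
  moreover have uv: "{u,v} \<in> E" using u(2) by (simp add: insert_commute)
  have "bag u = {u,v}" unfolding bag_def using u v uv small_unique[OF u(1) v _ uv] by blast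
  ultimately show ?thesis using pair[OF u(1,2)] u(3) by (simp add: insert_commute)
next
  case False
  then have "bag v = {v}" by (auto simp: bag_def)
  moreover have "4 \<le> deg E u \<and> 4 \<le> deg E v" if "u \<in> Sm" "{v,u} \<in> E" for u
  proof -
    have "\<not> (deg E u \<le> 3 \<or> deg E v \<le> 3)" using False that by blast
    then show ?thesis by linarith
  qed
  ultimately show ?thesis using single by blast
qed

lemma bag_self: "v \<in> bag v" by (simp add: bag_def)

lemma bag_sub: "v \<in> Sm \<Longrightarrow> bag v \<subseteq> Sm" by (auto simp: bag_def)

lemma bag_eq: "v \<in> Sm \<Longrightarrow> u \<in> bag v \<Longrightarrow> bag u = bag v"
  by (rule bag_cases[of v]) auto

lemma bag_disjoint: "X \<in> bag ` Sm \<Longrightarrow> Y \<in> bag ` Sm \<Longrightarrow> X \<noteq> Y \<Longrightarrow> X \<inter> Y = {}"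
  using bag_eq by blast

lemma finite_Bg: "finite Bg" and finite_Sm: "finite Sm"
proof -
  have "finite e" if "e \<in> E" for e using E that by (intro card_ge_0_finite) (simp add: simple_edges_def)
  then have fin: "finite (\<Union>E)" using E by (simp add: simple_edges_def)
  have "v \<in> \<Union>E" if "deg E v \<noteq> 0" for v
  proof (rule ccontr)
    assume "v \<notin> \<Union>E"
    then have "incident_edges E v = {}" by (auto simp: incident_edges_def)
    then show False using that by (simp add: graph_degree_def)
  qed
  then have "Bg \<subseteq> \<Union>E" "Sm \<subseteq> \<Union>E" unfolding Bg_def Sm_def by fastforce+
  then show "finite Bg" "finite Sm" using fin finite_subset by blast+
qed

lemma finite_ends: "finite (ends Q)" using finite_Bg by (simp add: ends_def)

lemma ends_insert: "ends (insert v Q) = (nb E v \<inter> Bg) \<union> ends Q" "ends {} = {}"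
  by (auto simp: ends_def nb_def)

lemma card_big_nb:
  assumes "v \<in> Sm"
  shows "u \<in> Sm \<Longrightarrow> {v,u} \<in> E \<Longrightarrow> card (nb E v \<inter> Bg) + 1 = deg E v"
    and "(\<And>u. u \<in> Sm \<Longrightarrow> {v,u} \<notin> E) \<Longrightarrow> nb E v \<subseteq> Bg"
    and "deg E v \<le> card (nb E v \<inter> Bg) + 1"
proof -
  show 1: "card (nb E v \<inter> Bg) + 1 = deg E v" if u: "u \<in> Sm" "{v,u} \<in> E" for u
  proof -
    have "z = u" if "z \<in> nb E v \<inter> Sm" for z
      using small_unique[OF assms u(1) _ u(2), of z] that by (simp add: nb_def)
    moreover have "u \<in> nb E v" using u(2) by (simp add: nb_def)
    ultimately have "nb E v = insert u (nb E v \<inter> Bg)" using nb_Bg_or_Sm by blast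
    moreover have "u \<notin> nb E v \<inter> Bg" using u(1) Bg_Sm_disjoint by blast
    then have "card (insert u (nb E v \<inter> Bg)) = card (nb E v \<inter> Bg) + 1"
      using finite_Bg by simp
    ultimately show ?thesis using card_nb[OF E, of v] by simp
  qed
  show 2: "nb E v \<subseteq> Bg" if "\<And>u. u \<in> Sm \<Longrightarrow> {v,u} \<notin> E"
    using that nb_Bg_or_Sm unfolding nb_def by blast
  show "deg E v \<le> card (nb E v \<inter> Bg) + 1"
  proof (cases "\<exists>u\<in>Sm. {v,u} \<in> E")
    case True then show ?thesis using 1 by force
  next
    case False
    then have "nb E v \<inter> Bg = nb E v" using 2 by blast
    then show ?thesis using card_nb[OF E, of v] by simp
  qed
qed

text \<open>Unmatched or uncontracted small vertices have at most 2 big ends only if they have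
  degree at most 2 and no small neighbour. In a contracted pair containing a vertex of degree 2, the
  big neighbourhoods are disjoint by the absence of pendant triangles, so both degrees are 2.
  Otherwise each member has at least two big neighbours, and these coincide.\<close>

lemma low_bag_cases:
  assumes v: "v \<in> Sm" "w \<in> Bg" "{v,w} \<in> E" and low: "card (ends (bag v)) \<le> 2"
  obtains (leaf) "deg E v \<le> 2" "nb E v \<subseteq> Bg" "bag v = {v}"
    | (path) u x where "u \<in> Sm" "{v,u} \<in> E" "bag v = {v,u}" "deg E v = 2" "deg E u = 2"
        "x \<in> Bg" "x \<noteq> w" "{u,x} \<in> E" "ends (bag v) = {w,x}"
    | (diam) u x where "diamond v u w x" "bag v = {v,u}" "ends (bag v) = {w,x}"
  using v(1)
proof (cases rule: bag_cases)
  case single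
  note 1 = this
  have e: "ends (bag v) = nb E v \<inter> Bg" unfolding 1 using ends_insert by auto
  have no: "{v,u} \<notin> E" if "u \<in> Sm" for u
    using 1(2)[OF that] card_big_nb(1)[OF v(1) that] e low by auto
  have "nb E v \<subseteq> Bg" using card_big_nb(2)[OF v(1)] no by blast
  moreover from this have "deg E v \<le> 2" using e low card_nb[OF E, of v] by (simp add: Int_absorb2)
  ultimately show ?thesis using leaf 1(1) by blast
next
  case (pair u)
  note 2 = this
  let ?v = "nb E v \<inter> Bg" and ?u = "nb E u \<inter> Bg"
  have uv: "{u,v} \<in> E" using 2(2) by (simp add: insert_commute)
  have lt: "light k E v u" "light k E u v" using small_light v(1) 2 uv by auto
  have e: "ends (bag v) = ?v \<union> ?u" unfolding 2 using ends_insert by auto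
  have cards: "card ?v + 1 = deg E v" "card ?u + 1 = deg E u"
    using card_big_nb(1)[OF v(1) 2(1,2)] card_big_nb(1)[OF 2(1) v(1) uv] by auto
  have d2: "2 \<le> deg E v" "2 \<le> deg E u" using light_deg_ge_2 lt by auto
  have fin: "finite ?v" "finite ?u" using finite_Bg by auto
  have w: "w \<in> ?v" using v by (simp add: nb_def)
  have dis: "?v \<inter> ?u = {}" if "deg E v = 2 \<or> deg E u = 2"
  proof -
    have False if "y \<in> ?v \<inter> ?u" for y
      using light_pendant_triangle[OF lt(1), of y] light_pendant_triangle[OF lt(2), of y] that
        \<open>deg E v = 2 \<or> deg E u = 2\<close> by (auto simp: nb_def)
    then show ?thesis by blast
  qed
  show ?thesis
  proof (cases "deg E v = 2 \<or> deg E u = 2")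
    case True
    then have "card (ends (bag v)) = card ?v + card ?u" unfolding e using dis fin by (simp add: card_Un_disjoint)
    then have dd: "deg E v = 2" "deg E u = 2" using low cards d2 by auto
    then have c1: "card ?v = 1" "card ?u = 1" using cards by auto
    then obtain x where x: "?u = {x}" by (metis card_1_singletonE)
    have vw: "?v = {w}" using c1(1) w by (metis card_1_singletonE singletonD)
    have "x \<in> Bg" "{u,x} \<in> E" "x \<noteq> w" using x dis[OF True] vw by (auto simp: nb_def)
    then show ?thesis using path[OF 2(1-3) dd] e x vw by auto
  next
    case False
    then have "3 \<le> deg E v" "3 \<le> deg E u" using d2 by auto
    then have c2: "2 \<le> card ?v" "2 \<le> card ?u" using cards by auto
    have fe: "finite (ends (bag v))" by (rule finite_ends)
    have ve: "?v = ends (bag v)" by (rule card_seteq[OF fe]) (use e low c2 in auto)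
    have ue: "?u = ends (bag v)" by (rule card_seteq[OF fe]) (use e low c2 in auto)
    have c: "card (ends (bag v)) = 2" using ve c2 low by simp
    then have dd: "deg E v = 3" "deg E u = 3" using ve ue cards by auto
    have "w \<in> ends (bag v)" using w ve by simp
    then have "card (ends (bag v) - {w}) = 1" using c by simp
    then obtain x where x: "ends (bag v) - {w} = {x}" by (metis card_1_singletonE)
    then have ex: "ends (bag v) = {w,x}" "w \<noteq> x" using \<open>w \<in> ends (bag v)\<close> by auto
    then have "x \<in> ?v" "x \<in> ?u" "w \<in> ?u" using ve ue by auto
    then have "diamond v u w x" using 2(2) v(3) dd ex(2) by (auto simp: diamond_def nb_def)
    then show ?thesis using diam 2(3) ex by blast
  qed
qed

section \<open>Contracted pairs with both vertices adjacent to \<open>w\<close>\<close>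

definition twins :: "'a \<Rightarrow> 'a set set" where
  "twins w = {Q \<in> bag ` Sm. 2 \<le> card (Q \<inter> nb E w)}"

lemma twins_pair:
  assumes "Q \<in> twins w"
  obtains i j where "Q = {i,j}" "i \<noteq> j" "light k E i j" "deg E i = 3" "{w,i} \<in> E" "{w,j} \<in> E"
proof -
  obtain v where v: "v \<in> Sm" "Q = bag v" "2 \<le> card (Q \<inter> nb E w)" using assms by (auto simp: twins_def)
  from v(1) show ?thesis
  proof (cases rule: bag_cases)
    case single
  note 1 = this
    then have "card (Q \<inter> nb E w) \<le> card {v}" using v(2) by (intro card_mono) auto
    then show ?thesis using v(3) by simp
  next
    case (pair u)
  note 2 = this
    have Q: "Q = {v,u}" using v(2) 2(3) by simp
    have uv: "{u,v} \<in> E" "u \<noteq> v" using 2(2) edge_neq by (auto simp: insert_commute)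
    have lt: "light k E v u" "light k E u v" using small_light v(1) 2 uv by auto
    have "Q \<inter> nb E w = Q"
      by (rule card_seteq) (use Q v(3) uv(2) in \<open>auto simp: card_insert_if\<close>)
    then have wE: "{w,v} \<in> E" "{w,u} \<in> E" using Q by (auto simp: nb_def)
    then have wE': "{v,w} \<in> E" "{u,w} \<in> E" by (auto simp: insert_commute)
    have "2 \<le> deg E v" "2 \<le> deg E u" using light_deg_ge_2 lt by auto
    moreover have "deg E v \<noteq> 2" "deg E u \<noteq> 2" using light_pendant_triangle lt wE' by metis+
    ultimately have "deg E v = 3 \<or> deg E u = 3" using 2(5) by auto
    then show ?thesis
      using that[of v u] that[of u v] Q uv(2) lt wE by (auto simp: insert_commute)
  qed
qed

lemma finite_twins: "finite (twins w)" using finite_Sm by (simp add: twins_def)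

text \<open>From each pair a vertex of degree 3 is taken; its edge to \<open>w\<close> and its light
  edge are deleted. Two values are forbidden there, one colour and one equalising value. The other
  members of the pairs are exempt, so with t pairs only deg w - 2 * t sums must be avoided. This is
  at most t * (k - deg w - 2) precisely when the claim fails.\<close>

lemma twins_count:
  assumes "0 < deg E w"
  shows "card (twins w) * (k - deg E w) < deg E w"
proof (rule ccontr)
  assume big: "\<not> ?thesis"
  then have ne: "twins w \<noteq> {}" using assms by auto
  have "\<forall>Q\<in>twins w. \<exists>i j. Q = {i,j} \<and> i \<noteq> j \<and> light k E i j \<and> deg E i = 3 \<and> {w,i} \<in> E \<and> {w,j} \<in> E"
    using twins_pair by metis
  then obtain f g where fg: "\<And>Q. Q \<in> twins w \<Longrightarrow> Q = {f Q, g Q} \<and> f Q \<noteq> g Q \<and> light k E (f Q) (g Q) \<and>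
      deg E (f Q) = 3 \<and> {w, f Q} \<in> E \<and> {w, g Q} \<in> E" by metis
  have disj: "Q \<inter> Q' = {}" if "Q \<in> twins w" "Q' \<in> twins w" "Q \<noteq> Q'" for Q Q'
    using that bag_disjoint by (auto simp: twins_def)
  have mem: "f Q \<in> Q" "g Q \<in> Q" if "Q \<in> twins w" for Q using fg[OF that] by auto
  define I where "I = f ` twins w"
  define \<rho> where "\<rho> i = g (bag i)" for i
  have bagf: "bag (f Q) = Q" if Q: "Q \<in> twins w" for Q
  proof -
    obtain v where "v \<in> Sm" "Q = bag v" using Q by (auto simp: twins_def)
    then show ?thesis using bag_eq[of v "f Q"] mem(1)[OF Q] by simp
  qed
  have \<rho>f: "\<rho> (f Q) = g Q" if "Q \<in> twins w" for Q using bagf[OF that] by (simp add: \<rho>_def)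
  have injf: "inj_on f (twins w)" by (rule inj_onI) (metis bagf)
  have injg: "inj_on g (twins w)" by (rule inj_onI) (metis disj mem(2) IntI empty_iff)
  have gI: "g Q \<notin> I" if Q: "Q \<in> twins w" for Q
  proof
    assume "g Q \<in> I"
    then obtain Q' where Q': "Q' \<in> twins w" "g Q = f Q'" by (auto simp: I_def)
    then have "Q = Q'" using disj[OF Q Q'(1)] mem(2)[OF Q] mem(1)[OF Q'(1)] by auto
    then show False using fg[OF Q] Q'(2) by auto
  qed
  have gw: "g Q \<noteq> w" if "Q \<in> twins w" for Q using fg[OF that] edge_neq[of w "g Q"] by auto
  have ok: "star_ok w I I \<rho>"
    unfolding star_ok_def using ne fg gI gw \<rho>f by (auto simp: I_def)
  have \<rho>I: "\<rho> ` I = g ` twins w" using \<rho>f by (force simp: I_def image_def)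
  have cI: "card I = card (twins w)" "card (\<rho> ` I) = card (twins w)"
    using injf injg \<rho>I by (auto simp: I_def card_image)
  have "I \<inter> \<rho> ` I = {}" using gI \<rho>I by auto
  then have "card (I \<union> \<rho> ` I) = 2 * card (twins w)"
    using cI finite_twins[of w] by (simp add: card_Un_disjoint I_def)
  moreover have sub: "I \<union> \<rho> ` I \<subseteq> nb E w" using fg \<rho>I by (auto simp: I_def nb_def)
  moreover have "nb E w - I - \<rho> ` I = nb E w - (I \<union> \<rho> ` I)" by auto
  ultimately have rest: "card (nb E w - I - \<rho> ` I) = deg E w - 2 * card (twins w)"
    and two: "2 * card (twins w) \<le> deg E w"
    using card_Diff_subset[of "I \<union> \<rho> ` I" "nb E w"] card_mono[OF finite_nb[OF E] sub] finite_twins[of w] card_nb[OF E, of w]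
    by (auto simp: I_def)
  have r: "2 \<le> k - deg E w"
  proof (rule ccontr)
    assume "\<not> ?thesis"
    then have "card (twins w) * (k - deg E w) \<le> card (twins w) * 1" by (intro mult_le_mono2) simp
    then show False using big two assms by linarith
  qed
  show False
  proof (rule star_count[OF ok _ r])
    show "deg E i \<le> 2 + 1" if "i \<in> I" for i using that fg by (auto simp: I_def)
    have "card (twins w) * (k - deg E w) = card (twins w) * (k - deg E w - 2) + 2 * card (twins w)"
      using r by (metis add_mult_distrib2 le_add_diff_inverse2 mult.commute)
    then show "card (nb E w - I - \<rho> ` I) \<le> card I * (k - deg E w - 2)" unfolding rest cI(1) using big by linarith
  qed
qed

section \<open>The kinds of neighbours of a big vertex\<close>

definition smalls :: "'a \<Rightarrow> 'a set" where "smalls w = nb E w \<inter> Sm"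
definition leaves :: "'a \<Rightarrow> 'a set" where
  "leaves w = {v\<in>smalls w. deg E v \<le> 2 \<and> card (ends (bag v)) \<le> 2}"
definition linked :: "'a \<Rightarrow> 'a set" where
  "linked w = {x\<in>Bg. x \<noteq> w \<and> ({w,x} \<in> E \<or> (\<exists>Q\<in>bag ` Sm. ends Q = {w,x}))}"
definition stars :: "'a \<Rightarrow> 'a set set" where
  "stars w = {Q\<in>bag ` Sm. 3 \<le> card (ends Q) \<and> w \<in> ends Q}"
definition dias :: "'a \<Rightarrow> 'a set set" where
  "dias w = {Q\<in>bag ` Sm. \<exists>u v x. diamond u v w x \<and> Q = {u,v} \<and> ends Q = {w,x}}"
definition Bl :: "'a set" where "Bl = {w\<in>Bg. 12 \<le> deg E w \<and> 2 \<le> card (smalls w)}"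

lemma finite_smalls: "finite (smalls w)" and finite_linked: "finite (linked w)"
  and finite_stars: "finite (stars w)" and finite_dias: "finite (dias w)"
  using finite_Sm finite_Bg by (auto simp: smalls_def linked_def stars_def dias_def)

text \<open>A light edge from \<open>w\<close> to one small neighbour would be incompatible with a
  second small neighbour by \<open>light_only\<close>.\<close>

lemma not_light_small:
  assumes "2 \<le> card (smalls w)" "v \<in> smalls w" shows "\<not> light k E w v" "\<not> light k E v w"
proof -
  have "\<not> smalls w \<subseteq> {v}" using assms(1) card_mono[of "{v}" "smalls w"] by auto
  then obtain y where y: "y \<in> smalls w" "y \<noteq> v" by auto
  show "\<not> light k E w v"
  proof
    assume l: "light k E w v"
    have "1 \<le> deg E v" "deg E y \<le> 8" using assms(2) y by (auto simp: smalls_def Sm_def)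
    \<comment> \<open>For k = 29 this is sharp: lightness leaves degree at most 15 for
      \<open>w\<close>, and 15 + 2 * 8 = 31.\<close>
    then have "deg E w + 2 * deg E y \<le> k + 2" using l k by (auto simp: light_def)
    then show False using light_only[OF l, of y] y by (auto simp: smalls_def nb_def)
  qed
  then show "\<not> light k E v w" by (simp add: light_sym)
qed

text \<open>Leaves with a light edge are put into \<open>J\<close>; all neighbours of the others
  have degree at least k / 2. Two leaves cannot be matched with each other, since with
  \<open>w\<close> they would form a pendant triangle.\<close>

lemma leaves_star_ok:
  assumes w: "2 \<le> card (smalls w)" and ne: "leaves w \<noteq> {}"
    and J: "J = {v\<in>leaves w. \<exists>y. light k E v y}" and \<rho>: "\<And>v. v \<in> J \<Longrightarrow> light k E v (\<rho> v)"
  shows "star_ok w (leaves w) J \<rho>"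
  unfolding star_ok_def
proof (intro conjI ballI ne)
  have lf: "{w,i} \<in> E" "{i,w} \<in> E" "deg E i \<le> 2" "\<not> light k E w i" "\<not> light k E i w" if "i \<in> leaves w" for i
    using that not_light_small[OF w, of i] by (auto simp: leaves_def smalls_def nb_def insert_commute)
  show "{w,i} \<in> E" "deg E i \<le> 3" if "i \<in> leaves w" for i using lf[OF that] by auto
  show "J \<subseteq> leaves w" using J by auto
  show "light k E i (\<rho> i)" if "i \<in> J" for i using \<rho>[OF that] .
  show "\<rho> i \<noteq> w" if "i \<in> J" for i using \<rho>[OF that] lf(5)[of i] that J by auto
  show "\<rho> i \<notin> leaves w" if i: "i \<in> J" for i
  proof
    assume r: "\<rho> i \<in> leaves w"
    have iL: "i \<in> leaves w" using i J by simp
    have "deg E i = 2" using light_deg_ge_2[OF \<rho>[OF i]] lf(3)[OF iL] by simp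
    then show False using light_pendant_triangle[OF \<rho>[OF i]] lf(2)[OF iL] lf(2)[OF r] by blast
  qed
  fix i assume "i \<in> leaves w - J"
  then have i: "i \<in> leaves w" "\<And>y. \<not> light k E i y" using J by auto
  show "deg E i \<le> 2" by (rule lf(3)[OF i(1)])
  show "k \<le> 2 * deg E w" using lf(1,3,4)[OF i(1)] by (auto simp: light_def)
  show "\<forall>x. {i,x} \<in> E \<longrightarrow> x \<noteq> w \<longrightarrow> k \<le> 2 * deg E x"
    using i(2) lf(3)[OF i(1)] by (fastforce simp: light_def)
qed

definition partner :: "'a \<Rightarrow> 'a" where "partner v = (SOME y. light k E v y)"

lemma light_partner: "v \<in> {v\<in>leaves w. \<exists>y. light k E v y} \<Longrightarrow> light k E v (partner v)"
  unfolding partner_def by (auto intro: someI)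

lemma leaves_sub: "leaves w \<subseteq> nb E w" by (auto simp: leaves_def smalls_def)

lemma finite_leaves: "finite (leaves w)"
  using leaves_sub finite_nb[OF E] finite_subset by blast

text \<open>The star count with one forbidden value per leaf: the at most deg w - t other
  neighbours, for t leaves, are no more than t * (k - deg w - 1) if the claim fails.\<close>

lemma leaves_count:
  assumes w: "2 \<le> card (smalls w)" and d: "0 < deg E w"
  shows "card (leaves w) * (k - deg E w) < deg E w"
proof (rule ccontr)
  assume big: "\<not> ?thesis"
  then have ne: "leaves w \<noteq> {}" using d by auto
  define J where "J = {v\<in>leaves w. \<exists>y. light k E v y}"
  define \<rho> where "\<rho> = partner"
  have J: "J = {v\<in>leaves w. \<exists>y. light k E v y}" "\<And>v. v \<in> J \<Longrightarrow> light k E v (\<rho> v)"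
    unfolding J_def \<rho>_def by (simp, rule light_partner)
  have r: "1 \<le> k - deg E w" using deg_less[of w] by simp
  show False
  proof (rule star_count[OF leaves_star_ok[OF w ne J] _ r])
    show "deg E i \<le> 1 + 1" if "i \<in> leaves w" for i using that by (simp add: leaves_def)
    have "card (nb E w - leaves w - \<rho> ` J) \<le> card (nb E w - leaves w)"
      using finite_nb[OF E] by (intro card_mono) auto
    also have "\<dots> = deg E w - card (leaves w)"
      using leaves_sub[of w] finite_leaves[of w] card_nb[OF E, of w] by (simp add: card_Diff_subset)
    finally have 1: "card (nb E w - leaves w - \<rho> ` J) \<le> deg E w - card (leaves w)" .
    have "card (leaves w) * (k - deg E w) = card (leaves w) * (k - deg E w - 1) + card (leaves w)"
      using r by (metis add_mult_distrib2 le_add_diff_inverse2 mult.commute mult_1)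
    then show "card (nb E w - leaves w - \<rho> ` J) \<le> card (leaves w) * (k - deg E w - 1)"
      using 1 big by linarith
  qed
qed

lemma nb_Bg_linked: "nb E w \<inter> Bg \<subseteq> linked w"
  using edge_neq by (auto simp: linked_def nb_def)

text \<open>Otherwise one colour would be forbidden for all leaf edges at \<open>w\<close>, and it would sit on edges
  (or be the prospective sum) at pairwise different vertices linked to \<open>w\<close>.\<close>

lemma leaves_le_linked:
  assumes w: "w \<in> Bg" "2 \<le> card (smalls w)" "4 * k < 5 * deg E w"
  shows "card (leaves w) \<le> card (linked w)"
proof (rule ccontr)
  assume big: "\<not> ?thesis"
  then have ne: "leaves w \<noteq> {}" by auto
  let ?I = "leaves w"
  define J where "J = {v\<in>leaves w. \<exists>y. light k E v y}"
  define \<rho> where "\<rho> = partner"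
  have J: "J = {v\<in>leaves w. \<exists>y. light k E v y}" "\<And>v. v \<in> J \<Longrightarrow> light k E v (\<rho> v)"
    unfolding J_def \<rho>_def by (simp, rule light_partner)
  note ok = leaves_star_ok[OF w(2) ne J]
  let ?D = "star_rest w ?I J \<rho>"
  \<comment> \<open>A neighbour of degree at most 8 has sum at most \<open>8 * k\<close>, which
    \<open>w\<close> exceeds since its degree is more than 4 * k / 5. Only big neighbours can
    conflict.\<close>
  have "{z \<in> nb E w - ?I - \<rho> ` J. deg E w * (deg E w + 1) \<le> 2 * (deg E z * k)} \<subseteq> nb E w \<inter> Bg"
  proof (intro subsetI IntI)
    fix z assume z: "z \<in> {z \<in> nb E w - ?I - \<rho> ` J. deg E w * (deg E w + 1) \<le> 2 * (deg E z * k)}"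
    then show "z \<in> nb E w" by simp
    show "z \<in> Bg"
    proof (rule ccontr)
      assume "z \<notin> Bg"
      then have "deg E z * k \<le> 8 * k" by (intro mult_le_mono1) (simp add: Bg_def)
      moreover have "(4 * k) * (4 * k) \<le> (5 * deg E w) * (5 * deg E w)" using w(3) by (intro mult_le_mono[OF less_imp_le less_imp_le])
      moreover have "(5 * deg E w) * (5 * deg E w) = 25 * (deg E w * deg E w)" "(4 * k) * (4 * k) = 16 * (k * k)" by algebra+
      moreover have "29 * k \<le> k * k" using k by (intro mult_le_mono1)
      moreover have "deg E w * deg E w + deg E w \<le> 2 * (deg E z * k)" using z by simp
      ultimately show False using k by linarith
    qed
  qed
  then have "card {z \<in> nb E w - ?I - \<rho> ` J. deg E w * (deg E w + 1) \<le> 2 * (deg E z * k)} \<le> card (linked w)"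
    using nb_Bg_linked[of w] finite_linked by (intro card_mono) auto
  then have few: "card {z \<in> nb E w - ?I - \<rho> ` J. deg E w * (deg E w + 1) \<le> 2 * (deg E z * k)} \<le> card ?I"
    using big by simp
  have deg2: "deg E i \<le> 2" if "i \<in> ?I" for i using that by (simp add: leaves_def)
  obtain c \<gamma> where c: "good_off k ?D c {}" and \<gamma>: "\<And>i. i \<in> ?I \<Longrightarrow> \<gamma> \<in> forbidden ?D c J \<rho> i"
    using star_common_forbidden[OF ok deg2 few] by metis
  have DE: "?D \<subseteq> E" by (auto simp: star_rest_def)
  have wD: "{i,w} \<notin> ?D" "{w,i} \<notin> ?D" if "i \<in> ?I" for i using that by (auto simp: star_rest_def insert_commute)
  \<comment> \<open>The vertex charged for a leaf \<open>i\<close>: its light partner if that is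
    big, and otherwise the far end of an edge of colour \<open>\<gamma>\<close> that starts at
    \<open>i\<close> or at its small partner. In the latter case \<open>\<gamma>\<close> is the
    equalising value, hence the colour of the only remaining edge at the partner.\<close>
  define W where "W i x \<longleftrightarrow> light k E i x \<or>
    (\<exists>y. {y,x} \<in> ?D \<and> c {y,x} = \<gamma> \<and> k \<le> 2 * deg E x \<and> (y = i \<or> i \<in> J \<and> y = \<rho> i))" for i x
  have "\<exists>x\<in>linked w. W i x" if i: "i \<in> ?I" for i
  proof -
    have iS: "i \<in> Sm" "{i,w} \<in> E" "card (ends (bag i)) \<le> 2"
      using i by (auto simp: leaves_def smalls_def nb_def insert_commute)
    from iS(1) w(1) iS(2,3) show ?thesis
    proof (cases rule: low_bag_cases)
      case leaf
      have e: "ends (bag i) = nb E i" unfolding leaf(3) using leaf(2) ends_insert by auto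
      have link: "x \<in> linked w" if x: "x \<in> nb E i" "x \<noteq> w" for x
      proof -
        have "{w,x} = ends (bag i)"
          by (rule card_seteq[OF finite_ends]) (use e x iS in \<open>auto simp: nb_def\<close>)
        then show ?thesis using x leaf(2) iS(1) by (auto simp: linked_def)
      qed
      show ?thesis
      proof (cases "i \<in> J")
        case True
        then have "light k E i (\<rho> i)" "\<rho> i \<noteq> w" using ok by (auto simp: star_ok_def)
        then show ?thesis using link[of "\<rho> i"] by (auto simp: W_def light_def nb_def)
      next
        case False
        then obtain f where f: "f \<in> ?D" "i \<in> f" "\<gamma> = c f"
          using \<gamma>[OF i] by (auto simp: forbidden_def incident_edges_def)
        have "f \<in> E" using f(1) DE by auto
        then obtain x where x: "f = {i,x}" using simple_edges_cases[OF E] f(2) by (metis insert_commute insertE singletonD)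
        have xE: "{i,x} \<in> E" "x \<noteq> w" using \<open>f \<in> E\<close> x wD[OF i] f(1) by auto
        have "\<not> light k E i x" using False J(1) i by auto
        then have "k \<le> 2 * deg E x" using xE leaf(1) by (simp add: light_def)
        then have "W i x" using f x by (auto simp: W_def)
        then show ?thesis using link[of x] xE by (auto simp: nb_def)
      qed
    next
      case (path u x)
      have lt: "light k E i u" by (rule small_light[OF iS(1) path(1,2)])
      then have iJ: "i \<in> J" using J(1) i by auto
      have \<rho>i: "\<rho> i = u" using light_unique[OF lt J(2)[OF iJ]] .
      have uw: "u \<noteq> w" using path(1) w(1) Bg_Sm_disjoint by blast
      have lu: "light k E u i" using lt by (simp add: light_sym)
      have xi: "x \<noteq> i" using path(6) iS(1) Bg_Sm_disjoint by blast
      have nl: "\<not> light k E u x" using light_unique[OF lu, of x] xi by auto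
      then have kx: "k \<le> 2 * deg E x" using path(5,8) by (simp add: light_def)
      have ie: "incident_edges E i = {{i,w},{i,u}}"
      proof -
        have "{{i,w},{i,u}} \<subseteq> incident_edges E i" using iS(2) path(2) by (auto simp: incident_edges_def)
        moreover have "card {{i,w},{i,u}} = 2" using uw by (auto simp: doubleton_eq_iff)
        ultimately show ?thesis
          using card_seteq[OF finite_incident[OF E], of "{{i,w},{i,u}}" i] path(4) by (auto simp: graph_degree_def)
      qed
      have ue: "incident_edges E u = {{u,i},{u,x}}"
      proof -
        have "{{u,i},{u,x}} \<subseteq> incident_edges E u" using path(2,8) by (auto simp: incident_edges_def insert_commute)
        moreover have "card {{u,i},{u,x}} = 2" using xi by (auto simp: doubleton_eq_iff)
        ultimately show ?thesis
          using card_seteq[OF finite_incident[OF E], of "{{u,i},{u,x}}" u] path(5) by (auto simp: graph_degree_def)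
      qed
      have iuD: "{i,u} \<notin> ?D" "{u,i} \<notin> ?D" using iJ \<rho>i by (auto simp: star_rest_def insert_commute)
      have "{u,x} \<noteq> {w,j}" for j using uw path(7) by (auto simp: doubleton_eq_iff)
      moreover have "{u,x} \<noteq> {j, \<rho> j}" if "j \<in> J" for j
        using J(2)[OF that] nl light_sym[of k E u x] by (auto simp: doubleton_eq_iff)
      ultimately have uxD: "{u,x} \<in> ?D" using path(8) by (auto simp: star_rest_def)
      have int: "incident_edges ?D v = incident_edges E v \<inter> ?D" for v using DE by (auto simp: incident_edges_def)
      have "incident_edges ?D i = {}" unfolding int ie using iuD wD[OF i] by (simp add: Int_insert_left)
      moreover have "incident_edges ?D u = {{u,x}}" unfolding int ue using iuD uxD by (simp add: Int_insert_left)
      ultimately have "c {u,x} = \<gamma>" using \<gamma>[OF i] iJ \<rho>i by (simp add: forbidden_def csum_def)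
      then have "W i x" unfolding W_def using uxD kx iJ \<rho>i by blast
      moreover have "x \<in> linked w" using path(6,7,9) iS(1) by (auto simp: linked_def)
      ultimately show ?thesis by blast
    next
      case (diam u x)
      then show ?thesis using deg2[OF i] by (simp add: diamond_def)
    qed
  qed
  then obtain e where e: "\<And>i. i \<in> ?I \<Longrightarrow> e i \<in> linked w \<and> W i (e i)" by metis
  \<comment> \<open>A charged vertex determines its leaf: light edges form a matching, and a vertex
    lies on at most one edge of colour \<open>\<gamma>\<close>. The two kinds of charge do not mix,
    because a light neighbour has degree less than k / 2.\<close>
  have sep: False if "light k E i x" "k \<le> 2 * deg E x" for i x
    using that light_deg_ge_2[OF that(1)] by (simp add: light_def)
  have "inj_on e ?I"
  proof (rule inj_onI)
    fix i i' assume ii: "i \<in> ?I" "i' \<in> ?I" "e i = e i'"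
    then have WW: "W i (e i)" "W i' (e i)" using e by metis+
    show "i = i'"
    proof (cases "light k E i (e i)")
      case True
      then have "light k E i' (e i)" using WW(2) sep[OF True] by (auto simp: W_def)
      then show ?thesis using True light_unique[of "e i" i i'] by (simp add: light_sym)
    next
      case False
      then obtain y where y: "{y,e i} \<in> ?D" "c {y,e i} = \<gamma>" "k \<le> 2 * deg E (e i)" "y = i \<or> i \<in> J \<and> y = \<rho> i"
        using WW(1) by (auto simp: W_def)
      have "\<not> light k E i' (e i)" using sep y(3) by blast
      then obtain y' where y': "{y',e i} \<in> ?D" "c {y',e i} = \<gamma>" "y' = i' \<or> i' \<in> J \<and> y' = \<rho> i'"
        using WW(2) by (auto simp: W_def)
      have "{y,e i} = {y',e i}"
        using proper_neq[OF good_off_proper[OF c] y(1) y'(1), of "e i"] y(2) y'(2) by auto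
      then have yy: "y = y'" by (auto simp: doubleton_eq_iff)
      have \<rho>I: "\<rho> j \<notin> ?I" if "j \<in> J" for j using ok that by (auto simp: star_ok_def)
      show ?thesis
      proof (cases "y = i")
        case True
        then show ?thesis using y'(3) yy \<rho>I[of i'] ii(1) by auto
      next
        case yi: False
        then have r: "i \<in> J" "y = \<rho> i" using y(4) by auto
        then have "y' \<noteq> i'" using yy \<rho>I[OF r(1)] ii(2) by auto
        then have r': "i' \<in> J" "y = \<rho> i'" using y'(3) yy by auto
        have "light k E y i" "light k E y i'" using J(2)[OF r(1)] J(2)[OF r'(1)] r(2) r'(2) by (simp_all add: light_sym)
        then show ?thesis using light_unique by metis
      qed
    qed
  qed
  then have "card ?I \<le> card (linked w)"
    using e finite_linked by (intro card_inj_on_le[of e]) auto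
  then show False using big by simp
qed

end

text \<open>Here \<open>d\<close> is the degree of \<open>w\<close>, \<open>r = k - d\<close>, and
  \<open>t\<close> and \<open>p\<close> count leaves and twins. If d is at most (m + 1) * r, both
  counts are at most m, and a lower bound for d in terms of m follows from d > m * r; m runs through
  0 to 3.\<close>

lemma twelve_arith:
  fixes d r t p k :: nat
  assumes "d + r = k" "29 \<le> k" "12 \<le> d" "d \<le> 4 * r" "t * r < d" "p * r < d"
  shows "12 + t + 2 * p \<le> d"
proof -
  have le: "s \<le> m" if "s * r < d" "d \<le> (m + 1) * r" for s m
  proof (rule ccontr)
    assume "\<not> s \<le> m"
    then have "(m + 1) * r \<le> s * r" by (intro mult_le_mono1) simp
    then show False using that by simp
  qed
  consider "d \<le> r" | "r < d" "d \<le> 2 * r" | "2 * r < d" "d \<le> 3 * r" | "3 * r < d" using assms(4) by linarith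
  then show ?thesis
  proof cases
    case 1
    then show ?thesis using le[of t 0] le[of p 0] assms by simp
  next
    case 2
    then show ?thesis using le[of t 1] le[of p 1] assms by simp
  next
    case 3
    then show ?thesis using le[of t 2] le[of p 2] assms by simp
  next
    case 4
    then show ?thesis using le[of t 3] le[of p 3] assms by simp
  qed
qed

section \<open>Lower bounds for the charge of a big vertex\<close>

context minimal_counterexample
begin

lemma bag_card: "v \<in> Sm \<Longrightarrow> card (bag v) \<le> 2"
  by (rule bag_cases[of v]) (auto simp: card_insert_if)

lemma nb_cover:
  assumes w: "w \<in> Bg"
  shows "nb E w \<subseteq> (nb E w \<inter> Bg) \<union> leaves w \<union> (\<Union>Q\<in>stars w. Q \<inter> nb E w) \<union> (\<Union>Q\<in>dias w. Q \<inter> nb E w)"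
proof
  fix z assume z: "z \<in> nb E w"
  show "z \<in> (nb E w \<inter> Bg) \<union> leaves w \<union> (\<Union>Q\<in>stars w. Q \<inter> nb E w) \<union> (\<Union>Q\<in>dias w. Q \<inter> nb E w)"
  proof (cases "z \<in> Bg")
    case False
    then have zS: "z \<in> Sm" "{z,w} \<in> E" using z nb_Bg_or_Sm[OF z] by (auto simp: nb_def insert_commute)
    have zs: "z \<in> smalls w" using z zS by (simp add: smalls_def)
    show ?thesis
    proof (cases "3 \<le> card (ends (bag z))")
      case True
      have "w \<in> ends (bag z)" using w zS bag_self by (auto simp: ends_def)
      then have "bag z \<in> stars w" using True zS by (simp add: stars_def)
      then show ?thesis using bag_self z by blast
    next
      case False
      then have low: "card (ends (bag z)) \<le> 2" by simp
      from zS(1) w zS(2) low show ?thesis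
      proof (cases rule: low_bag_cases)
        case leaf then show ?thesis using zs low by (simp add: leaves_def)
      next
        case path then show ?thesis using zs low by (simp add: leaves_def)
      next
        case (diam u x)
        then have "bag z \<in> dias w" using zS(1) unfolding dias_def by blast
        then show ?thesis using bag_self z by blast
      qed
    qed
  qed (use z in simp)
qed

lemma dias_facts:
  assumes "Q \<in> dias w" shows "Q \<in> twins w" "card (ends Q) \<le> 2" "\<exists>x. x \<in> linked w"
proof -
  obtain u v x where Q: "Q \<in> bag ` Sm" "diamond u v w x" "Q = {u,v}" "ends Q = {w,x}"
    using assms unfolding dias_def by blast
  have "Q \<inter> nb E w = {u,v}" using Q(2,3) by (auto simp: diamond_def nb_def insert_commute)
  then show "Q \<in> twins w" using Q(1) diamond_distinct[OF Q(2)] by (simp add: twins_def)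
  show "card (ends Q) \<le> 2" using Q(4) by (simp add: card_insert_if)
  have "x \<in> ends Q" "x \<noteq> w" using Q(4) diamond_distinct[OF Q(2)] by auto
  then show "\<exists>x. x \<in> linked w" using Q(1,4) unfolding linked_def ends_def by blast
qed

text \<open>In the first bound a star bag counts 1, and once more if it is a twin; a diamond counts
  2. Diamonds and star bags that are twins are disjoint subsets of the twins, so together they
  exceed the number of stars by at most twice the number of twins.\<close>

lemma degree_count:
  assumes w: "w \<in> Bg"
  shows "deg E w \<le> card (linked w) + card (leaves w) + card (stars w) + 2 * card (twins w)"
    and "deg E w \<le> card (nb E w \<inter> Bg) + card (leaves w) + 2 * card (stars w) + 2 * card (dias w)"
proof -
  let ?f = "\<lambda>Q. Q \<inter> nb E w"
  have two: "card (?f Q) \<le> 2" if "Q \<in> bag ` Sm" for Q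
  proof -
    have "Q \<subseteq> Sm" "card Q \<le> 2" using that bag_card bag_sub by auto
    moreover from this have "finite Q" using finite_Sm finite_subset by blast
    ultimately show ?thesis using card_mono[of Q "?f Q"] by simp
  qed
  have "deg E w \<le> card ((nb E w \<inter> Bg) \<union> leaves w \<union> (\<Union>Q\<in>stars w. ?f Q) \<union> (\<Union>Q\<in>dias w. ?f Q))"
    unfolding card_nb[OF E, symmetric]
    using nb_cover[OF w] finite_nb[OF E] finite_leaves finite_stars finite_dias by (intro card_mono) auto
  also have "\<dots> \<le> card (nb E w \<inter> Bg) + card (leaves w) + card (\<Union>Q\<in>stars w. ?f Q) + card (\<Union>Q\<in>dias w. ?f Q)"
    by (intro order.trans[OF card_Un_le] add_mono order.refl)
  finally have 1: "deg E w \<le> card (nb E w \<inter> Bg) + card (leaves w) + card (\<Union>Q\<in>stars w. ?f Q) + card (\<Union>Q\<in>dias w. ?f Q)" .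
  have u: "card (\<Union>Q\<in>stars w. ?f Q) \<le> (\<Sum>Q\<in>stars w. card (?f Q))" "card (\<Union>Q\<in>dias w. ?f Q) \<le> (\<Sum>Q\<in>dias w. card (?f Q))"
    by (rule card_UN_le[OF finite_stars], rule card_UN_le[OF finite_dias])
  have sd: "(\<Sum>Q\<in>dias w. card (?f Q)) \<le> (\<Sum>Q\<in>dias w. 2)" using two by (intro sum_mono) (auto simp: dias_def)
  have ss: "(\<Sum>Q\<in>stars w. card (?f Q)) \<le> (\<Sum>Q\<in>stars w. 2)" using two by (intro sum_mono) (auto simp: stars_def)
  show "deg E w \<le> card (nb E w \<inter> Bg) + card (leaves w) + 2 * card (stars w) + 2 * card (dias w)"
    using 1 u sd ss by simp
  have "(\<Sum>Q\<in>stars w. card (?f Q)) \<le> (\<Sum>Q\<in>stars w. 1 + (if Q \<in> twins w then 1 else 0))"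
  proof (rule sum_mono)
    fix Q assume Q: "Q \<in> stars w"
    then have "Q \<in> bag ` Sm" by (simp add: stars_def)
    then show "card (?f Q) \<le> 1 + (if Q \<in> twins w then 1 else 0)" using two[of Q] by (auto simp: twins_def)
  qed
  also have "\<dots> = card (stars w) + card (stars w \<inter> twins w)"
    unfolding sum.distrib using finite_stars by (simp add: sum.If_cases)
  finally have s2: "(\<Sum>Q\<in>stars w. card (?f Q)) \<le> card (stars w) + card (stars w \<inter> twins w)" .
  have "(stars w \<inter> twins w) \<inter> dias w = {}" using dias_facts(2) by (fastforce simp: stars_def)
  then have "card ((stars w \<inter> twins w) \<union> dias w) = card (stars w \<inter> twins w) + card (dias w)"
    using finite_stars finite_dias by (intro card_Un_disjoint) auto
  moreover have "card ((stars w \<inter> twins w) \<union> dias w) \<le> card (twins w)"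
    using dias_facts(1) finite_twins by (intro card_mono) auto
  moreover have "card (dias w) \<le> card (twins w)" using dias_facts(1) finite_twins by (intro card_mono) auto
  moreover have "card (nb E w \<inter> Bg) \<le> card (linked w)" by (rule card_mono[OF finite_linked nb_Bg_linked])
  ultimately show "deg E w \<le> card (linked w) + card (leaves w) + card (stars w) + 2 * card (twins w)"
    using 1 u sd s2 by simp
qed

lemma dias_restrict:
  assumes Q: "Q \<in> dias w" and w: "k \<le> 2 * deg E w"
  shows "leaves w = {}" "card (dias w) = 1"
proof -
  obtain u v x where d: "diamond u v w x" "Q = {u,v}" using Q unfolding dias_def by blast
  have "z \<notin> leaves w" for z
  proof
    assume "z \<in> leaves w"
    then have z: "{z,w} \<in> E" "deg E z \<le> 2" by (auto simp: leaves_def smalls_def nb_def insert_commute)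
    moreover have "z \<notin> {u,v}" using d(1) z(2) by (auto simp: diamond_def)
    ultimately show False using diamond_no_small[OF d(1) _ _ _ w] by blast
  qed
  then show "leaves w = {}" by blast
  have "Q' = Q" if Q': "Q' \<in> dias w" for Q'
  proof (rule ccontr)
    assume "Q' \<noteq> Q"
    then have dis: "Q \<inter> Q' = {}" using Q Q' bag_disjoint[of Q Q'] by (simp add: dias_def)
    obtain u' v' x' where "diamond u' v' w x'" "Q' = {u',v'}" using Q' unfolding dias_def by blast
    then show False using diamond_unique[OF d(1)] dis d(2) by blast
  qed
  then have "dias w = {Q}" using Q by blast
  then show "card (dias w) = 1" by simp
qed

text \<open>While the degree is at most 4 * (k - deg w), leaves and twins are few and the first
  degree count suffices. Beyond that the degree is at least 24, and the second count meets each
  linked vertex and each star at most twice, apart from diamonds.\<close>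

lemma Bl_charge:
  assumes "w \<in> Bl" shows "12 \<le> card (linked w) + card (stars w)"
proof -
  have w: "w \<in> Bg" "12 \<le> deg E w" "2 \<le> card (smalls w)" using assms by (auto simp: Bl_def)
  let ?r = "k - deg E w"
  have r: "deg E w + ?r = k" using deg_less[of w] by simp
  show ?thesis
  proof (cases "deg E w \<le> 4 * ?r")
    case True
    have "12 + card (leaves w) + 2 * card (twins w) \<le> deg E w"
      using w(2) leaves_count[OF w(3)] twins_count[of w] by (intro twelve_arith[OF r k w(2) True]) auto
    then show ?thesis using degree_count(1)[OF w(1)] by linarith
  next
    case False
    then have big: "4 * k < 5 * deg E w" using r by linarith
    then have d24: "24 \<le> deg E w" "k \<le> 2 * deg E w" using k by auto
    have lf: "card (leaves w) \<le> card (linked w)" by (rule leaves_le_linked[OF w(1,3) big])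
    have h: "card (nb E w \<inter> Bg) \<le> card (linked w)" by (rule card_mono[OF finite_linked nb_Bg_linked])
    note dc = degree_count(2)[OF w(1)]
    show ?thesis
    proof (cases "dias w = {}")
      case True
      then show ?thesis using dc lf h d24 by simp
    next
      case False
      then obtain Q where Q: "Q \<in> dias w" by auto
      \<comment> \<open>With a diamond there are no leaves, so linked vertices count only once. The
        diamond costs 2, leaving at least 22; the single linked vertex guaranteed here lifts twice
        the charge above 22, hence the charge to 12.\<close>
      have "card (linked w) \<noteq> 0" using dias_facts(3)[OF Q] finite_linked[of w] by auto
      then show ?thesis using dc dias_restrict[OF Q d24(2)] h d24 by simp
    qed
  qed
qed

lemma star_small:
  assumes "Q \<in> stars w" obtains v where "v \<in> smalls w" "bag v = Q"
proof -
  obtain v0 v where "v0 \<in> Sm" "Q = bag v0" "v \<in> Q" "{v,w} \<in> E"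
    using assms by (auto simp: stars_def ends_def)
  then show ?thesis using that[of v] bag_eq[of v0 v] bag_sub[of v0]
    by (auto simp: smalls_def nb_def insert_commute)
qed

text \<open>With two small neighbours the degree is at most 11. As edges to small neighbours are not
  light, these have degree at least 6, hence at least five big neighbours, and lie in different bags
  because contracted pairs have a vertex of degree at most 3.\<close>

lemma Bm_charge:
  assumes w: "w \<in> Bg - Bl"
  shows "8 \<le> card (linked w) \<and> card (stars w) \<le> 1 \<or>
    18 \<le> 3 * card (linked w) + 2 * card (stars w) \<and> (\<forall>Q\<in>stars w. 5 \<le> card (ends Q))"
proof -
  have d9: "9 \<le> deg E w" using w by (simp add: Bg_def)
  have split: "deg E w = card (nb E w \<inter> Bg) + card (smalls w)"
  proof -
    have "nb E w = (nb E w \<inter> Bg) \<union> smalls w" using nb_Bg_or_Sm by (auto simp: smalls_def)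
    moreover have "(nb E w \<inter> Bg) \<inter> smalls w = {}" using Bg_Sm_disjoint by (auto simp: smalls_def)
    ultimately show ?thesis
      using card_Un_disjoint[of "nb E w \<inter> Bg" "smalls w"] finite_Bg finite_smalls[of w] card_nb[OF E, of w] by simp
  qed
  have h: "card (nb E w \<inter> Bg) \<le> card (linked w)" by (rule card_mono[OF finite_linked nb_Bg_linked])
  have st: "stars w \<subseteq> bag ` smalls w" using star_small by blast
  show ?thesis
  proof (cases "2 \<le> card (smalls w)")
    case False
    have "card (stars w) \<le> card (bag ` smalls w)" using st finite_smalls by (intro card_mono) auto
    also have "\<dots> \<le> card (smalls w)" by (rule card_image_le[OF finite_smalls])
    finally show ?thesis using False split h d9 by auto
  next
    case True
    then have d11: "deg E w \<le> 11" using w by (auto simp: Bl_def)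
    have deg6: "6 \<le> deg E v" "v \<in> Sm" if "v \<in> smalls w" for v
      using not_light_small(1)[OF True that] that d11 k by (auto simp: light_def smalls_def nb_def)
    have big: "5 \<le> card (ends (bag v))" if "v \<in> smalls w" for v
    proof -
      have "nb E v \<inter> Bg \<subseteq> ends (bag v)" using bag_self by (auto simp: ends_def nb_def)
      then have "card (nb E v \<inter> Bg) \<le> card (ends (bag v))" by (rule card_mono[OF finite_ends])
      then show ?thesis using card_big_nb(3)[OF deg6(2)[OF that]] deg6(1)[OF that] by simp
    qed
    have "inj_on bag (smalls w)"
    proof (rule inj_onI)
      fix u v assume uv: "u \<in> smalls w" "v \<in> smalls w" "bag u = bag v"
      show "u = v"
        using deg6(2)[OF uv(1)]
      proof (cases rule: bag_cases)
        case single
        then show ?thesis using uv(3) bag_self[of v] by auto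
      next
        case (pair y)
        then have "y \<noteq> v" using deg6[OF uv(1)] deg6[OF uv(2)] by auto
        then show ?thesis using pair(3) uv(3) bag_self[of v] by auto
      qed
    qed
    then have c: "card (bag ` smalls w) = card (smalls w)" by (rule card_image)
    have "bag v \<in> stars w" if "v \<in> smalls w" for v
    proof -
      have "w \<in> ends (bag v)" using that w bag_self[of v] by (auto simp: ends_def smalls_def nb_def insert_commute)
      then show ?thesis using big[OF that] deg6(2)[OF that] by (simp add: stars_def)
    qed
    then have "stars w = bag ` smalls w" using st by blast
    then show ?thesis using big c split h d9 by auto
  qed
qed

section \<open>The global count\<close>

definition star_bags :: "'a set set" where "star_bags = {Q\<in>bag ` Sm. 3 \<le> card (ends Q)}"

lemma sum_stars:
  fixes f :: "'a set \<Rightarrow> int"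
  assumes "finite A"
  shows "(\<Sum>w\<in>A. \<Sum>Q\<in>stars w. f Q) = (\<Sum>Q\<in>star_bags. f Q * int (card (ends Q \<inter> A)))"
proof -
  have fin: "finite star_bags" using finite_Sm by (simp add: star_bags_def)
  have "stars w = {Q\<in>star_bags. w \<in> ends Q}" for w by (auto simp: stars_def star_bags_def)
  then have "(\<Sum>w\<in>A. \<Sum>Q\<in>stars w. f Q) = (\<Sum>w\<in>A. \<Sum>Q\<in>star_bags. if w \<in> ends Q then f Q else 0)"
    using fin by (simp add: sum.inter_filter)
  also have "\<dots> = (\<Sum>Q\<in>star_bags. \<Sum>w\<in>A. if w \<in> ends Q then f Q else 0)" by (rule sum.swap)
  also have "\<dots> = (\<Sum>Q\<in>star_bags. f Q * int (card (ends Q \<inter> A)))"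
    using assms by (intro sum.cong) (simp_all add: sum.If_cases Int_commute)
  finally show ?thesis .
qed

text \<open>Otherwise all edges are light and form a matching, although ends of light edges have
  degree at least 2.\<close>

lemma Bg_nonempty: "Bg \<noteq> {}"
proof
  assume empty: "Bg = {}"
  have "E \<noteq> {}"
  proof
    assume "E = {}"
    then have "good_off k E (\<lambda>_. 0) {}" by (simp add: good_off_def proper_edge_colouring_def)
    then show False using none by blast
  qed
  then obtain u v where e: "{u,v} \<in> E" using simple_edges_cases[OF E] by (metis ex_in_conv)
  then have "u \<in> nb E v" "v \<in> nb E u" by (auto simp: nb_def insert_commute)
  then have "u \<in> Sm" "v \<in> Sm" using nb_Bg_or_Sm empty by blast+
  then have l: "light k E u v" using small_light e by blast
  have "nb E u \<subseteq> {v}"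
  proof
    fix y assume y: "y \<in> nb E u"
    then have "light k E u y" using small_light[of u y] nb_Bg_or_Sm[OF y] empty \<open>u \<in> Sm\<close> by (auto simp: nb_def)
    then show "y \<in> {v}" using light_unique[OF l] by auto
  qed
  then have "card (nb E u) \<le> 1" using card_mono[of "{v}" "nb E u"] by simp
  then show False using light_deg_ge_2[OF l] card_nb[OF E, of u] by simp
qed

lemma bags_ok:
  assumes "simple_graph V E" "Q \<in> bag ` Sm"
  shows "Q \<subseteq> V - Bg \<and> (\<exists>u v. Q = {u,v} \<and> (u = v \<or> {u,v} \<in> E))"
proof -
  obtain v where v: "v \<in> Sm" "Q = bag v" using assms(2) by auto
  have "z \<in> V" if z: "z \<in> Sm" for z
  proof -
    have "incident_edges E z \<noteq> {}" using z by (auto simp: Sm_def graph_degree_def)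
    then show ?thesis using assms(1) by (auto simp: incident_edges_def simple_graph_def)
  qed
  then have "Q \<subseteq> V - Bg" using bag_sub[OF v(1)] v(2) Bg_Sm_disjoint by blast
  moreover have "\<exists>u v. Q = {u,v} \<and> (u = v \<or> {u,v} \<in> E)"
    using v(1) by (cases rule: bag_cases) (use v(2) in blast)+
  ultimately show ?thesis by blast
qed

lemma Bg_sub: "simple_graph V E \<Longrightarrow> Bg \<subseteq> V"
proof
  fix z assume G: "simple_graph V E" and "z \<in> Bg"
  then have "incident_edges E z \<noteq> {}" by (auto simp: Bg_def graph_degree_def)
  then show "z \<in> V" using G by (auto simp: incident_edges_def simple_graph_def)
qed

lemma star_count_planar:
  assumes G: "simple_graph V E" "planar V E"
  shows "(\<Sum>Q\<in>{Q\<in>star_bags. 3 \<le> card (ends Q \<inter> Bl)}. card (ends Q \<inter> Bl))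
    \<le> 2 * (card Bl + card {Q\<in>star_bags. 3 \<le> card (ends Q \<inter> Bl)})"
proof (cases "Bl = {}")
  case False
  let ?Q = "{Q\<in>star_bags. 3 \<le> card (ends Q \<inter> Bl)}"
  have Bl: "Bl \<subseteq> Bg" by (auto simp: Bl_def)
  have e: "{b\<in>Bl. \<exists>v\<in>X. {v,b} \<in> E} = ends X \<inter> Bl" for X using Bl by (auto simp: ends_def)
  have "(\<Sum>X\<in>?Q. card {b\<in>Bl. \<exists>v\<in>X. {v,b} \<in> E}) < 2 * (card Bl + card ?Q)"
  proof (rule bag_minor_bound(2)[of V E Bl "bag ` Sm" ?Q "{}" "{}"])
    show "X \<subseteq> V - Bl \<and> (\<exists>u v. X = {u,v} \<and> (u = v \<or> {u,v} \<in> E))" if "X \<in> bag ` Sm" for X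
      using bags_ok[OF G(1) that] Bl by blast
  qed (use G Bg_sub[OF G(1)] Bl False bag_disjoint in \<open>auto simp: star_bags_def\<close>)
  then show ?thesis unfolding e by simp
qed simp

text \<open>Each edge of the minor between big vertices is seen from both ends by
  \<open>linked\<close>, so the edge bound is doubled. A pair joined through several two-ended bags
  is represented by one of them, and a pair that is already adjacent by its edge.\<close>

lemma link_count_planar:
  assumes G: "simple_graph V E" "planar V E"
  shows "(\<Sum>w\<in>Bg. card (linked w)) + 2 * (\<Sum>Q\<in>star_bags. card (ends Q)) < 6 * (card Bg + card star_bags)"
proof -
  define H where "H = {e\<in>E. e \<subseteq> Bg}"
  define P where "P = {e. e \<subseteq> Bg \<and> card e = 2 \<and> e \<notin> E \<and> (\<exists>Q\<in>bag ` Sm. ends Q = e)}"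
  define con where "con e = (SOME Q. Q \<in> bag ` Sm \<and> ends Q = e)" for e
  have con: "con e \<in> bag ` Sm" "ends (con e) = e" if "e \<in> P" for e
    using that someI_ex[of "\<lambda>Q. Q \<in> bag ` Sm \<and> ends Q = e"] unfolding P_def con_def by blast+
  have e: "{b\<in>Bg. \<exists>v\<in>X. {v,b} \<in> E} = ends X" for X by (auto simp: ends_def)
  have "card H + card P + (\<Sum>X\<in>star_bags. card {b\<in>Bg. \<exists>v\<in>X. {v,b} \<in> E}) < 3 * (card Bg + card star_bags)"
  proof (rule bag_minor_bound(1)[of V E Bg "bag ` Sm" star_bags H P con])
    show "inj_on con P" using con(2) by (metis inj_onI)
    fix e assume eP: "e \<in> P"
    have "con e \<notin> star_bags" using con(2)[OF eP] eP by (auto simp: star_bags_def P_def)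
    moreover have "\<forall>b\<in>e. \<exists>v\<in>con e. {v,b} \<in> E" using con(2)[OF eP] unfolding ends_def by blast
    ultimately show "e \<subseteq> Bg \<and> card e = 2 \<and> con e \<in> bag ` Sm - star_bags \<and> (\<forall>b\<in>e. \<exists>v\<in>con e. {v,b} \<in> E)"
      using con(1)[OF eP] eP by (simp add: P_def)
  qed (use G Bg_sub[OF G(1)] Bg_nonempty bags_ok[OF G(1)] bag_disjoint in \<open>auto simp: star_bags_def H_def P_def\<close>)
  moreover have "(\<Sum>w\<in>Bg. card (linked w)) \<le> 2 * (card H + card P)"
  proof -
    let ?F = "H \<union> P"
    have sub: "?F \<subseteq> Pow Bg" by (auto simp: H_def P_def)
    then have fin: "finite ?F" using finite_Bg by (meson finite_Pow_iff finite_subset)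
    have F: "simple_edges ?F" using fin E by (auto simp: simple_edges_def H_def P_def)
    have "linked w \<subseteq> nb ?F w" if "w \<in> Bg" for w
      using that by (auto simp: linked_def nb_def H_def P_def)
    then have "(\<Sum>w\<in>Bg. card (linked w)) \<le> (\<Sum>w\<in>Bg. card {e\<in>?F. w \<in> e})"
      using card_mono[OF finite_nb[OF F]] card_nb[OF F]
      by (intro sum_mono) (simp add: graph_degree_def incident_edges_def)
    also have "\<dots> = (\<Sum>e\<in>?F. card (e \<inter> Bg))" by (rule sum_degrees_eq[OF finite_Bg fin])
    also have "\<dots> = (\<Sum>e\<in>?F. 2)"
      using sub F by (intro sum.cong) (auto simp: simple_edges_def Int_absorb2 Pow_def subset_iff)
    also have "\<dots> = 2 * card ?F" by simp
    also have "card ?F = card H + card P"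
      using fin by (intro card_Un_disjoint) (auto simp: H_def P_def)
    finally show ?thesis .
  qed
  ultimately show ?thesis unfolding e by simp
qed

text \<open>Charges at \<open>Bl\<close> add up to at least 36 and at the other big vertices to at
  least 18. Three times the doubled edge bound pays strictly less than 18 per big vertex and per
  star bag. Nine times the bipartite bound pays the other 18 per vertex of
  \<open>Bl\<close>.\<close>

theorem not_planar:
  assumes G: "simple_graph V E" "planar V E" shows False
proof -
  \<comment> \<open>A star bag contributes 3 to each end in \<open>Bl\<close> and \<open>G'\<close>
    to each other end. The value 2 fits vertices all of whose stars have five ends; -6 is the loss
    that eight linked vertices can bear once, as 3 * 8 - 18 = 6.\<close>
  define G' :: "'a set \<Rightarrow> int" where "G' Q = (if 5 \<le> card (ends Q) then 2 else - 6)" for Q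
  define X :: "'a set \<Rightarrow> int" where "X Q = (if 3 \<le> card (ends Q \<inter> Bl) then int (card (ends Q \<inter> Bl)) - 2 else 0)" for Q
  have Bl: "Bl \<subseteq> Bg" by (auto simp: Bl_def)
  have fin: "finite Bl" "finite (Bg - Bl)" "finite star_bags"
    using finite_Bg finite_subset[OF Bl] finite_Sm by (auto simp: star_bags_def)
  let ?\<eta> = "\<lambda>w. int (card (linked w))"
  have l: "(\<Sum>w\<in>Bl. 3 * ?\<eta> w - 36 + (\<Sum>Q\<in>stars w. 3)) \<ge> 0"
    using Bl_charge by (intro sum_nonneg) force
  have m: "(\<Sum>w\<in>Bg - Bl. 3 * ?\<eta> w - 18 + (\<Sum>Q\<in>stars w. G' Q)) \<ge> 0"
  proof (rule sum_nonneg)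
    fix w assume "w \<in> Bg - Bl"
    from Bm_charge[OF this] show "0 \<le> 3 * ?\<eta> w - 18 + (\<Sum>Q\<in>stars w. G' Q)"
    proof
      assume a: "8 \<le> card (linked w) \<and> card (stars w) \<le> 1"
      have "(\<Sum>Q\<in>stars w. - 6) \<le> (\<Sum>Q\<in>stars w. G' Q)" by (intro sum_mono) (simp add: G'_def)
      then show ?thesis using a by simp
    next
      assume a: "18 \<le> 3 * card (linked w) + 2 * card (stars w) \<and> (\<forall>Q\<in>stars w. 5 \<le> card (ends Q))"
      then have "(\<Sum>Q\<in>stars w. G' Q) = (\<Sum>Q\<in>stars w. 2)" by (intro sum.cong) (auto simp: G'_def)
      then show ?thesis using a by simp
    qed
  qed
  \<comment> \<open>Balance of one star bag. Equality occurs for 2 + 1, 3 + 0 and 2 + 3 ends in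
    \<open>Bl\<close> and outside it, so these cases fix the coefficients; \<open>X\<close> is its
    excess in the bipartite bound.\<close>
  have star: "3 * int (card (ends Q \<inter> Bl)) + G' Q * int (card (ends Q \<inter> (Bg - Bl))) \<le> 6 * int (card (ends Q)) - 18 + 9 * X Q"
    if "Q \<in> star_bags" for Q
  proof -
    have "ends Q = (ends Q \<inter> Bl) \<union> (ends Q \<inter> (Bg - Bl))" by (auto simp: ends_def)
    then have D: "card (ends Q) = card (ends Q \<inter> Bl) + card (ends Q \<inter> (Bg - Bl))"
      using card_Un_disjoint[of "ends Q \<inter> Bl" "ends Q \<inter> (Bg - Bl)"] finite_ends[of Q] by (metis Diff_disjoint Int_assoc Int_commute Int_empty_right finite_Int inf_assoc)
    have "3 \<le> card (ends Q)" using that by (simp add: star_bags_def)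
    then show ?thesis using D unfolding G'_def X_def by auto
  qed
  have "(\<Sum>w\<in>Bl. 3 * ?\<eta> w - 36 + (\<Sum>Q\<in>stars w. 3)) + (\<Sum>w\<in>Bg - Bl. 3 * ?\<eta> w - 18 + (\<Sum>Q\<in>stars w. G' Q))
      = 3 * (\<Sum>w\<in>Bg. ?\<eta> w) - 36 * int (card Bl) - 18 * int (card (Bg - Bl))
        + (\<Sum>Q\<in>star_bags. 3 * int (card (ends Q \<inter> Bl)) + G' Q * int (card (ends Q \<inter> (Bg - Bl))))"
  proof -
    have "(\<Sum>w\<in>Bg. ?\<eta> w) = (\<Sum>w\<in>Bl. ?\<eta> w) + (\<Sum>w\<in>Bg - Bl. ?\<eta> w)"
      using sum.subset_diff[OF Bl finite_Bg, of ?\<eta>] by simp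
    then show ?thesis
      using sum_stars[OF fin(1), of "\<lambda>_. 3"] sum_stars[OF fin(2), of G']
      by (simp add: sum.distrib sum_subtractf sum_distrib_left[symmetric] del: sum_constant)
        (simp add: algebra_simps)
  qed
  also have "(\<Sum>Q\<in>star_bags. 3 * int (card (ends Q \<inter> Bl)) + G' Q * int (card (ends Q \<inter> (Bg - Bl))))
      \<le> (\<Sum>Q\<in>star_bags. 6 * int (card (ends Q)) - 18 + 9 * X Q)"
    by (rule sum_mono[OF star])
  also have "\<dots> = 6 * (\<Sum>Q\<in>star_bags. int (card (ends Q))) - 18 * int (card star_bags) + 9 * (\<Sum>Q\<in>star_bags. X Q)"
    by (simp add: sum.distrib sum_subtractf sum_distrib_left)
  finally have total: "0 \<le> 3 * (\<Sum>w\<in>Bg. ?\<eta> w) - 36 * int (card Bl) - 18 * int (card (Bg - Bl))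
      + (6 * (\<Sum>Q\<in>star_bags. int (card (ends Q))) - 18 * int (card star_bags) + 9 * (\<Sum>Q\<in>star_bags. X Q))"
    using l m by linarith
  have charge: False if "x \<le> 2 * l" "b = l + m" "e + 2 * d < 6 * (b + q)"
    "0 \<le> 3 * e - 36 * l - 18 * m + (6 * d - 18 * q + 9 * x)" for x l b m e d q :: int
    using that by presburger
  have "(\<Sum>Q\<in>star_bags. X Q) \<le> 2 * int (card Bl)"
  proof -
    let ?Q = "{Q\<in>star_bags. 3 \<le> card (ends Q \<inter> Bl)}"
    have "(\<Sum>Q\<in>star_bags. X Q) = (\<Sum>Q\<in>?Q. int (card (ends Q \<inter> Bl)) - 2)"
      unfolding X_def using fin(3) by (simp add: sum.inter_filter)
    also have "\<dots> = int (\<Sum>Q\<in>?Q. card (ends Q \<inter> Bl)) - 2 * int (card ?Q)" by (simp add: sum_subtractf)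
    also have "\<dots> \<le> int (2 * (card Bl + card ?Q)) - 2 * int (card ?Q)"
      by (intro diff_right_mono zle_int[THEN iffD2] star_count_planar[OF G])
    finally show ?thesis by simp
  qed
  moreover have "int (card Bg) = int (card Bl) + int (card (Bg - Bl))"
    using card_Diff_subset[OF fin(1) Bl] card_mono[OF finite_Bg Bl] by simp
  moreover have "(\<Sum>w\<in>Bg. ?\<eta> w) + 2 * (\<Sum>Q\<in>star_bags. int (card (ends Q))) < 6 * (int (card Bg) + int (card star_bags))"
    using link_count_planar[OF G] by (simp flip: of_nat_sum)
  ultimately show False using total by (rule charge)
qed

end

section \<open>From the minimal counterexample to the theorem\<close>

lemma planar_mono:
  assumes "planar V E" "D \<subseteq> E" shows "planar V D"
  using assms unfolding planar_def plane_drawing_def by (meson subsetD)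

theorem planar_good_colouring:
  assumes "simple_graph V E" "planar V E" "\<And>v. deg E v < k" "29 \<le> k"
  shows "\<exists>c. good_off k E c {}"
  using assms
proof (induction "card E" arbitrary: E rule: less_induct)
  case less
  have "E \<subseteq> Pow V" using less.prems(1) by (auto simp: simple_graph_def)
  then have "finite E" using less.prems(1) by (meson finite_Pow_iff finite_subset simple_graph_def)
  then have E: "simple_edges E" using less.prems(1) by (simp add: simple_graph_def simple_edges_def)
  have sub: "\<exists>c. good_off k D c {}" if D: "D \<subset> E" for D
  proof (rule less.hyps)
    show "card D < card E" using D \<open>finite E\<close> psubset_card_mono by blast
    show "simple_graph V D" using D less.prems(1) by (auto simp: simple_graph_def)
    show "planar V D" using planar_mono[OF less.prems(2)] D by blast
    show "deg D v < k" for v using deg_mono[OF E, of D v] D less.prems(3)[of v] by auto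
  qed (rule less.prems(4))
  show ?case
  proof (rule ccontr)
    assume no: "\<not> ?case"
    interpret minimal_counterexample E k
      by standard (use E less.prems sub no in auto)
    show False using not_planar less.prems(1,2) by blast
  qed
qed

text \<open>The exemption in \<open>good_off\<close> concerns exactly such edges, so in a graph
  without isolated edges it never applies.\<close>

lemma pendant_edge_isolated:
  assumes G: "simple_graph V E" and e: "{u,v} \<in> E" "deg E u = 1" "deg E v = 1"
  shows "isolated_edge V E {u,v}"
proof -
  have mem: "{u,v} \<in> incident_edges E u" "{u,v} \<in> incident_edges E v" using e(1) by (auto simp: incident_edges_def)
  have inc: "incident_edges E u = {{u,v}}" "incident_edges E v = {{u,v}}"
    using e(2,3) mem unfolding graph_degree_def by (metis card_1_singletonE singletonD)+
  have uV: "u \<in> V" using G e(1) by (auto simp: simple_graph_def)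
  let ?C = "connected_relation V E `` {u}"
  have "z \<in> {u,v}" if "(u,z) \<in> {(u, v). {u, v} \<in> E}\<^sup>*" for z
    using that
  proof (induction rule: rtrancl_induct)
    case (step y z)
    then have "{y,z} \<in> incident_edges E y" "incident_edges E y = {{u,v}}" using inc by (auto simp: incident_edges_def)
    then have "{y,z} = {u,v}" by auto
    then show ?case by (auto simp: doubleton_eq_iff)
  qed simp
  then have C: "?C \<subseteq> {u,v}" by (auto simp: connected_relation_def)
  have "v \<in> V" using G e(1) by (auto simp: simple_graph_def)
  then have "{u,v} \<subseteq> ?C" using uV e(1) by (auto simp: connected_relation_def)
  then have C': "?C = {u,v}" using C by blast
  have "f = {u,v}" if "f \<in> E" "f \<subseteq> {u,v}" for f
  proof -
    have "card f = 2" using G that(1) by (simp add: simple_graph_def)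
    moreover have "card {u,v} = 2" using G e(1) by (simp add: simple_graph_def)
    ultimately show ?thesis using card_subset_eq[of "{u,v}" f] that(2) by simp
  qed
  then have "{f \<in> E. f \<subseteq> ?C} = {{u,v}}" unfolding C' using e(1) by blast
  moreover have "?C \<in> graph_components V E" unfolding graph_components_def using uV by (rule quotientI)
  ultimately show ?thesis unfolding isolated_edge_def by blast
qed

theorem theorem2:
  fixes V :: "'a set" and E :: "'a set set"
  assumes "simple_graph V E"
    and "planar V E"
    and "max_degree V E \<ge> 28"
    and "\<not> (\<exists>e. isolated_edge V E e)"
  shows "nsd_index E \<le> max_degree V E + 1 \<and>
    (\<exists>c. nsd_colouring E (max_degree V E + 1) c)"
proof -
  let ?k = "max_degree V E + 1"
  have "deg E v < ?k" for v
  proof (cases "v \<in> V")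
    case True
    have "finite (graph_degree E ` V)" using assms(1) by (simp add: simple_graph_def)
    then have "deg E v \<le> max_degree V E"
      unfolding max_degree_def using True by (intro cSUP_upper) (auto intro: bdd_above_finite)
    then show ?thesis by simp
  next
    case False
    then have "incident_edges E v = {}" using assms(1) by (auto simp: incident_edges_def simple_graph_def)
    then show ?thesis by (simp add: graph_degree_def)
  qed
  then obtain c where c: "good_off ?k E c {}"
    using planar_good_colouring[of V E ?k] assms(1-3) by auto
  have "nsd_colouring E ?k c"
    unfolding nsd_colouring_def
  proof (intro conjI allI impI good_off_proper[OF c])
    fix u v assume e: "{u,v} \<in> E"
    then have "csum E c u \<noteq> csum E c v"
      using good_offD[OF c e] pendant_edge_isolated[OF assms(1) e] assms(4) by auto
    then show "(\<Sum>e\<in>incident_edges E u. c e) \<noteq> (\<Sum>e\<in>incident_edges E v. c e)" by (simp add: csum_def)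
  qed
  then show ?thesis unfolding nsd_index_def by (metis Least_le)
qed

end
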